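(* Let $\widehat{R}(T,X,Y)\in \mathbb{C}[T, X, Y]$ be a homogeneous polynomial defining a smooth curve $\mathcal{C} \subset \mathbb{P}^2$, and assume that the divisors in $\mathbb{P}^2$ given by $\widehat{R}$ and its partial derivatives $\widehat{R}_T, \widehat{R}_X, \widehat{R}_Y$ are in general position (i.e., any intersection of them has the expected codimension). Dehomogenizing by setting $T = 1$ yields an affine polynomial $R(x,y) \in \mathbb{C}[x,y]$ such that $\mathcal{C} \cap \{T \neq 0\} = \{R=0\}$. For any weighted order $m$, every global section of the invariant logarithmic $2$-jet differential bundle $E_{2,m}T^*_{\mathbb{P}^2}(\log\mathcal{C})$ on $\mathbb{P}^2$, when restricted to the affine open set $\{R_y \neq 0\}\subset \{T\neq 0\}$, admits the general expression \[ J_{xR} = \sum_{\substack{0 \leqslant k \leqslant \lfloor m/3 \rfloor \\ 0 \leqslant j \leqslant m-3k}} \frac{F_{j,k}}{R_y^{\,m-2k}}\, (x')^{m-3k-j}\Bigl(\frac{R'}{R}\Bigr)^{j}\, \bigl(\Delta_{xR}'''\bigr)^k, \] where $F_{j,k} \in \mathbb{C}[x,y]$ are polynomials.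
   Context: Everything is over $\mathbb{C}$; $[T:X:Y]$ are homogeneous coordinates on $\mathbb{P}^2$ and $(x,y)=(X/T,Y/T)$. Subscripts on $R$ denote partial derivatives. For a curve germ $\zeta\mapsto(x(\zeta),y(\zeta))$ with derivatives denoted by primes, put $R'=x'R_x+y'R_y$, $R''=x''R_x+y''R_y+x'x'R_{xx}+2x'y'R_{xy}+y'y'R_{yy}$, and \[ \Delta_{xR}'''=\begin{vmatrix} x' & (\log R)' \\ {x''} & (\log R)'' \end{vmatrix},\qquad (\log R)'=\frac{R'}{R},\quad (\log R)''=\frac{R''}{R}-\frac{R'^2}{R^2}. \] $E_{2,m}T_{\mathbb{P}^2}^*(\log\mathcal{C})$ is the (Demailly--Semple) bundle of invariant logarithmic $2$-jet differentials of weighted degree $m$: in local coordinates $(x_1,x_2)$ away from $\mathcal{C}$ its local sections are the expressions $\sum_{0\leqslant j\leqslant\lfloor m/3\rfloor}\sum_{\alpha_1+\alpha_2=m-3j}R_{\alpha_1,\alpha_2,j}(x_1,x_2)(\xi_1')^{\alpha_1}(\xi_2')^{\alpha_2}(\xi_1'\xi_2''-\xi_2'\xi_1'')^j$ with $R_{\alpha_1,\alpha_2,j}$ holomorphic and $\xi_i^{(k)}=x_i^{(k)}$; near a point of $\mathcal{C}=\{x_1=0\}$ one uses instead $\xi_1^{(k)}=(\log x_1)^{(k)}$, $\xi_2^{(k)}=x_2^{(k)}$ ($k=1,2$). *)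

theory Defs
  imports "HOL-Analysis.Analysis" "HOL-Computational_Algebra.Polynomial"
begin

section \<open>The projective plane\<close>

definition proportional :: "complex^3 \<Rightarrow> complex^3 \<Rightarrow> bool" where
  "proportional v w \<longleftrightarrow> v \<noteq> 0 \<and> w \<noteq> 0 \<and> (\<exists>c. w = c *s v)"

lemma part_equivp_proportional: "part_equivp proportional"
proof (rule part_equivpI)
  have "proportional (axis 1 1) (axis 1 1)"
    unfolding proportional_def by (auto intro!: exI[of _ 1])
  then show "\<exists>v. proportional v v" by blast
  show "symp proportional"
  proof (rule sympI)
    fix v w assume "proportional v w"
    then obtain c where c: "v \<noteq> 0" "w \<noteq> 0" "w = c *s v"
      unfolding proportional_def by blast
    then have "c \<noteq> 0" by auto
    then have "v = inverse c *s w"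
      using c by (simp add: vector_smult_assoc)
    then show "proportional w v"
      using c unfolding proportional_def by blast
  qed
  show "transp proportional"
    unfolding transp_def proportional_def by (metis vector_smult_assoc)
qed

quotient_type p2 = "complex^3" / partial: proportional
  morphisms rep_p2 hom_coords
  by (rule part_equivp_proportional)

text \<open>
  For \<open>v \<noteq> 0\<close>, \<open>hom_coords v\<close> is the point \<open>[v$1 : v$2 : v$3]\<close>; the homogeneous coordinates
  are \<open>T = v$1\<close>, \<open>X = v$2\<close>, \<open>Y = v$3\<close>.  The value of \<open>hom_coords\<close> at \<open>0\<close> is meaningless, so
  \<open>v \<noteq> 0\<close> is required wherever it is used.
\<close>

definition cone :: "p2 set \<Rightarrow> (complex^3) set" where
  "cone U = {v. v \<noteq> 0 \<and> hom_coords v \<in> U}"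

definition p2_open :: "p2 set \<Rightarrow> bool" where
  "p2_open U \<longleftrightarrow> open (cone U)"


section \<open>Holomorphic maps, local coordinates and curve germs\<close>

text \<open>Holomorphy in several variables, on open sets \<open>S\<close>: the real derivative exists and is
  complex linear at every point.\<close>

definition mholomorphic_on :: "(complex^'n \<Rightarrow> complex) \<Rightarrow> (complex^'n) set \<Rightarrow> bool" where
  "mholomorphic_on f S \<longleftrightarrow>
     (\<forall>z\<in>S. \<exists>a::complex^'n. (f has_derivative (\<lambda>h. \<Sum>i\<in>UNIV. a$i * h$i)) (at z))"

definition p2_holomorphic_on :: "(p2 \<Rightarrow> complex) \<Rightarrow> p2 set \<Rightarrow> bool" where
  "p2_holomorphic_on g U \<longleftrightarrow> mholomorphic_on (\<lambda>v. g (hom_coords v)) (cone U)"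

text \<open>A map into the projective plane is holomorphic iff it locally has a holomorphic lift to
  nonzero vectors.\<close>

definition holomorphic_into_p2 :: "(complex^'n \<Rightarrow> p2) \<Rightarrow> (complex^'n) set \<Rightarrow> bool" where
  "holomorphic_into_p2 \<psi> V \<longleftrightarrow>
     (\<forall>z\<in>V. \<exists>S g. open S \<and> z \<in> S \<and> (\<forall>i. mholomorphic_on (\<lambda>w. g w $ i) S) \<and>
        (\<forall>w\<in>S. g w \<noteq> 0 \<and> \<psi> w = hom_coords (g w)))"

text \<open>\<open>\<phi> = (x\<^sub>1, x\<^sub>2)\<close> maps the open set \<open>U\<close> biholomorphically onto an open subset of the plane.\<close>

definition local_coordinates :: "p2 set \<Rightarrow> (p2 \<Rightarrow> complex^2) \<Rightarrow> bool" where
  "local_coordinates U \<phi> \<longleftrightarrow>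
     p2_open U \<and> open (\<phi> ` U) \<and> inj_on \<phi> U \<and>
     (\<forall>i. p2_holomorphic_on (\<lambda>q. \<phi> q $ i) U) \<and>
     holomorphic_into_p2 (the_inv_into U \<phi>) (\<phi> ` U)"

text \<open>All curve germs are based at the parameter value \<open>\<zeta> = 0\<close>.\<close>

definition curve_germ :: "(complex \<Rightarrow> p2) \<Rightarrow> bool" where
  "curve_germ f \<longleftrightarrow>
     (\<exists>g. (\<forall>i. (\<lambda>\<zeta>. g \<zeta> $ i) analytic_on {0}) \<and> g 0 \<noteq> 0 \<and>
          (\<forall>\<^sub>F \<zeta> in nhds 0. f \<zeta> = hom_coords (g \<zeta>)))"


section \<open>Polynomials and plane curves\<close>

text \<open>
  \<open>\<complex>[T,X,Y]\<close> is the iterated polynomial ring \<open>\<complex>[T][X][Y]\<close>, with \<open>T\<close> the innermost variable;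
  likewise \<open>\<complex>[x,y]\<close> is \<open>\<complex>[x][y]\<close>.
\<close>

type_synonym poly_TXY = "complex poly poly poly"
type_synonym poly_xy = "complex poly poly"

definition eval3 :: "poly_TXY \<Rightarrow> complex^3 \<Rightarrow> complex" where
  "eval3 P v = poly (poly (poly P [:[:v$3:]:]) [:v$2:]) (v$1)"

definition eval2 :: "poly_xy \<Rightarrow> complex \<Rightarrow> complex \<Rightarrow> complex" where
  "eval2 F x y = poly (poly F [:y:]) x"

definition homogeneous :: "poly_TXY \<Rightarrow> nat \<Rightarrow> bool" where
  "homogeneous P d \<longleftrightarrow> (\<forall>i j k. coeff (coeff (coeff P k) j) i \<noteq> 0 \<longrightarrow> i + j + k = d)"

definition d_T :: "poly_TXY \<Rightarrow> poly_TXY" where "d_T P = map_poly (map_poly pderiv) P"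
definition d_X :: "poly_TXY \<Rightarrow> poly_TXY" where "d_X P = map_poly pderiv P"
definition d_Y :: "poly_TXY \<Rightarrow> poly_TXY" where "d_Y P = pderiv P"

definition d_x :: "poly_xy \<Rightarrow> poly_xy" where "d_x F = map_poly pderiv F"
definition d_y :: "poly_xy \<Rightarrow> poly_xy" where "d_y F = pderiv F"

text \<open>Setting \<open>T = 1\<close>:\<close>

definition dehomogenize :: "poly_TXY \<Rightarrow> poly_xy" where
  "dehomogenize P = map_poly (map_poly (\<lambda>p. poly p 1)) P"

definition zero_locus :: "poly_TXY \<Rightarrow> p2 set" where
  "zero_locus P = {hom_coords v | v. v \<noteq> 0 \<and> eval3 P v = 0}"

text \<open>\<open>P\<close> is a nonconstant form, and \<open>P = 0\<close> is smooth as a scheme (Jacobian criterion).\<close>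

definition defines_smooth_curve :: "poly_TXY \<Rightarrow> nat \<Rightarrow> bool" where
  "defines_smooth_curve P d \<longleftrightarrow> homogeneous P d \<and> d \<ge> 1 \<and>
     (\<forall>v. v \<noteq> 0 \<and> eval3 P v = 0 \<longrightarrow>
        \<not> (eval3 (d_T P) v = 0 \<and> eval3 (d_X P) v = 0 \<and> eval3 (d_Y P) v = 0))"

text \<open>
  Codimension at least \<open>n\<close>, for Zariski closed subsets of the projective plane: these are the
  whole plane (codimension 0), finite unions of curves and points (codimension 1 if a curve
  occurs), finite sets of points (codimension 2), and the empty set, which counts as having any
  codimension.
\<close>

definition codim_ge :: "p2 set \<Rightarrow> nat \<Rightarrow> bool" where
  "codim_ge A n \<longleftrightarrow>
     (if n = 0 then True else if n = 1 then A \<noteq> UNIV else if n = 2 then finite A else A = {})"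

text \<open>
  The divisors are indexed, so that coinciding ones among them count separately.  An intersection
  of \<open>n\<close> divisors never has codimension greater than \<open>n\<close> unless it is empty, hence having the
  expected codimension amounts to a lower bound.
\<close>

definition general_position :: "poly_TXY list \<Rightarrow> bool" where
  "general_position Ps \<longleftrightarrow>
     (\<forall>I. I \<subseteq> {..<length Ps} \<longrightarrow> codim_ge (\<Inter>i\<in>I. zero_locus (Ps ! i)) (card I))"


section \<open>Invariant logarithmic 2-jet differentials\<close>

text \<open>
  The expression of weighted degree \<open>m\<close> with coefficients \<open>A \<alpha>\<^sub>1 \<alpha>\<^sub>2 j\<close> evaluated at \<open>z\<close>, where
  \<open>(u1, u2)\<close> and \<open>(w1, w2)\<close> are the first and second derivatives of \<open>(\<xi>\<^sub>1, \<xi>\<^sub>2)\<close>.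
\<close>

definition jet_expression ::
  "nat \<Rightarrow> (nat \<Rightarrow> nat \<Rightarrow> nat \<Rightarrow> complex^2 \<Rightarrow> complex) \<Rightarrow> complex^2 \<Rightarrow>
   complex \<Rightarrow> complex \<Rightarrow> complex \<Rightarrow> complex \<Rightarrow> complex" where
  "jet_expression m A z u1 u2 w1 w2 =
     (\<Sum>j\<le>m div 3. \<Sum>(\<alpha>1, \<alpha>2)\<in>{(\<alpha>1, \<alpha>2). \<alpha>1 + \<alpha>2 = m - 3 * j}.
        A \<alpha>1 \<alpha>2 j z * u1 ^ \<alpha>1 * u2 ^ \<alpha>2 * (u1 * w2 - u2 * w1) ^ j)"

text \<open>
  The logarithm is multivalued; its first and second derivatives along a curve are not.
\<close>

definition D1 :: "(complex \<Rightarrow> complex) \<Rightarrow> complex" where "D1 h = deriv h 0"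
definition D2 :: "(complex \<Rightarrow> complex) \<Rightarrow> complex" where "D2 h = deriv (deriv h) 0"
definition logD1 :: "(complex \<Rightarrow> complex) \<Rightarrow> complex" where "logD1 h = D1 h / h 0"
definition logD2 :: "(complex \<Rightarrow> complex) \<Rightarrow> complex" where
  "logD2 h = D2 h / h 0 - (D1 h)\<^sup>2 / (h 0)\<^sup>2"

text \<open>
  A section is given by its values on the germs of holomorphic curves starting off \<open>C\<close> (its
  values on germs starting on \<open>C\<close> are irrelevant); since the bundle is locally free, this
  determines the section, and sections over the whole plane are those which near every point
  have the local form prescribed there.  That the value depends only on the 2-jet of the germ at
  \<open>0\<close> is part of the local form.
\<close>

definition plain_local_form ::
  "p2 set \<Rightarrow> nat \<Rightarrow> ((complex \<Rightarrow> p2) \<Rightarrow> complex) \<Rightarrow> p2 \<Rightarrow> bool" where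
  "plain_local_form C m J p \<longleftrightarrow>
     (\<exists>U \<phi> A. local_coordinates U \<phi> \<and> p \<in> U \<and> U \<inter> C = {} \<and>
        (\<forall>\<alpha>1 \<alpha>2 j. mholomorphic_on (A \<alpha>1 \<alpha>2 j) (\<phi> ` U)) \<and>
        (\<forall>f. curve_germ f \<and> f 0 \<in> U \<longrightarrow>
           (let x1 = (\<lambda>\<zeta>. \<phi> (f \<zeta>) $ 1); x2 = (\<lambda>\<zeta>. \<phi> (f \<zeta>) $ 2)
            in J f = jet_expression m A (\<phi> (f 0)) (D1 x1) (D1 x2) (D2 x1) (D2 x2))))"

definition log_local_form ::
  "p2 set \<Rightarrow> nat \<Rightarrow> ((complex \<Rightarrow> p2) \<Rightarrow> complex) \<Rightarrow> p2 \<Rightarrow> bool" where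
  "log_local_form C m J p \<longleftrightarrow>
     (\<exists>U \<phi> A. local_coordinates U \<phi> \<and> p \<in> U \<and> U \<inter> C = {q \<in> U. \<phi> q $ 1 = 0} \<and>
        (\<forall>\<alpha>1 \<alpha>2 j. mholomorphic_on (A \<alpha>1 \<alpha>2 j) (\<phi> ` U)) \<and>
        (\<forall>f. curve_germ f \<and> f 0 \<in> U - C \<longrightarrow>
           (let x1 = (\<lambda>\<zeta>. \<phi> (f \<zeta>) $ 1); x2 = (\<lambda>\<zeta>. \<phi> (f \<zeta>) $ 2)
            in J f = jet_expression m A (\<phi> (f 0)) (logD1 x1) (D1 x2) (logD2 x1) (D2 x2))))"

definition log_jet_differential ::
  "p2 set \<Rightarrow> nat \<Rightarrow> ((complex \<Rightarrow> p2) \<Rightarrow> complex) \<Rightarrow> bool" where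
  "log_jet_differential C m J \<longleftrightarrow>
     (\<forall>p. p \<notin> C \<longrightarrow> plain_local_form C m J p) \<and> (\<forall>p\<in>C. log_local_form C m J p)"


section \<open>Derivatives of a polynomial along an affine curve germ\<close>

definition along :: "poly_xy \<Rightarrow> (complex \<Rightarrow> complex) \<Rightarrow> (complex \<Rightarrow> complex) \<Rightarrow> complex" where
  "along F x y = eval2 F (x 0) (y 0)"

definition jet1 :: "poly_xy \<Rightarrow> (complex \<Rightarrow> complex) \<Rightarrow> (complex \<Rightarrow> complex) \<Rightarrow> complex" where
  "jet1 R x y = D1 x * along (d_x R) x y + D1 y * along (d_y R) x y"

definition jet2 :: "poly_xy \<Rightarrow> (complex \<Rightarrow> complex) \<Rightarrow> (complex \<Rightarrow> complex) \<Rightarrow> complex" where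
  "jet2 R x y =
     D2 x * along (d_x R) x y + D2 y * along (d_y R) x y
     + D1 x * D1 x * along (d_x (d_x R)) x y
     + 2 * D1 x * D1 y * along (d_y (d_x R)) x y
     + D1 y * D1 y * along (d_y (d_y R)) x y"

definition log_jet1 :: "poly_xy \<Rightarrow> (complex \<Rightarrow> complex) \<Rightarrow> (complex \<Rightarrow> complex) \<Rightarrow> complex" where
  "log_jet1 R x y = jet1 R x y / along R x y"

definition log_jet2 :: "poly_xy \<Rightarrow> (complex \<Rightarrow> complex) \<Rightarrow> (complex \<Rightarrow> complex) \<Rightarrow> complex" where
  "log_jet2 R x y = jet2 R x y / along R x y - (jet1 R x y)\<^sup>2 / (along R x y)\<^sup>2"

definition Delta_xR :: "poly_xy \<Rightarrow> (complex \<Rightarrow> complex) \<Rightarrow> (complex \<Rightarrow> complex) \<Rightarrow> complex" where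
  "Delta_xR R x y = D1 x * log_jet2 R x y - log_jet1 R x y * D2 x"

end

theory Submission
  imports Defs "HOL-Complex_Analysis.Complex_Analysis"
begin

text \<open>
  Where \<open>R\<^sub>y \<noteq> 0\<close>, the value of \<open>J\<close> on a germ off the curve \<open>C\<close> depends only on the base point and on \<open>x'\<close>,
  \<open>R' / R\<close> and \<open>\<Delta>\<close>, because jet differentials are invariant. Writing these as
  \<open>x' = p R\<^sub>y\<close>, \<open>R' / R = q R\<^sub>y\<close>, \<open>\<Delta> = r R\<^sub>y\<close>, the claim says that
  \<open>J = \<Sum> F\<^sub>j\<^sub>k p\<^bsup>m-3k-j\<^esup> q\<^sup>j r\<^sup>k\<close> with polynomial coefficients. The point of these parameters is that
  \<open>y' = q R - p R\<^sub>x\<close> and \<open>x' y'' - y' x''\<close> are polynomial in \<open>p, q, r, R\<close> and the derivatives of \<open>R\<close>. At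
  every point off \<open>C\<close>, whether or not \<open>R\<^sub>y\<close> vanishes there, the local form of \<open>J\<close> therefore is a weighted
  homogeneous polynomial in \<open>(p, q, r)\<close> (\<open>plain_form_coefficients\<close>); its coefficients are the \<open>F\<^sub>j\<^sub>k\<close>.

  By interpolation the \<open>F\<^sub>j\<^sub>k\<close> are linear combinations of values of \<open>J\<close> on explicit germs
  (\<open>coefficient_interpolation\<close>), which yields three facts. Off \<open>C\<close> they are holomorphic
  (\<open>bihol_at_coefficient\<close>). Near \<open>C\<close> they are bounded (\<open>coefficient_bounded_near_curve\<close>): the germs used have
  bounded logarithmic jets with respect to \<open>R\<close>, and passing from \<open>R\<close> to the first coordinate \<open>\<phi>\<^sub>1\<close> of a
  logarithmic chart costs only a bounded amount, because \<open>\<phi>\<^sub>1\<close> and \<open>R\<close> both are reduced equations of \<open>C\<close>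
  (\<open>holomorphic_ratio_bound\<close>). Towards a point at infinity off \<open>C\<close> they grow at most polynomially
  (\<open>coefficient_growth\<close>), as the local form there has bounded coefficients.

  It then suffices to use one complex variable. General position implies that \<open>C\<close> does not contain the
  line at infinity (\<open>infinity_not_contained\<close>), so there are two different directions whose points at infinity
  lie off \<open>C\<close>. On a line in such a direction, \<open>F\<^sub>j\<^sub>k\<close> is holomorphic except at finitely many points, near which it is
  bounded, and it has polynomial growth; hence it is a polynomial, of degree bounded independently of the line. A
  function that is polynomial along two families of parallel lines in this way is a polynomial in two
  variables (\<open>separately_polynomial\<close>).
\<close>

no_notation fps_nth (infixl "$" 75)

section \<open>Separately holomorphic functions of two variables\<close>

text \<open>
  Separate holomorphy together with a bound on a polydisc. By Osgood's lemma this is holomorphy in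
  two variables; stated this way it is inherited by partial derivatives through one-variable Cauchy
  estimates alone.
\<close>

definition bihol_on :: "(complex \<Rightarrow> complex \<Rightarrow> complex) \<Rightarrow> complex \<Rightarrow> complex \<Rightarrow> real \<Rightarrow> real \<Rightarrow> bool"
  where "bihol_on K a b r M \<longleftrightarrow> 0 < r \<and>
    (\<forall>x\<in>ball a r. \<forall>y\<in>ball b r. norm (K x y) \<le> M) \<and>
    (\<forall>x\<in>ball a r. (\<lambda>y. K x y) holomorphic_on ball b r) \<and>
    (\<forall>y\<in>ball b r. (\<lambda>x. K x y) holomorphic_on ball a r)"

definition bihol_at :: "(complex \<Rightarrow> complex \<Rightarrow> complex) \<Rightarrow> complex \<Rightarrow> complex \<Rightarrow> bool"
  where "bihol_at K a b \<longleftrightarrow> (\<exists>r M. bihol_on K a b r M)"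

abbreviation dx :: "(complex \<Rightarrow> complex \<Rightarrow> complex) \<Rightarrow> complex \<Rightarrow> complex \<Rightarrow> complex"
  where "dx K \<equiv> \<lambda>x y. deriv (\<lambda>t. K t y) x"

abbreviation dy :: "(complex \<Rightarrow> complex \<Rightarrow> complex) \<Rightarrow> complex \<Rightarrow> complex \<Rightarrow> complex"
  where "dy K \<equiv> \<lambda>x y. deriv (\<lambda>t. K x t) y"

lemma bihol_on_flip: "bihol_on K a b r M \<Longrightarrow> bihol_on (\<lambda>x y. K y x) b a r M"
  by (auto simp: bihol_on_def)

lemma bihol_at_flip: "bihol_at K a b \<Longrightarrow> bihol_at (\<lambda>x y. K y x) b a"
  unfolding bihol_at_def using bihol_on_flip by blast

lemma ball_shift: "\<lbrakk>dist a x \<le> s; s + t \<le> r\<rbrakk> \<Longrightarrow> ball x t \<subseteq> ball (a::complex) r"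
  by (smt (verit) dist_triangle mem_ball subsetI)

lemma bihol_on_mono:
  assumes "bihol_on K a b r M" "dist a x \<le> s" "dist b y \<le> s" "s + t \<le> r" "0 < t"
  shows "bihol_on K x y t M"
proof -
  have "ball x t \<subseteq> ball a r" "ball y t \<subseteq> ball b r"
    by (rule ball_shift[OF assms(2,4)], rule ball_shift[OF assms(3,4)])
  with assms(1,5) show ?thesis
    unfolding bihol_on_def by (blast intro: holomorphic_on_subset)
qed

lemma deriv_bound:
  fixes f :: "complex \<Rightarrow> complex"
  assumes "f holomorphic_on ball b r" "\<And>y. y \<in> ball b r \<Longrightarrow> norm (f y) \<le> M"
    and "ball y t \<subseteq> ball b r" "0 < t"
  shows "norm ((deriv ^^ n) f y) \<le> fact n * M / (t/2) ^ n"
proof (rule Cauchy_inequality)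
  have sub: "cball y (t/2) \<subseteq> ball b r"
    using assms(4) by (intro subset_trans[OF _ assms(3)]) (simp add: cball_subset_ball_iff)
  show "f holomorphic_on ball y (t/2)"
    using assms(1) by (rule holomorphic_on_subset) (use sub ball_subset_cball in blast)
  show "continuous_on (cball y (t/2)) f"
    using assms(1) sub holomorphic_on_imp_continuous_on holomorphic_on_subset by blast
  show "norm (f x) \<le> M" if "norm (y - x) = t/2" for x
    using that sub assms(2) by (auto simp: dist_norm subset_iff)
qed (use assms in auto)

text \<open>
  The derivative in one variable is a limit of difference quotients, each of which is holomorphic in
  the other variable. The second-order Taylor estimate makes the limit uniform on the polydisc,
  because the second derivatives are bounded there by Cauchy's inequality.
\<close>

lemma bihol_on_dy_holomorphic:
  assumes K: "bihol_on K a b r M" and y: "y \<in> ball b (r/2)"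
  shows "(\<lambda>x. dy K x y) holomorphic_on ball a (r/2)"
proof -
  have r: "0 < r" using K by (simp add: bihol_on_def)
  define h where "h n = complex_of_real (r / (16 * (real n + 1)))" for n :: nat
  \<comment> \<open>the increments tend to 0 and stay in a disc that leaves room for the Cauchy estimates\<close>
  have hn: "norm (h n) = r / (16 * (real n + 1))" for n
    unfolding h_def norm_of_real using r by simp
  have h1: "norm (h n) < r/8" for n
  proof -
    have "r / (16 * (real n + 1)) \<le> r / 16" using r by (intro divide_left_mono) auto
    also have "\<dots> < r / 8" using r by simp
    finally show ?thesis unfolding hn .
  qed
  have h0: "h n \<noteq> 0" for n
    using hn[of n] r by (metis norm_zero divide_eq_0_iff less_irrefl mult_eq_0_iff of_nat_0_le_iff add_nonneg_eq_0_iff zero_le_one zero_neq_numeral zero_neq_one)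
  have yn: "y + h n \<in> ball y (r/8)" for n using h1[of n] by (simp add: dist_norm)
  have sub1: "ball y (r/4) \<subseteq> ball b r" by (rule ball_shift[of _ _ "r/2"]) (use y r in auto)
  define B where "B = 2 * M / (r/16)^2"
  have lim: "uniform_limit (ball a (r/2)) (\<lambda>n x. (K x (y + h n) - K x y) / h n) (\<lambda>x. dy K x y) sequentially"
  proof -
    have est: "norm ((K x (y + h n) - K x y) / h n - dy K x y) \<le> B * norm (h n)"
      if x: "x \<in> ball a (r/2)" for x n
    proof -
      have x': "x \<in> ball a r" using x r by auto
      have hol: "K x holomorphic_on ball b r" and bd: "\<And>y. y \<in> ball b r \<Longrightarrow> norm (K x y) \<le> M"
        using K x' by (auto simp: bihol_on_def)
      have "norm ((deriv ^^ 0) (K x) (y + h n) - (\<Sum>i\<le>1. (deriv ^^ i) (K x) y * ((y + h n) - y) ^ i / fact i))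
          \<le> B * norm ((y + h n) - y) ^ Suc 1 / fact 1"
      proof (rule complex_Taylor[of "ball y (r/8)"])
        show "((deriv ^^ i) (K x) has_field_derivative (deriv ^^ Suc i) (K x) z) (at z within ball y (r/8))"
          if "z \<in> ball y (r/8)" for i z
        proof -
          have "z \<in> ball y (r/4)" using that r by auto
          then have "z \<in> ball b r" using sub1 by blast
          then show ?thesis
            using holomorphic_higher_deriv[OF hol open_ball, of i]
            by (metis holomorphic_derivI open_ball comp_apply funpow.simps(2))
        qed
        show "norm ((deriv ^^ Suc 1) (K x) z) \<le> B" if "z \<in> ball y (r/8)" for z
        proof -
          have "ball z (r/8) \<subseteq> ball y (r/4)" by (rule ball_shift[of _ _ "r/8"]) (use that in auto)
          then have "norm ((deriv ^^ Suc 1) (K x) z) \<le> fact (Suc 1) * M / (r/8/2) ^ Suc 1"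
            by (intro deriv_bound[OF hol bd]) (use sub1 r in auto)
          then show ?thesis by (simp add: B_def power2_eq_square)
        qed
      qed (use yn[of n] r in auto)
      then have "norm (K x (y + h n) - K x y - dy K x y * h n) \<le> B * (norm (h n))\<^sup>2"
        by (simp add: power2_eq_square algebra_simps)
      moreover have "(K x (y + h n) - K x y) / h n - dy K x y = (K x (y + h n) - K x y - dy K x y * h n) / h n"
        using h0[of n] by (simp add: field_simps)
      ultimately show ?thesis
        using h0[of n] by (simp add: norm_divide power2_eq_square divide_le_eq mult.assoc)
    qed
    have "(\<lambda>n. B * norm (h n)) \<longlonglongrightarrow> 0"
      unfolding hn by real_asymp
    show ?thesis
    proof (rule uniform_limitI)
      fix e :: real assume "e > 0"
      with \<open>(\<lambda>n. B * norm (h n)) \<longlonglongrightarrow> 0\<close> have "eventually (\<lambda>n. B * norm (h n) < e) sequentially"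
        by (rule order_tendstoD)
      then show "eventually (\<lambda>n. \<forall>x\<in>ball a (r/2). dist ((K x (y + h n) - K x y) / h n) (dy K x y) < e) sequentially"
        by (rule eventually_mono) (auto simp: dist_norm intro: le_less_trans[OF est[unfolded mem_ball dist_norm]])
    qed
  qed
  show ?thesis
  proof (rule holomorphic_uniform_sequence[OF open_ball])
    fix n
    have "y \<in> ball b r" "y + h n \<in> ball b r"
      using sub1 yn[of n] r by (auto simp: subset_iff)
    moreover have "(\<lambda>x. K x t) holomorphic_on ball a (r/2)" if "t \<in> ball b r" for t
      by (rule holomorphic_on_subset[of _ "ball a r"]) (use K that r in \<open>auto simp: bihol_on_def\<close>)
    ultimately show "(\<lambda>x. (K x (y + h n) - K x y) / h n) holomorphic_on ball a (r/2)"
      by (intro holomorphic_intros) (auto simp: h0)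
  next
    fix x assume "x \<in> ball a (r/2)"
    then obtain d where "d > 0" "cball x d \<subseteq> ball a (r/2)" by (meson open_ball open_contains_cball)
    then show "\<exists>d>0. cball x d \<subseteq> ball a (r/2) \<and> uniform_limit (cball x d) (\<lambda>n x. (K x (y + h n) - K x y) / h n) (\<lambda>x. dy K x y) sequentially"
      using lim uniform_limit_on_subset by blast
  qed
qed

lemma bihol_on_dy:
  assumes K: "bihol_on K a b r M"
  shows "bihol_on (dy K) a b (r/2) (4 * M / r)"
  unfolding bihol_on_def
proof (intro conjI ballI)
  show r: "0 < r / 2" using K by (simp add: bihol_on_def)
  fix x assume x: "x \<in> ball a (r/2)"
  then have "x \<in> ball a r" using r by auto
  with K have hol: "K x holomorphic_on ball b r" and bd: "\<And>y. y \<in> ball b r \<Longrightarrow> norm (K x y) \<le> M"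
    by (auto simp: bihol_on_def)
  show "dy K x holomorphic_on ball b (r/2)"
    using holomorphic_deriv[OF hol open_ball] r by (auto intro: holomorphic_on_subset)
  fix y assume y: "y \<in> ball b (r/2)"
  have "norm ((deriv ^^ 1) (K x) y) \<le> fact 1 * M / (r/2/2) ^ 1"
    by (rule deriv_bound[OF hol bd]) (use ball_shift[of b y "r/2" "r/2" r] y r in auto)
  then show "norm (dy K x y) \<le> 4 * M / r" by (simp add: mult.commute)
next
  fix y assume "y \<in> ball b (r/2)"
  then show "(\<lambda>x. dy K x y) holomorphic_on ball a (r/2)"
    by (rule bihol_on_dy_holomorphic[OF K])
qed

lemma bihol_on_dx:
  assumes "bihol_on K a b r M"
  shows "bihol_on (dx K) a b (r/2) (4 * M / r)"
  using bihol_on_flip[OF bihol_on_dy[OF bihol_on_flip[OF assms]]] .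

lemma bihol_at_dy: "bihol_at K a b \<Longrightarrow> bihol_at (dy K) a b"
  and bihol_at_dx: "bihol_at K a b \<Longrightarrow> bihol_at (dx K) a b"
  unfolding bihol_at_def using bihol_on_dx bihol_on_dy by blast+

lemma bihol_on_Lipschitz_y:
  assumes K: "bihol_on K a b r M" and "x \<in> ball a (r/2)" "y \<in> ball b (r/2)" "y' \<in> ball b (r/2)"
  shows "norm (K x y - K x y') \<le> 4 * M / r * norm (y - y')"
proof (rule field_differentiable_bound[of "ball b (r/2)"])
  have r: "0 < r" using K by (simp add: bihol_on_def)
  then have "x \<in> ball a r" using assms(2) by auto
  then have "K x holomorphic_on ball b r" using K by (simp add: bihol_on_def)
  then have "K x holomorphic_on ball b (r/2)"
    by (rule holomorphic_on_subset) (use r in auto)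
  then show "(K x has_field_derivative dy K x z) (at z within ball b (r/2))" if "z \<in> ball b (r/2)" for z
    using that by (meson has_field_derivative_at_within holomorphic_derivI open_ball)
  show "norm (dy K x z) \<le> 4 * M / r" if "z \<in> ball b (r/2)" for z
    using bihol_on_dy[OF K] that assms(2) by (simp add: bihol_on_def)
qed (use assms in auto)

lemma eventually_polydisc:
  assumes "0 < r"
  shows "eventually (\<lambda>z. fst z \<in> ball a r \<and> snd z \<in> ball b r) (nhds (a :: complex, b :: complex))"
proof -
  have "open (ball (a::complex) r \<times> ball b r)" by (intro open_Times) auto
  then show ?thesis
    using assms by (auto simp: eventually_nhds mem_Times_iff intro!: exI[of _ "ball a r \<times> ball b r"])
qed

lemma eventually_nhds_polydisc:
  assumes "eventually P (nhds (a :: complex, b :: complex))"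
  obtains r where "0 < r" "\<And>x y. x \<in> ball a r \<Longrightarrow> y \<in> ball b r \<Longrightarrow> P (x, y)"
proof -
  obtain S where S: "open S" "(a, b) \<in> S" "\<And>z. z \<in> S \<Longrightarrow> P z"
    using assms unfolding eventually_nhds by blast
  obtain A B where AB: "open A" "open B" "(a, b) \<in> A \<times> B" "A \<times> B \<subseteq> S"
    by (rule open_prod_elim[OF S(1,2)])
  obtain r1 r2 where r12: "r1 > 0" "ball a r1 \<subseteq> A" "r2 > 0" "ball b r2 \<subseteq> B"
    using AB by (meson mem_Sigma_iff open_contains_ball)
  have "P (x, y)" if "x \<in> ball a (min r1 r2)" "y \<in> ball b (min r1 r2)" for x y
    by (intro S(3) subsetD[OF AB(4)]) (use that r12 in \<open>auto simp: subset_iff\<close>)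
  then show ?thesis using that[of "min r1 r2"] r12 by simp
qed

lemma isCont_tendsto_nhds: "isCont f a \<Longrightarrow> (f \<longlongrightarrow> f a) (nhds a)"
  unfolding isCont_def tendsto_at_iff_tendsto_nhds .

lemma bihol_at_continuous:
  assumes "bihol_at K a b"
  shows "isCont (\<lambda>z. K (fst z) (snd z)) (a, b)"
proof -
  obtain r M where K: "bihol_on K a b r M" using assms by (auto simp: bihol_at_def)
  then have r: "0 < r" by (simp add: bihol_on_def)
  define L where "L = 4 * M / r"
  have "norm (K (fst z) (snd z) - K a b) \<le> L * norm (snd z - b) + L * norm (fst z - a)"
    if z: "fst z \<in> ball a (r/2) \<and> snd z \<in> ball b (r/2)" for z
  proof -
    have "norm (K (fst z) (snd z) - K (fst z) b) \<le> L * norm (snd z - b)"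
      unfolding L_def by (rule bihol_on_Lipschitz_y[OF K]) (use z r in auto)
    moreover have "norm (K (fst z) b - K a b) \<le> L * norm (fst z - a)"
      unfolding L_def by (rule bihol_on_Lipschitz_y[OF bihol_on_flip[OF K]]) (use z r in auto)
    ultimately show ?thesis by (rule norm_diff_triangle_le)
  qed
  then have ev: "eventually (\<lambda>z. norm (K (fst z) (snd z) - K a b) \<le> L * norm (snd z - b) + L * norm (fst z - a)) (nhds (a,b))"
    using eventually_mono[OF eventually_polydisc[of "r/2" a b]] r by auto
  have "((\<lambda>z. L * norm (snd z - b) + L * norm (fst z - a)) \<longlongrightarrow> 0) (nhds (a,b))"
    by (rule tendsto_eq_rhs[OF tendsto_add[OF tendsto_mult_left[OF tendsto_norm[OF tendsto_diff[OF tendsto_snd[OF filterlim_ident] tendsto_const]]]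
          tendsto_mult_left[OF tendsto_norm[OF tendsto_diff[OF tendsto_fst[OF filterlim_ident] tendsto_const]]]]]) simp
  then have "((\<lambda>z. K (fst z) (snd z) - K a b) \<longlongrightarrow> 0) (nhds (a,b))"
    using ev by (rule Lim_null_comparison[rotated])
  then show ?thesis
    by (simp add: isCont_def LIM_zero_iff tendsto_mono[OF at_within_le_nhds])
qed

lemma bihol_at_eventually_nonzero:
  assumes "bihol_at K a b" "K a b \<noteq> 0"
  shows "eventually (\<lambda>z. K (fst z) (snd z) \<noteq> 0) (nhds (a, b))"
  using tendsto_imp_eventually_ne[OF isCont_tendsto_nhds[OF bihol_at_continuous[OF assms(1)]]] assms(2) by simp

text \<open>
  Total differentiability follows from continuity of one of the partial derivatives, which is again
  separately holomorphic and locally bounded.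
\<close>

lemma bihol_at_has_derivative:
  assumes "bihol_at K a b"
  shows "((\<lambda>z. K (fst z) (snd z)) has_derivative (\<lambda>h. dx K a b * fst h + dy K a b * snd h)) (at (a, b))"
proof -
  obtain r M where K: "bihol_on K a b r M" using assms by (auto simp: bihol_at_def)
  then have r: "0 < r" by (simp add: bihol_on_def)
  have "((\<lambda>(x, y). K x y) has_derivative (\<lambda>(s, t). dx K a b * s + blinfun_apply (blinfun_mult_right (dy K a b)) t))
      (at (a, b) within ball a r \<times> ball b r)"
  proof (rule has_derivative_partialsI)
    show "((\<lambda>x. K x b) has_derivative (*) (dx K a b)) (at a within ball a r)"
      using K r unfolding bihol_on_def
      by (auto intro!: has_field_derivative_imp_has_derivative has_field_derivative_at_within[OF holomorphic_derivI[OF _ open_ball]])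
    show "(K x has_derivative blinfun_apply (blinfun_mult_right (dy K x y))) (at y within ball b r)"
      if "x \<in> ball a r" "y \<in> ball b r" for x y
      using K that unfolding bihol_on_def
      by (auto simp: blinfun_mult_right.rep_eq intro!: has_field_derivative_imp_has_derivative
          has_field_derivative_at_within[OF holomorphic_derivI[OF _ open_ball]])
    have "isCont (\<lambda>z. blinfun_mult_right (dy K (fst z) (snd z))) (a, b)"
      by (rule bounded_linear.isCont[OF bounded_linear_blinfun_mult_right])
        (rule bihol_at_continuous[OF bihol_at_dy[OF assms]])
    then show "continuous (at (a, b) within ball a r \<times> ball b r) (\<lambda>(x, y). blinfun_mult_right (dy K x y))"
      by (simp add: case_prod_beta' continuous_at_imp_continuous_at_within)
  qed (use r in auto)
  moreover have "at (a, b) within ball a r \<times> ball b r = at (a, b)"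
    using r by (intro at_within_open) (auto intro: open_Times)
  ultimately show ?thesis by (simp add: case_prod_beta')
qed

lemma bihol_at_chain:
  assumes K: "bihol_at K (x s) (y s)"
    and x: "(x has_field_derivative x') (at s)" and y: "(y has_field_derivative y') (at s)"
  shows "((\<lambda>s. K (x s) (y s)) has_field_derivative dx K (x s) (y s) * x' + dy K (x s) (y s) * y') (at s)"
proof -
  have "((\<lambda>s. (x s, y s)) has_derivative (\<lambda>h. (x' * h, y' * h))) (at s)"
    using x y by (intro has_derivative_Pair) (auto simp: has_field_derivative_def)
  from has_derivative_compose[OF this, of "\<lambda>z. K (fst z) (snd z)", OF bihol_at_has_derivative[OF K]]
  have "((\<lambda>s. K (x s) (y s)) has_derivative
      (\<lambda>h. dx K (x s) (y s) * (x' * h) + dy K (x s) (y s) * (y' * h))) (at s)"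
    by simp
  then show ?thesis
    by (rule has_derivative_imp_has_field_derivative) (simp add: algebra_simps)
qed

lemma bihol_at_eventually:
  assumes "bihol_at K a b"
  shows "eventually (\<lambda>z. bihol_at K (fst z) (snd z)) (nhds (a, b))"
proof -
  obtain r M where K: "bihol_on K a b r M" using assms by (auto simp: bihol_at_def)
  then have r: "0 < r" by (simp add: bihol_on_def)
  have r2: "0 < r / 2" using r by simp
  have "bihol_at K (fst z) (snd z)" if "fst z \<in> ball a (r/2) \<and> snd z \<in> ball b (r/2)" for z
    unfolding bihol_at_def using bihol_on_mono[OF K, of "fst z" "r/2" "snd z" "r/2"] that r
    by (metis field_sum_of_halves half_gt_zero less_eq_real_def mem_ball)
  then show ?thesis
    by (rule eventually_mono[OF eventually_polydisc[OF r2]])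
qed

section \<open>Holomorphic functions along maps and curves\<close>

text \<open>
  Conversely, partial derivatives near a point and continuity at that point suffice; continuity
  provides the bound.
\<close>

lemma bihol_atI:
  assumes ev: "eventually (\<lambda>z. (\<exists>D. ((\<lambda>x. K x (snd z)) has_field_derivative D) (at (fst z))) \<and>
      (\<exists>D. (K (fst z) has_field_derivative D) (at (snd z)))) (nhds (a, b))"
    and cont: "isCont (\<lambda>z. K (fst z) (snd z)) (a, b)"
  shows "bihol_at K a b"
proof -
  have "((\<lambda>z. norm (K (fst z) (snd z))) \<longlongrightarrow> norm (K a b)) (nhds (a, b))"
    using tendsto_norm[OF isCont_tendsto_nhds[OF cont]] by simp
  then have "eventually (\<lambda>z. norm (K (fst z) (snd z)) < norm (K a b) + 1) (nhds (a, b))"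
    by (rule order_tendstoD) simp
  from eventually_conj[OF this ev] obtain r where r: "0 < r"
    and P: "\<And>x y. x \<in> ball a r \<Longrightarrow> y \<in> ball b r \<Longrightarrow> norm (K x y) < norm (K a b) + 1 \<and>
      (\<exists>D. ((\<lambda>x. K x y) has_field_derivative D) (at x)) \<and> (\<exists>D. (K x has_field_derivative D) (at y))"
    by (rule eventually_nhds_polydisc) (rule that, assumption, simp only: fst_conv snd_conv)
  have "bihol_on K a b r (norm (K a b) + 1)"
    unfolding bihol_on_def holomorphic_on_open[OF open_ball]
  proof (intro conjI ballI)
    show "0 < r" by (fact r)
    fix x y assume "x \<in> ball a r" "y \<in> ball b r"
    from P[OF this] show "norm (K x y) \<le> norm (K a b) + 1"
      and "\<exists>D. (K x has_field_derivative D) (at y)" by auto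
  next
    fix x y assume "x \<in> ball a r" "y \<in> ball b r"
    from P[OF this] show "\<exists>D. ((\<lambda>x. K x y) has_field_derivative D) (at x)" by auto
  qed
  then show ?thesis unfolding bihol_at_def by blast
qed

lemma mholomorphic_on_isCont: "mholomorphic_on f S \<Longrightarrow> z \<in> S \<Longrightarrow> isCont f z"
  unfolding mholomorphic_on_def using has_derivative_continuous by blast

lemma mholomorphic_on_along_curve:
  fixes g :: "complex \<Rightarrow> complex^'n"
  assumes "mholomorphic_on f S" "g s \<in> S"
    and g: "\<And>i. ((\<lambda>t. g t $ i) has_field_derivative g' i) (at s)"
  shows "\<exists>D. ((\<lambda>t. f (g t)) has_field_derivative D) (at s)"
proof -
  obtain a where a: "(f has_derivative (\<lambda>h. \<Sum>i\<in>UNIV. a$i * h$i)) (at (g s))"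
    using assms(1,2) unfolding mholomorphic_on_def by blast
  have "(g has_derivative (\<lambda>h. \<chi> i. g' i * h)) (at s)"
    unfolding has_derivative_componentwise_within[of g]
  proof
    fix b :: "complex^'n" assume "b \<in> Basis"
    then obtain k u where b: "b = axis k u" by (auto simp: Basis_vec_def)
    have "((\<lambda>t. g t $ k \<bullet> u) has_derivative (\<lambda>h. (g' k * h) \<bullet> u)) (at s)"
      by (rule has_derivative_inner_left[OF has_field_derivative_imp_has_derivative[OF g]])
    then show "((\<lambda>t. g t \<bullet> b) has_derivative (\<lambda>h. (\<chi> i. g' i * h) \<bullet> b)) (at s)"
      by (simp add: b inner_axis)
  qed
  from has_derivative_compose[OF this a]
  have "((\<lambda>t. f (g t)) has_field_derivative (\<Sum>i\<in>UNIV. a$i * g' i)) (at s)"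
    by (rule has_derivative_imp_has_field_derivative) (simp add: sum_distrib_left algebra_simps)
  then show ?thesis by blast
qed

lemma bihol_at_partial_derivatives:
  assumes "bihol_at K x y"
  shows "((\<lambda>t. K t y) has_field_derivative dx K x y) (at x)"
    and "(K x has_field_derivative dy K x y) (at y)"
proof -
  obtain r M where "bihol_on K x y r M" using assms by (auto simp: bihol_at_def)
  then show "((\<lambda>t. K t y) has_field_derivative dx K x y) (at x)"
    and "(K x has_field_derivative dy K x y) (at y)"
    by (auto simp: bihol_on_def intro!: holomorphic_derivI[OF _ open_ball])
qed

lemma isCont_vec_componentwise:
  fixes e :: "'a::t2_space \<Rightarrow> complex^'n"
  shows "(\<And>i. isCont (\<lambda>z. e z $ i) a) \<Longrightarrow> isCont e a"
  unfolding isCont_def by (rule vec_tendstoI)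

text \<open>
  This turns holomorphy on domains of \<open>\<complex>\<^sup>n\<close>, where the charts and the coefficients of a jet
  differential live, into holomorphy in two affine coordinates.
\<close>

lemma bihol_at_compose:
  fixes e :: "complex \<Rightarrow> complex \<Rightarrow> complex^'n"
  assumes f: "mholomorphic_on f S" "open S" and e: "\<And>i. bihol_at (\<lambda>x y. e x y $ i) a b" "e a b \<in> S"
  shows "bihol_at (\<lambda>x y. f (e x y)) a b"
proof (rule bihol_atI)
  have cont: "isCont (\<lambda>z. e (fst z) (snd z)) (a, b)"
    by (rule isCont_vec_componentwise) (rule bihol_at_continuous[OF e(1)])
  then have "eventually (\<lambda>z. e (fst z) (snd z) \<in> S) (nhds (a, b))"
    using topological_tendstoD[OF isCont_tendsto_nhds[OF cont] f(2)] e(2) by simp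
  moreover have "eventually (\<lambda>z. \<forall>i. bihol_at (\<lambda>x y. e x y $ i) (fst z) (snd z)) (nhds (a, b))"
    by (intro eventually_all_finite bihol_at_eventually e)
  ultimately show "eventually (\<lambda>z. (\<exists>D. ((\<lambda>x. f (e x (snd z))) has_field_derivative D) (at (fst z))) \<and>
      (\<exists>D. ((\<lambda>y. f (e (fst z) y)) has_field_derivative D) (at (snd z)))) (nhds (a, b))"
  proof eventually_elim
    case (elim z)
    then have e: "bihol_at (\<lambda>x y. e x y $ i) (fst z) (snd z)" for i by blast
    show ?case
      by (intro conjI mholomorphic_on_along_curve[OF f(1)])
        (use elim in simp, rule bihol_at_partial_derivatives(1)[OF e],
         use elim in simp, rule bihol_at_partial_derivatives(2)[OF e])
  qed
  have "isCont (\<lambda>z. f (e (fst z) (snd z))) (a, b)"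
    by (rule isCont_o2[OF cont]) (use mholomorphic_on_isCont[OF f(1)] e(2) in simp)
  then show "isCont (\<lambda>z. f (e (fst z) (snd z))) (a, b)" .
qed

lemma bihol_at_const: "bihol_at (\<lambda>x y. c) a b"
  and bihol_at_fst: "bihol_at (\<lambda>x y. x) a b"
  and bihol_at_snd: "bihol_at (\<lambda>x y. y) a b"
  by ((rule bihol_atI, intro always_eventually allI conjI exI, (rule DERIV_const DERIV_ident)+, simp)+)

lemma eval2_pCons: "eval2 (pCons p F) x y = poly p x + y * eval2 F x y"
  by (simp add: eval2_def)

lemma eval2_0: "eval2 0 x y = 0"
  and eval2_add: "eval2 (F + G) x y = eval2 F x y + eval2 G x y"
  and eval2_mult: "eval2 (F * G) x y = eval2 F x y * eval2 G x y"
  by (simp_all add: eval2_def)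

lemma eval2_has_derivative_x: "((\<lambda>x. eval2 F x y) has_field_derivative eval2 (d_x F) x y) (at x)"
  by (induction F) (auto simp: eval2_0 eval2_pCons d_x_def map_poly_pCons intro!: derivative_eq_intros poly_DERIV)

lemma eval2_has_derivative_y: "(eval2 F x has_field_derivative eval2 (d_y F) x y) (at y)"
proof (induction F)
  case 0
  then show ?case by (simp add: eval2_0[abs_def] d_y_def)
next
  case (pCons p F)
  have "((\<lambda>y. poly p x + y * eval2 F x y) has_field_derivative eval2 (d_y (pCons p F)) x y) (at y)"
    by (auto simp: d_y_def pderiv_pCons eval2_add eval2_pCons intro!: derivative_eq_intros pCons.IH[unfolded d_y_def])
  then show ?case by (simp add: eval2_pCons[abs_def])
qed

lemma isCont_eval2: "isCont (\<lambda>z. eval2 F (fst z) (snd z)) (a, b)"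
  by (induction F) (auto simp: eval2_0 eval2_pCons intro!: continuous_intros)

lemma bihol_at_eval2: "bihol_at (eval2 F) a b"
  by (rule bihol_atI, intro always_eventually allI conjI exI, rule eval2_has_derivative_x,
      rule eval2_has_derivative_y, rule isCont_eval2)

lemma bihol_at_compose2:
  assumes K: "bihol_at K (X a b) (Y a b)" and X: "bihol_at X a b" and Y: "bihol_at Y a b"
  shows "bihol_at (\<lambda>x y. K (X x y) (Y x y)) a b"
proof (rule bihol_atI)
  have cont: "isCont (\<lambda>z. (X (fst z) (snd z), Y (fst z) (snd z))) (a, b)"
    using bihol_at_continuous[OF X] bihol_at_continuous[OF Y] by (rule isCont_Pair)
  have "filterlim (\<lambda>z. (X (fst z) (snd z), Y (fst z) (snd z))) (nhds (X a b, Y a b)) (nhds (a, b))"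
    using isCont_tendsto_nhds[OF cont] by simp
  from eventually_compose_filterlim[OF bihol_at_eventually[OF K] this]
    bihol_at_eventually[OF X] bihol_at_eventually[OF Y]
  show "eventually (\<lambda>z. (\<exists>D. ((\<lambda>x. K (X x (snd z)) (Y x (snd z))) has_field_derivative D) (at (fst z))) \<and>
      (\<exists>D. ((\<lambda>y. K (X (fst z) y) (Y (fst z) y)) has_field_derivative D) (at (snd z)))) (nhds (a, b))"
  proof eventually_elim
    case (elim z)
    then have K: "bihol_at K (X (fst z) (snd z)) (Y (fst z) (snd z))" by simp
    note X = bihol_at_partial_derivatives[OF elim(2)] and Y = bihol_at_partial_derivatives[OF elim(3)]
    show ?case
      using bihol_at_chain[OF K X(1) Y(1)] bihol_at_chain[OF K X(2) Y(2)] by blast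
  qed
  have "isCont (\<lambda>z. K (fst z) (snd z)) (X a b, Y a b)" by (rule bihol_at_continuous[OF K])
  then show "isCont (\<lambda>z. K (X (fst z) (snd z)) (Y (fst z) (snd z))) (a, b)"
    using isCont_o2[OF cont, of "\<lambda>z. K (fst z) (snd z)"] by simp
qed

lemma bihol_at_divide:
  assumes "bihol_at X a b" "bihol_at Y a b" "Y a b \<noteq> 0"
  shows "bihol_at (\<lambda>x y. X x y / Y x y) a b"
proof (rule bihol_at_compose2[where K="(/)"])
  show "bihol_at (/) (X a b) (Y a b)"
  proof (rule bihol_atI)
    have "open {z :: complex \<times> complex. snd z \<noteq> 0}"
      by (intro open_Collect_neq continuous_intros)
    then have "eventually (\<lambda>z. snd z \<noteq> 0) (nhds (X a b, Y a b))"
      using assms(3) eventually_nhds_in_open by fastforce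
    then show "eventually (\<lambda>z. (\<exists>D. ((\<lambda>x. x / snd z) has_field_derivative D) (at (fst z))) \<and>
        (\<exists>D. ((/) (fst z) has_field_derivative D) (at (snd z)))) (nhds (X a b, Y a b))"
      by eventually_elim (auto intro!: exI derivative_eq_intros)
    show "isCont (\<lambda>z. fst z / snd z) (X a b, Y a b)"
      using assms(3) by (intro continuous_intros) auto
  qed
qed (use assms in auto)

lemma eventually_curve:
  fixes x y :: "complex \<Rightarrow> complex"
  assumes "eventually (\<lambda>z. P (fst z) (snd z)) (nhds (x s, y s))" "isCont x s" "isCont y s"
  shows "eventually (\<lambda>t. P (x t) (y t)) (nhds s)"
proof -
  have "((\<lambda>t. (x t, y t)) \<longlongrightarrow> (x s, y s)) (nhds s)"
    using assms(2,3) by (intro tendsto_Pair) (auto simp: isCont_def tendsto_at_iff_tendsto_nhds)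
  from eventually_compose_filterlim[OF assms(1) this] show ?thesis by simp
qed

lemma eventually_analytic_at: "f analytic_on {s} \<Longrightarrow> eventually (\<lambda>t. f analytic_on {t}) (nhds s)"
  by (auto simp: eventually_nhds analytic_at)

lemma analytic_at_has_derivative: "f analytic_on {t} \<Longrightarrow> (f has_field_derivative deriv f t) (at t)"
  by (meson DERIV_deriv_iff_field_differentiable analytic_on_imp_differentiable_at singletonI)

text \<open>
  The first-order chain rule holds not only at 0 but at all nearby parameters, so it can be
  differentiated once more.
\<close>

lemma bihol_at_jet:
  assumes K: "bihol_at K (x 0) (y 0)" and x: "x analytic_on {0}" and y: "y analytic_on {0}"
  shows "D1 (\<lambda>t. K (x t) (y t)) = dx K (x 0) (y 0) * D1 x + dy K (x 0) (y 0) * D1 y"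
    and "D2 (\<lambda>t. K (x t) (y t)) = dx K (x 0) (y 0) * D2 x + dy K (x 0) (y 0) * D2 y
      + (dx (dx K) (x 0) (y 0) * D1 x ^ 2 + (dy (dx K) (x 0) (y 0) + dx (dy K) (x 0) (y 0)) * D1 x * D1 y
         + dy (dy K) (x 0) (y 0) * D1 y ^ 2)"
proof -
  note evx = eventually_analytic_at[OF x] and evy = eventually_analytic_at[OF y] and der = analytic_at_has_derivative
  have der2: "(deriv h has_field_derivative D2 h) (at 0)" if "h analytic_on {0}" for h
    unfolding D2_def using that by (intro der analytic_deriv)
  have cont: "isCont x 0" "isCont y 0"
    using der[OF x] der[OF y] DERIV_isCont by blast+
  have chain: "((\<lambda>t. K (x t) (y t)) has_field_derivative dx K (x t) (y t) * deriv x t + dy K (x t) (y t) * deriv y t) (at t)"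
    if "bihol_at K (x t) (y t)" "x analytic_on {t}" "y analytic_on {t}" for K t
    using that by (intro bihol_at_chain der)
  show "D1 (\<lambda>t. K (x t) (y t)) = dx K (x 0) (y 0) * D1 x + dy K (x 0) (y 0) * D1 y"
    unfolding D1_def using chain[OF K x y] by (rule DERIV_imp_deriv)
  have "eventually (\<lambda>t. bihol_at K (x t) (y t)) (nhds 0)"
    by (rule eventually_curve[OF bihol_at_eventually[OF K] cont])
  with evx evy have "eventually (\<lambda>t. deriv (\<lambda>t. K (x t) (y t)) t = dx K (x t) (y t) * deriv x t + dy K (x t) (y t) * deriv y t) (nhds 0)"
    by eventually_elim (rule DERIV_imp_deriv[OF chain])
  then have "D2 (\<lambda>t. K (x t) (y t)) = deriv (\<lambda>t. dx K (x t) (y t) * deriv x t + dy K (x t) (y t) * deriv y t) 0"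
    unfolding D2_def by (rule deriv_cong_ev) simp
  also have "\<dots> = dx K (x 0) (y 0) * D2 x + dy K (x 0) (y 0) * D2 y
      + (dx (dx K) (x 0) (y 0) * D1 x ^ 2 + (dy (dx K) (x 0) (y 0) + dx (dy K) (x 0) (y 0)) * D1 x * D1 y
         + dy (dy K) (x 0) (y 0) * D1 y ^ 2)"
    by (rule DERIV_imp_deriv)
      (rule DERIV_cong[OF DERIV_add[OF DERIV_mult[OF chain[OF bihol_at_dx[OF K] x y] der2[OF x]]
          DERIV_mult[OF chain[OF bihol_at_dy[OF K] x y] der2[OF y]]]],
       simp add: D1_def algebra_simps power2_eq_square)
  finally show "D2 (\<lambda>t. K (x t) (y t)) = dx K (x 0) (y 0) * D2 x + dy K (x 0) (y 0) * D2 y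
      + (dx (dx K) (x 0) (y 0) * D1 x ^ 2 + (dy (dx K) (x 0) (y 0) + dx (dy K) (x 0) (y 0)) * D1 x * D1 y
         + dy (dy K) (x 0) (y 0) * D1 y ^ 2)" .
qed

section \<open>Points of the projective plane and forms\<close>

lemma hom_coords_eq_iff:
  assumes "v \<noteq> 0" "w \<noteq> 0"
  shows "hom_coords v = hom_coords w \<longleftrightarrow> (\<exists>c. w = c *s v)"
  using Quotient3_rel[OF Quotient3_p2, of v w] assms unfolding proportional_def
  by (metis vector_smult_lid)

lemma eval2_altdef: "eval2 F x y = (\<Sum>j\<le>degree F. poly (coeff F j) x * y ^ j)"
  unfolding eval2_def poly_altdef[of F] poly_sum poly_mult by (simp add: poly_power)

lemma eval3_altdef: "eval3 P v = (\<Sum>k\<le>degree P. eval2 (coeff P k) (v$1) (v$2) * (v$3) ^ k)"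
  unfolding eval3_def eval2_def poly_altdef[of P] poly_sum poly_mult by (simp add: poly_power)

lemma eval3_pCons: "eval3 (pCons p P) v = eval2 p (v$1) (v$2) + v$3 * eval3 P v"
  by (simp add: eval3_def eval2_def)

text \<open>
  Every monomial of a form of degree \<open>d\<close> scales by \<open>c ^ d\<close>; the powers of \<open>c\<close> are split off one variable
  at a time.
\<close>

lemma eval3_scale:
  assumes "homogeneous P d"
  shows "eval3 P (c *s v) = c ^ d * eval3 P v"
proof -
  have 1: "c ^ n * poly p (c * t) = c ^ d * poly p t"
    if "\<And>i. coeff p i \<noteq> 0 \<Longrightarrow> i + n = d" for p n t
    unfolding poly_altdef sum_distrib_left
  proof (intro sum.cong refl)
    fix i
    show "c ^ n * (coeff p i * (c * t) ^ i) = c ^ d * (coeff p i * t ^ i)"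
      using that[of i] by (cases "coeff p i = 0") (auto simp: power_add power_mult_distrib)
  qed
  have 2: "c ^ n * eval2 F (c * t) (c * x) = c ^ d * eval2 F t x"
    if "\<And>i j. coeff (coeff F j) i \<noteq> 0 \<Longrightarrow> i + j + n = d" for F n t x
  proof -
    have "c ^ n * (poly (coeff F j) (c * t) * (c * x) ^ j) = c ^ d * (poly (coeff F j) t * x ^ j)" for j
    proof -
      have "c ^ n * (poly (coeff F j) (c * t) * (c * x) ^ j) = c ^ (j + n) * poly (coeff F j) (c * t) * x ^ j"
        by (simp add: power_add power_mult_distrib)
      also have "c ^ (j + n) * poly (coeff F j) (c * t) = c ^ d * poly (coeff F j) t"
        by (rule 1) (use that[of j] in \<open>auto simp: add_ac\<close>)
      finally show ?thesis by simp
    qed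
    then show ?thesis unfolding eval2_altdef sum_distrib_left by simp
  qed
  have "eval2 (coeff P k) (c * v$1) (c * v$2) * (c * v$3) ^ k = c ^ d * (eval2 (coeff P k) (v$1) (v$2) * (v$3) ^ k)" for k
  proof -
    have "eval2 (coeff P k) (c * v$1) (c * v$2) * (c * v$3) ^ k
        = c ^ k * eval2 (coeff P k) (c * v$1) (c * v$2) * (v$3) ^ k"
      by (simp add: power_mult_distrib)
    also have "c ^ k * eval2 (coeff P k) (c * v$1) (c * v$2) = c ^ d * eval2 (coeff P k) (v$1) (v$2)"
      by (rule 2) (use assms in \<open>auto simp: homogeneous_def\<close>)
    finally show ?thesis by simp
  qed
  then show ?thesis by (simp add: eval3_altdef sum_distrib_left)
qed

lemma hom_coords_in_zero_locus:
  assumes "homogeneous P d" "v \<noteq> 0"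
  shows "hom_coords v \<in> zero_locus P \<longleftrightarrow> eval3 P v = 0"
proof
  assume "hom_coords v \<in> zero_locus P"
  then obtain w where w: "w \<noteq> 0" "eval3 P w = 0" "hom_coords w = hom_coords v"
    unfolding zero_locus_def by force
  then show "eval3 P v = 0"
    using assms by (auto simp: hom_coords_eq_iff eval3_scale)
qed (use assms in \<open>auto simp: zero_locus_def\<close>)

lemma eval2_dehomogenize: "eval2 (dehomogenize P) x y = eval3 P (vector [1, x, y])"
proof (induction P)
  case 0
  then show ?case by (simp add: eval2_def eval3_def dehomogenize_def)
next
  case (pCons p P)
  have "poly (map_poly (\<lambda>q. poly q 1) p) x = eval2 p 1 x"
    by (induction p) (simp_all add: eval2_0 eval2_pCons map_poly_pCons)
  then show ?case
    using pCons.IH by (simp add: eval2_pCons eval3_pCons dehomogenize_def map_poly_pCons vector_3)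
qed

section \<open>Second-order jets\<close>

lemma bihol_at_plus: "bihol_at X a b \<Longrightarrow> bihol_at Y a b \<Longrightarrow> bihol_at (\<lambda>x y. X x y + Y x y) a b"
  and bihol_at_times: "bihol_at X a b \<Longrightarrow> bihol_at Y a b \<Longrightarrow> bihol_at (\<lambda>x y. X x y * Y x y) a b"
proof -
  have "bihol_at (+) c d" "bihol_at (*) c d" for c d
    by (rule bihol_atI; auto intro!: always_eventually exI derivative_eq_intros)+
  then show "bihol_at X a b \<Longrightarrow> bihol_at Y a b \<Longrightarrow> bihol_at (\<lambda>x y. X x y + Y x y) a b"
    and "bihol_at X a b \<Longrightarrow> bihol_at Y a b \<Longrightarrow> bihol_at (\<lambda>x y. X x y * Y x y) a b"
    by (blast intro: bihol_at_compose2)+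
qed

lemma bihol_at_uminus: "bihol_at X a b \<Longrightarrow> bihol_at (\<lambda>x y. - X x y) a b"
  using bihol_at_times[OF bihol_at_const[of "-1"]] by simp

lemma bihol_at_minus: "bihol_at X a b \<Longrightarrow> bihol_at Y a b \<Longrightarrow> bihol_at (\<lambda>x y. X x y - Y x y) a b"
  using bihol_at_plus[OF _ bihol_at_uminus] by simp

lemma bihol_at_power: "bihol_at X a b \<Longrightarrow> bihol_at (\<lambda>x y. X x y ^ n) a b"
  by (induction n) (auto intro: bihol_at_const bihol_at_times)

lemma bihol_at_sum: "(\<And>i. i \<in> I \<Longrightarrow> bihol_at (X i) a b) \<Longrightarrow> bihol_at (\<lambda>x y. \<Sum>i\<in>I. X i x y) a b"
  by (induction I rule: infinite_finite_induct) (auto intro: bihol_at_const bihol_at_plus)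

lemmas bihol_intros = bihol_at_const bihol_at_fst bihol_at_snd bihol_at_eval2 bihol_at_plus bihol_at_times
  bihol_at_uminus bihol_at_minus bihol_at_power bihol_at_sum

lemma bihol_at_cong:
  assumes "bihol_at G a b" "eventually (\<lambda>z. K (fst z) (snd z) = G (fst z) (snd z)) (nhds (a, b))"
  shows "bihol_at K a b"
proof -
  obtain r M where G: "bihol_on G a b r M" using assms by (auto simp: bihol_at_def)
  then have r: "0 < r" by (simp add: bihol_on_def)
  obtain r' where r': "0 < r'" "\<And>x y. x \<in> ball a r' \<Longrightarrow> y \<in> ball b r' \<Longrightarrow> K x y = G x y"
    by (rule eventually_nhds_polydisc[OF assms(2)]) simp
  define s where "s = min r r'"
  have s: "0 < s" "s \<le> r" using r r' by (auto simp: s_def)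
  have eq: "K x y = G x y" if "x \<in> ball a s" "y \<in> ball b s" for x y
    using that r'(2) by (simp add: s_def)
  have G': "bihol_on G a b s M" by (rule bihol_on_mono[OF G, of _ 0]) (use s in auto)
  have "bihol_on K a b s M"
    unfolding bihol_on_def
  proof (intro conjI ballI)
    fix x y assume xy: "x \<in> ball a s" "y \<in> ball b s"
    show "norm (K x y) \<le> M" using G' xy eq by (simp add: bihol_on_def)
  next
    fix x assume xy: "x \<in> ball a s"
    show "K x holomorphic_on ball b s"
    proof (rule holomorphic_transform)
      show "G x holomorphic_on ball b s" using G' xy by (simp add: bihol_on_def)
    qed (use eq[OF xy] in simp)
  next
    fix y assume y: "y \<in> ball b s"
    show "(\<lambda>x. K x y) holomorphic_on ball a s"
    proof (rule holomorphic_transform)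
      show "(\<lambda>x. G x y) holomorphic_on ball a s" using G' y by (simp add: bihol_on_def)
    qed (use eq[OF _ y] in simp)
  qed (use s in auto)
  then show ?thesis by (auto simp: bihol_at_def)
qed

lemma bihol_at_analytic:
  assumes "bihol_at K (x s) (y s)" and x: "x analytic_on {s}" and y: "y analytic_on {s}"
  shows "(\<lambda>t. K (x t) (y t)) analytic_on {s}"
proof -
  note eventually_analytic_at[OF x] eventually_analytic_at[OF y]
  moreover have "eventually (\<lambda>t. bihol_at K (x t) (y t)) (nhds s)"
    by (rule eventually_curve[where P="bihol_at K" and x=x and y=y, OF bihol_at_eventually[OF assms(1)]])
      (use x y in \<open>auto intro: analytic_at_imp_isCont\<close>)
  ultimately have "eventually (\<lambda>t. \<exists>D. ((\<lambda>t. K (x t) (y t)) has_field_derivative D) (at t)) (nhds s)"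
  proof eventually_elim
    case (elim t)
    from bihol_at_chain[OF elim(3) analytic_at_has_derivative[OF elim(1)] analytic_at_has_derivative[OF elim(2)]]
    show ?case by blast
  qed
  then obtain S where "open S" "s \<in> S" "\<forall>t\<in>S. \<exists>D. ((\<lambda>t. K (x t) (y t)) has_field_derivative D) (at t)"
    unfolding eventually_nhds by blast
  then show ?thesis
    unfolding analytic_at using holomorphic_on_open by blast
qed

text \<open>
  The first and second derivatives at the base point of \<open>K\<close> along a curve germ through \<open>(a, b)\<close>, as
  functions of the 2-jet of the germ (cf. \<open>bihol_at_jet\<close>).
\<close>

definition first_jet where
  "first_jet K a b x1 y1 = dx K a b * x1 + dy K a b * y1"

definition second_jet where
  "second_jet K a b x1 y1 x2 y2 = dx K a b * x2 + dy K a b * y2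
     + (dx (dx K) a b * x1 ^ 2 + (dy (dx K) a b + dx (dy K) a b) * x1 * y1 + dy (dy K) a b * y1 ^ 2)"

lemma bihol_at_first_jet:
  "bihol_at K a b \<Longrightarrow> bihol_at X1 a b \<Longrightarrow> bihol_at Y1 a b \<Longrightarrow>
   bihol_at (\<lambda>x y. first_jet K x y (X1 x y) (Y1 x y)) a b"
  unfolding first_jet_def by (intro bihol_intros bihol_at_dx bihol_at_dy)

lemma bihol_at_second_jet:
  "bihol_at K a b \<Longrightarrow> bihol_at X1 a b \<Longrightarrow> bihol_at Y1 a b \<Longrightarrow> bihol_at X2 a b \<Longrightarrow> bihol_at Y2 a b \<Longrightarrow>
   bihol_at (\<lambda>x y. second_jet K x y (X1 x y) (Y1 x y) (X2 x y) (Y2 x y)) a b"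
  unfolding second_jet_def by (intro bihol_intros bihol_at_dx bihol_at_dy)

lemma bihol_at_jet_expression:
  assumes "\<And>i j k. bihol_at (\<lambda>x y. A i j k (z x y)) a b"
    and "bihol_at U1 a b" "bihol_at U2 a b" "bihol_at W1 a b" "bihol_at W2 a b"
  shows "bihol_at (\<lambda>x y. jet_expression m A (z x y) (U1 x y) (U2 x y) (W1 x y) (W2 x y)) a b"
  unfolding jet_expression_def case_prod_unfold by (intro bihol_intros assms)

lemma jet_cong:
  assumes "eventually (\<lambda>t. g t = h t) (nhds (0::complex))"
  shows "D1 g = D1 h" "D2 g = D2 h" "logD1 g = logD1 h" "logD2 g = logD2 h"
proof -
  show 1: "D1 g = D1 h" unfolding D1_def by (rule deriv_cong_ev[OF assms refl])
  have "eventually (\<lambda>t. eventually (\<lambda>u. g u = h u) (nhds t)) (nhds 0)"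
    using assms by (simp add: eventually_eventually)
  then have "eventually (\<lambda>t. deriv g t = deriv h t) (nhds 0)"
    by eventually_elim (rule deriv_cong_ev[OF _ refl])
  then show 2: "D2 g = D2 h" unfolding D2_def by (rule deriv_cong_ev[OF _ refl])
  have "g 0 = h 0" using assms by (rule eventually_nhds_x_imp_x)
  with 1 2 show "logD1 g = logD1 h" "logD2 g = logD2 h" by (simp_all add: logD1_def logD2_def)
qed

section \<open>Charts of the projective plane\<close>

text \<open>
  A coordinate system of the projective plane read in two affine variables; the lift \<open>e\<close> is
  \<open>(1, x, y)\<close> in the affine part and \<open>(s, 1, t)\<close> near a point at infinity.
\<close>

locale lifted_chart =
  fixes U :: "p2 set" and \<phi> :: "p2 \<Rightarrow> complex^2" and e :: "complex \<Rightarrow> complex \<Rightarrow> complex^3"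
  assumes coords: "local_coordinates U \<phi>"
    and lift: "\<And>i a b. bihol_at (\<lambda>x y. e x y $ i) a b" "\<And>x y. e x y \<noteq> 0"
begin

definition coord :: "2 \<Rightarrow> complex \<Rightarrow> complex \<Rightarrow> complex" where
  "coord i x y = \<phi> (hom_coords (e x y)) $ i"

lemma bihol_at_coord:
  assumes "hom_coords (e a b) \<in> U"
  shows "bihol_at (coord i) a b"
  unfolding coord_def[abs_def]
proof (rule bihol_at_compose[where S="cone U" and f="\<lambda>v. \<phi> (hom_coords v) $ i"])
  show "mholomorphic_on (\<lambda>v. \<phi> (hom_coords v) $ i) (cone U)" "open (cone U)"
    using coords by (simp_all add: local_coordinates_def p2_open_def p2_holomorphic_on_def)
  show "e a b \<in> cone U" using assms lift(2) by (simp add: cone_def)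
qed (rule lift(1))

lemma bihol_at_coefficient:
  assumes "mholomorphic_on A (\<phi> ` U)" "hom_coords (e a b) \<in> U"
  shows "bihol_at (\<lambda>x y. A (\<phi> (hom_coords (e x y)))) a b"
proof (rule bihol_at_compose[where S="\<phi> ` U" and f=A])
  show "open (\<phi> ` U)" using coords by (simp add: local_coordinates_def)
  show "bihol_at (\<lambda>x y. \<phi> (hom_coords (e x y)) $ i) a b" for i
    using bihol_at_coord[OF assms(2)] by (simp add: coord_def[abs_def])
qed (use assms in auto)

lemma eventually_in_domain:
  assumes "hom_coords (e a b) \<in> U"
  shows "eventually (\<lambda>z. hom_coords (e (fst z) (snd z)) \<in> U) (nhds (a, b))"
proof -
  have "isCont (\<lambda>z. e (fst z) (snd z)) (a, b)"
    by (rule isCont_vec_componentwise) (rule bihol_at_continuous[OF lift(1)])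
  moreover have "open (cone U)" using coords by (simp add: local_coordinates_def p2_open_def)
  ultimately have "eventually (\<lambda>z. e (fst z) (snd z) \<in> cone U) (nhds (a, b))"
    using topological_tendstoD[OF isCont_tendsto_nhds] assms lift(2) by (fastforce simp: cone_def)
  then show ?thesis by eventually_elim (simp add: cone_def)
qed

context
  fixes f :: "complex \<Rightarrow> p2" and x y :: "complex \<Rightarrow> complex"
  assumes x: "x analytic_on {0}" and y: "y analytic_on {0}"
    and f: "eventually (\<lambda>t. f t = hom_coords (e (x t) (y t))) (nhds 0)"
    and dom: "hom_coords (e (x 0) (y 0)) \<in> U"
begin

lemma germ_start: "f 0 = hom_coords (e (x 0) (y 0))"
  using f by (rule eventually_nhds_x_imp_x)

lemma germ_curve_germ: "curve_germ f"
  unfolding curve_germ_def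
  by (rule exI[of _ "\<lambda>t. e (x t) (y t)"]) (use f lift(2) bihol_at_analytic[OF lift(1) x y] in auto)

lemma germ_coord: "eventually (\<lambda>t. \<phi> (f t) $ i = coord i (x t) (y t)) (nhds 0)"
  using f by eventually_elim (simp add: coord_def)

lemma germ_D1: "D1 (\<lambda>t. \<phi> (f t) $ i) = first_jet (coord i) (x 0) (y 0) (D1 x) (D1 y)"
  unfolding jet_cong(1)[OF germ_coord] first_jet_def
  by (rule bihol_at_jet(1)[where K="coord i", OF bihol_at_coord[OF dom] x y])

lemma germ_D2: "D2 (\<lambda>t. \<phi> (f t) $ i) = second_jet (coord i) (x 0) (y 0) (D1 x) (D1 y) (D2 x) (D2 y)"
  unfolding jet_cong(2)[OF germ_coord] second_jet_def
  by (rule bihol_at_jet(2)[where K="coord i", OF bihol_at_coord[OF dom] x y])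

end

end

section \<open>Weighted homogeneous polynomials and interpolation\<close>

text \<open>
  Weighted homogeneous polynomials in three variables of weights 1, 1 and 3, as functions. The
  inductive form makes stability under products and substitutions immediate.
\<close>

inductive weighted_form :: "nat \<Rightarrow> (complex \<Rightarrow> complex \<Rightarrow> complex \<Rightarrow> complex) \<Rightarrow> bool" where
  monomial: "n = i + j + 3 * k \<Longrightarrow> weighted_form n (\<lambda>p q r. c * p ^ i * q ^ j * r ^ k)"
| add: "weighted_form n f \<Longrightarrow> weighted_form n g \<Longrightarrow> weighted_form n (\<lambda>p q r. f p q r + g p q r)"

lemma weighted_form_zero: "weighted_form n (\<lambda>p q r. 0)"
  using weighted_form.monomial[of n n 0 0 0] by simp

lemma weighted_form_sum:
  "(\<And>i. i \<in> I \<Longrightarrow> weighted_form n (f i)) \<Longrightarrow> weighted_form n (\<lambda>p q r. \<Sum>i\<in>I. f i p q r)"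
  by (induction I rule: infinite_finite_induct) (auto intro: weighted_form_zero weighted_form.add)

lemma weighted_form_mult:
  assumes f: "weighted_form n f" and g: "weighted_form l g"
  shows "weighted_form (n + l) (\<lambda>p q r. f p q r * g p q r)"
  using f
proof induction
  case (monomial n i j k c)
  show ?case using g
  proof induction
    case m: (monomial l i' j' k' c')
    have "weighted_form (n + l) (\<lambda>p q r. (c * c') * p ^ (i + i') * q ^ (j + j') * r ^ (k + k'))"
      by (rule weighted_form.monomial) (use monomial m in simp)
    then show ?case by (simp add: power_add mult_ac)
  next
    case (add l f g)
    then show ?case using weighted_form.add[OF add.IH] by (simp add: distrib_left)
  qed
next
  case (add n f g)
  then show ?case using weighted_form.add[OF add.IH] by (simp add: distrib_right)
qed

lemma weighted_form_mult_degree: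
  "weighted_form n f \<Longrightarrow> weighted_form l g \<Longrightarrow> k = n + l \<Longrightarrow> weighted_form k (\<lambda>p q r. f p q r * g p q r)"
  by (simp add: weighted_form_mult)

lemma weighted_form_const: "weighted_form 0 (\<lambda>p q r. c)"
  using weighted_form.monomial[of 0 0 0 0 c] by simp

lemma weighted_form_scale: "weighted_form n f \<Longrightarrow> weighted_form n (\<lambda>p q r. c * f p q r)"
  using weighted_form_mult[OF weighted_form_const] by simp

lemma weighted_form_power: "weighted_form n f \<Longrightarrow> weighted_form (n * k) (\<lambda>p q r. f p q r ^ k)"
  by (induction k) (auto intro: weighted_form_const weighted_form_mult)

lemma weighted_form_normal_form:
  assumes "weighted_form n f"
  shows "\<exists>c. \<forall>p q r. f p q r = (\<Sum>k\<le>n div 3. \<Sum>j\<le>n - 3 * k. c j k * p ^ (n - 3 * k - j) * q ^ j * r ^ k)"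
  using assms
proof induction
  case (monomial n i j k c)
  define c' where "c' j' k' = (if k' = k then if j' = j then c else 0 else 0)" for j' k'
  have "(\<Sum>k'\<le>n div 3. \<Sum>j'\<le>n - 3 * k'. c' j' k' * p ^ (n - 3 * k' - j') * q ^ j' * r ^ k') = c * p ^ i * q ^ j * r ^ k"
    for p q r
  proof -
    have "(\<Sum>j'\<le>n - 3 * k'. c' j' k' * p ^ (n - 3 * k' - j') * q ^ j' * r ^ k')
        = (if k' = k then c * p ^ i * q ^ j * r ^ k else 0)" for k'
    proof (cases "k' = k")
      case True
      have "(\<Sum>j'\<le>n - 3 * k. c' j' k * p ^ (n - 3 * k - j') * q ^ j' * r ^ k)
         = (\<Sum>j'\<le>n - 3 * k. if j' = j then c * p ^ (n - 3 * k - j) * q ^ j * r ^ k else 0)"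
        by (intro sum.cong) (auto simp: c'_def)
      then show ?thesis using True monomial by (simp add: sum.delta)
    qed (simp add: c'_def)
    then show ?thesis using monomial by (simp add: sum.delta)
  qed
  then show ?case by (intro exI[of _ c'] allI) (rule sym)
next
  case (add n f g)
  then obtain c c' where
    "\<forall>p q r. f p q r = (\<Sum>k\<le>n div 3. \<Sum>j\<le>n - 3 * k. c j k * p ^ (n - 3 * k - j) * q ^ j * r ^ k)"
    "\<forall>p q r. g p q r = (\<Sum>k\<le>n div 3. \<Sum>j\<le>n - 3 * k. c' j k * p ^ (n - 3 * k - j) * q ^ j * r ^ k)"
    by blast
  then show ?case
    by (intro exI[of _ "\<lambda>j k. c j k + c' j k"]) (simp add: sum.distrib distrib_right)
qed

text \<open>
  The weights \<open>L j i\<close> are the coefficients of the Lagrange basis polynomials; they depend on the nodes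
  only, which is what allows limits and bounds to pass from values to coefficients.
\<close>

lemma coeff_interpolation:
  fixes t :: "nat \<Rightarrow> complex"
  assumes inj: "inj_on t {..n}"
  shows "\<exists>L. \<forall>p j. degree p \<le> n \<longrightarrow> coeff p j = (\<Sum>i\<le>n. L j i * poly p (t i))"
proof -
  define l where "l i = (\<Prod>h\<in>{..n} - {i}. smult (1 / (t i - t h)) [:- t h, 1:])" for i
  have deg: "degree (l i) \<le> n" if "i \<le> n" for i
  proof -
    have "degree (l i) \<le> sum (degree \<circ> (\<lambda>h. smult (1 / (t i - t h)) [:- t h, 1:])) ({..n} - {i})"
      unfolding l_def by (rule degree_prod_sum_le) simp
    also have "\<dots> \<le> (\<Sum>h\<in>{..n} - {i}. 1)"
      by (intro sum_mono) (auto intro: degree_smult_le[THEN order_trans])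
    also have "\<dots> = n" using that by simp
    finally show ?thesis .
  qed
  have val: "poly (l i) (t h) = (if h = i then 1 else 0)" if "i \<le> n" "h \<le> n" for i h
  proof (cases "h = i")
    case True
    have "t i \<noteq> t h" if "h \<in> {..n} - {i}" for h
      using inj that \<open>i \<le> n\<close> by (auto dest: inj_onD)
    then have "poly (smult (1 / (t i - t h)) [:- t h, 1:]) (t i) = 1" if "h \<in> {..n} - {i}" for h
      using that by (simp add: diff_divide_distrib[symmetric])
    then have "poly (l i) (t i) = 1" unfolding l_def poly_prod by (rule prod.neutral[rule_format])
    then show ?thesis using True by simp
  next
    case False
    then show ?thesis using that by (auto simp: l_def poly_prod intro!: bexI[of _ h])
  qed
  have "coeff p j = (\<Sum>i\<le>n. coeff (l i) j * poly p (t i))" if p: "degree p \<le> n" for p j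
  proof -
    define q where "q = (\<Sum>i\<le>n. smult (poly p (t i)) (l i))"
    have "p = q"
    proof (rule poly_eqI_degree)
      show "poly p x = poly q x" if "x \<in> t ` {..n}" for x
      proof -
        from that obtain h where h: "h \<le> n" "x = t h" by blast
        have "poly q x = (\<Sum>i\<le>n. if i = h then poly p (t h) else 0)"
          unfolding q_def poly_sum by (intro sum.cong) (use h val in auto)
        then show ?thesis using h by (simp add: sum.delta)
      qed
      have card: "card (t ` {..n}) = Suc n" using card_image[OF inj] by simp
      then show "degree p < card (t ` {..n})" using p by simp
      have "degree q \<le> n" unfolding q_def
        by (intro degree_sum_le) (auto intro: deg)
      then show "degree q < card (t ` {..n})" using card by simp
    qed
    then have "coeff p j = coeff q j" by (rule arg_cong)
    also have "\<dots> = (\<Sum>i\<le>n. coeff (l i) j * poly p (t i))"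
      by (simp add: q_def coeff_sum mult.commute)
    finally show ?thesis .
  qed
  then show ?thesis by (intro exI[of _ "\<lambda>j i. coeff (l i) j"]) blast
qed

lemma double_coeff_interpolation:
  fixes t s :: "nat \<Rightarrow> complex"
  assumes "inj_on t {..m}" "inj_on s {..m}"
  shows "\<exists>L. \<forall>c P. (\<forall>q r. P q r = (\<Sum>k\<le>m div 3. \<Sum>j\<le>m - 3 * k. c j k * q ^ j * r ^ k)) \<longrightarrow>
    (\<forall>k\<le>m div 3. \<forall>j\<le>m - 3 * k. c j k = (\<Sum>i\<le>m. \<Sum>l\<le>m. L j k i l * P (t i) (s l)))"
proof -
  obtain T where T: "\<And>p j. degree p \<le> m \<Longrightarrow> coeff p j = (\<Sum>i\<le>m. T j i * poly p (t i))"
    using coeff_interpolation[OF assms(1)] by blast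
  obtain S where S: "\<And>p j. degree p \<le> m \<Longrightarrow> coeff p j = (\<Sum>i\<le>m. S j i * poly p (s i))"
    using coeff_interpolation[OF assms(2)] by blast
  have "c j k = (\<Sum>i\<le>m. \<Sum>l\<le>m. (T j i * S k l) * P (t i) (s l))"
    if P: "\<And>q r. P q r = (\<Sum>k\<le>m div 3. \<Sum>j\<le>m - 3 * k. c j k * q ^ j * r ^ k)"
      and k: "k \<le> m div 3" and j: "j \<le> m - 3 * k" for c P j k
  proof -
    define a where "a k = (\<Sum>j\<le>m - 3 * k. monom (c j k) j)" for k
    have a: "poly (a k) q = (\<Sum>j\<le>m - 3 * k. c j k * q ^ j)" for k q
      by (simp add: a_def poly_sum poly_monom)
    define b where "b q = (\<Sum>k\<le>m div 3. monom (poly (a k) q) k)" for q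
    have b: "poly (b q) r = P q r" for q r
      by (simp add: b_def a P poly_sum poly_monom sum_distrib_right)
    have "degree (b q) \<le> m" for q
      unfolding b_def by (intro degree_sum_le) (auto intro: order_trans[OF degree_monom_le])
    moreover have "coeff (b q) k = poly (a k) q" for q
      using k by (simp add: b_def coeff_sum sum.delta)
    ultimately have 1: "poly (a k) q = (\<Sum>l\<le>m. S k l * P q (s l))" for q
      using S[of "b q" k] b by simp
    have "degree (a k) \<le> m"
      unfolding a_def by (intro degree_sum_le) (auto intro: order_trans[OF degree_monom_le])
    moreover have "coeff (a k) j = c j k"
      using j by (simp add: a_def coeff_sum sum.delta)
    ultimately have "c j k = (\<Sum>i\<le>m. T j i * poly (a k) (t i))" using T by metis
    then show ?thesis unfolding 1 by (simp add: sum_distrib_left mult.assoc)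
  qed
  then show ?thesis by (intro exI[of _ "\<lambda>j k i l. T j i * S k l"]) blast
qed

section \<open>Jet differentials at a point off the curve\<close>

abbreviation affine_point :: "complex \<Rightarrow> complex \<Rightarrow> p2"
  where "affine_point x y \<equiv> hom_coords (vector [1, x, y])"

lemma affine_lift: "bihol_at (\<lambda>x y. (vector [1, x, y] :: complex^3) $ i) a b" "(vector [1, x, y] :: complex^3) \<noteq> 0"
  using exhaust_3[of i] by (auto simp: vector_3 vec_eq_iff intro: bihol_intros exI[of _ 1])

lemma infinity_lift: "bihol_at (\<lambda>s t. (vector [s, 1, t] :: complex^3) $ i) a b" "(vector [s, 1, t] :: complex^3) \<noteq> 0"
  using exhaust_3[of i] by (auto simp: vector_3 vec_eq_iff intro: bihol_intros exI[of _ 2])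

text \<open>
  \<open>R''\<close> minus its terms in \<open>x''\<close> and \<open>y''\<close>.
\<close>

definition hessian_form :: "poly_xy \<Rightarrow> complex \<Rightarrow> complex \<Rightarrow> complex \<Rightarrow> complex \<Rightarrow> complex" where
  "hessian_form R x y x1 y1 = x1 ^ 2 * eval2 (d_x (d_x R)) x y + 2 * x1 * y1 * eval2 (d_y (d_x R)) x y
     + y1 ^ 2 * eval2 (d_y (d_y R)) x y"

text \<open>
  The denominators disappear in suitable parameters for the 2-jets of curves: put
  \<open>x' = p R\<^sub>y\<close>, \<open>R' / R = q R\<^sub>y\<close> and \<open>\<Delta> = r R\<^sub>y\<close>. Then \<open>y' = q R - p R\<^sub>x\<close>, and \<open>x' y'' - y' x''\<close> is the
  polynomial expression \<open>wronskian\<close> below. So \<open>p\<close> and \<open>q\<close> parametrize vectors tangent to the curve along the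
  curve, and the coefficients of \<open>J\<close> with respect to \<open>(p, q, r)\<close> are the \<open>F\<^sub>j\<^sub>k\<close> themselves: a monomial of
  degrees \<open>m - 3k - j\<close>, \<open>j\<close> and \<open>k\<close> carries \<open>R\<^sub>y\<close> to the power \<open>m - 2k\<close>. The parametrization also makes sense where
  \<open>R\<^sub>y\<close> vanishes.
\<close>

definition tangent_y :: "poly_xy \<Rightarrow> complex \<Rightarrow> complex \<Rightarrow> complex \<Rightarrow> complex \<Rightarrow> complex" where
  "tangent_y R x y p q = eval2 R x y * q - eval2 (d_x R) x y * p"

definition tangent_x :: "poly_xy \<Rightarrow> complex \<Rightarrow> complex \<Rightarrow> complex \<Rightarrow> complex" where
  "tangent_x R x y p = eval2 (d_y R) x y * p"

definition wronskian :: "poly_xy \<Rightarrow> complex \<Rightarrow> complex \<Rightarrow> complex \<Rightarrow> complex \<Rightarrow> complex \<Rightarrow> complex" where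
  "wronskian R x y p q r = eval2 R x y * r + p * (eval2 R x y * q ^ 2 * eval2 (d_y R) x y ^ 2
     - hessian_form R x y (tangent_x R x y p) (tangent_y R x y p q))"

lemma weighted_form_tangents:
  "weighted_form 1 (\<lambda>p q r. tangent_x R x y p)" "weighted_form 1 (\<lambda>p q r. tangent_y R x y p q)"
  "weighted_form 3 (\<lambda>p q r. wronskian R x y p q r)"
proof -
  have p: "weighted_form 1 (\<lambda>p q r. p)" and q: "weighted_form 1 (\<lambda>p q r. q)" and r: "weighted_form 3 (\<lambda>p q r. r)"
    using weighted_form.monomial[of 1 1 0 0 1] weighted_form.monomial[of 1 0 1 0 1] weighted_form.monomial[of 3 0 0 1 1]
    by simp_all
  show x: "weighted_form 1 (\<lambda>p q r. tangent_x R x y p)"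
    unfolding tangent_x_def by (intro weighted_form_scale p)
  show y: "weighted_form 1 (\<lambda>p q r. tangent_y R x y p q)"
    using weighted_form.add[OF weighted_form_scale[OF q, of "eval2 R x y"] weighted_form_scale[OF p, of "- eval2 (d_x R) x y"]]
    unfolding tangent_y_def by simp
  have two: "2 = 1 + (1 :: nat)" and three: "3 = 1 + (2 :: nat)" by simp_all
  note xx = weighted_form_mult_degree[OF x x two] and xy = weighted_form_mult_degree[OF x y two]
    and yy = weighted_form_mult_degree[OF y y two]
  note h = weighted_form.add[OF weighted_form.add[OF weighted_form_scale[OF xx, of "- eval2 (d_x (d_x R)) x y"]
     weighted_form_scale[OF xy, of "- 2 * eval2 (d_y (d_x R)) x y"]] weighted_form_scale[OF yy, of "- eval2 (d_y (d_y R)) x y"]]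
  note w = weighted_form.add[OF weighted_form_scale[OF weighted_form_mult_degree[OF q q two], of "eval2 R x y * eval2 (d_y R) x y ^ 2"] h]
  have "weighted_form 3 (\<lambda>p q r. eval2 R x y * r + p * ((eval2 R x y * (eval2 (d_y R) x y)\<^sup>2) * (q * q) +
        (- eval2 (d_x (d_x R)) x y * (tangent_x R x y p * tangent_x R x y p) +
         - 2 * eval2 (d_y (d_x R)) x y * (tangent_x R x y p * tangent_y R x y p q) +
         - eval2 (d_y (d_y R)) x y * (tangent_y R x y p q * tangent_y R x y p q))))"
    using weighted_form.add[OF weighted_form_scale[OF r, of "eval2 R x y"] weighted_form_mult_degree[OF p w three]] .
  then show "weighted_form 3 (\<lambda>p q r. wronskian R x y p q r)"
    unfolding wronskian_def hessian_form_def by (simp add: algebra_simps power2_eq_square)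
qed

text \<open>
  In local coordinates, \<open>u\<^sub>1 w\<^sub>2 - u\<^sub>2 w\<^sub>1\<close> is the Jacobian times \<open>x' y'' - y' x''\<close> plus a cubic form in
  \<open>(x', y')\<close>. Hence the local expression of \<open>J\<close> is weighted homogeneous in \<open>(x', y', x' y'' - y' x'')\<close>, and
  these in turn are weighted homogeneous in \<open>(p, q, r)\<close>.
\<close>

lemma plain_form_coefficients:
  assumes "plain_local_form C m J (affine_point a b)"
  shows "\<exists>c. \<forall>f x y p q r. x analytic_on {0} \<and> y analytic_on {0} \<and>
      (\<forall>\<^sub>F t in nhds 0. f t = affine_point (x t) (y t)) \<and> x 0 = a \<and> y 0 = b \<and>
      D1 x = tangent_x R a b p \<and> D1 y = tangent_y R a b p q \<and> D1 x * D2 y - D1 y * D2 x = wronskian R a b p q r \<longrightarrow>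
    J f = (\<Sum>k\<le>m div 3. \<Sum>j\<le>m - 3 * k. c j k * p ^ (m - 3 * k - j) * q ^ j * r ^ k)"
proof -
  obtain U \<phi> A where U: "local_coordinates U \<phi>" "affine_point a b \<in> U"
    and J: "\<And>f. curve_germ f \<Longrightarrow> f 0 \<in> U \<Longrightarrow> J f = jet_expression m A (\<phi> (f 0))
        (D1 (\<lambda>\<zeta>. \<phi> (f \<zeta>) $ 1)) (D1 (\<lambda>\<zeta>. \<phi> (f \<zeta>) $ 2)) (D2 (\<lambda>\<zeta>. \<phi> (f \<zeta>) $ 1)) (D2 (\<lambda>\<zeta>. \<phi> (f \<zeta>) $ 2))"
    using assms unfolding plain_local_form_def Let_def by blast
  interpret lifted_chart U \<phi> "\<lambda>x y. vector [1, x, y]"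
    by unfold_locales (fact U affine_lift)+
  define X where "X p = tangent_x R a b p" for p
  define Y where "Y p q = tangent_y R a b p q" for p q
  define u where "u i p q = first_jet (coord i) a b (X p) (Y p q)" for i p q
  define v where "v i p q = second_jet (coord i) a b (X p) (Y p q) 0 0" for i p q
  define jac where "jac = dx (coord 1) a b * dy (coord 2) a b - dy (coord 1) a b * dx (coord 2) a b"
  define F where "F p q r = (\<Sum>j\<le>m div 3. \<Sum>(\<alpha>1, \<alpha>2)\<in>{(\<alpha>1, \<alpha>2). \<alpha>1 + \<alpha>2 = m - 3 * j}.
        A \<alpha>1 \<alpha>2 j (\<phi> (affine_point a b)) * u 1 p q ^ \<alpha>1 * u 2 p q ^ \<alpha>2 *
        (jac * wronskian R a b p q r + (u 1 p q * v 2 p q - u 2 p q * v 1 p q)) ^ j)" for p q r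
  note XY = weighted_form_tangents(1,2)[of R a b, folded X_def Y_def]
  have u: "weighted_form 1 (\<lambda>p q r. u i p q)" for i
    unfolding u_def first_jet_def by (intro weighted_form.add weighted_form_scale XY)
  have "weighted_form 2 (\<lambda>p q r. dx (dx (coord i)) a b * (X p * X p) +
      (dy (dx (coord i)) a b + dx (dy (coord i)) a b) * (X p * Y p q) + dy (dy (coord i)) a b * (Y p q * Y p q))" for i
    by (intro weighted_form.add weighted_form_scale weighted_form_mult_degree[OF _ _ one_add_one[symmetric]] XY)
  then have v: "weighted_form 2 (\<lambda>p q r. v i p q)" for i
    unfolding v_def second_jet_def by (simp add: power2_eq_square mult.assoc)
  have "weighted_form 3 (\<lambda>p q r. u 1 p q * v 2 p q + (-1) * (u 2 p q * v 1 p q))"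
    by (intro weighted_form.add weighted_form_scale weighted_form_mult_degree[of 1 _ 2 _ 3] u v) simp_all
  then have det: "weighted_form 3 (\<lambda>p q r. jac * wronskian R a b p q r + (u 1 p q * v 2 p q - u 2 p q * v 1 p q))"
    by (intro weighted_form.add weighted_form_scale weighted_form_tangents) simp
  have "weighted_form m F"
    unfolding F_def[abs_def]
  proof (intro weighted_form_sum, clarsimp)
    fix j \<alpha>1 \<alpha>2 assume j: "j \<le> m div 3" "\<alpha>1 + \<alpha>2 = m - 3 * j"
    have "weighted_form (0 + 1 * \<alpha>1 + 1 * \<alpha>2 + 3 * j) (\<lambda>p q r. A \<alpha>1 \<alpha>2 j (\<phi> (affine_point a b)) * u 1 p q ^ \<alpha>1 * u 2 p q ^ \<alpha>2 *
        (jac * wronskian R a b p q r + (u 1 p q * v 2 p q - u 2 p q * v 1 p q)) ^ j)"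
      by (intro weighted_form_mult weighted_form_power weighted_form_const u det)
    moreover have "0 + 1 * \<alpha>1 + 1 * \<alpha>2 + 3 * j = m" using j by auto
    ultimately show "weighted_form m (\<lambda>p q r. A \<alpha>1 \<alpha>2 j (\<phi> (affine_point a b)) * u 1 p q ^ \<alpha>1 * u 2 p q ^ \<alpha>2 *
        (jac * wronskian R a b p q r + (u 1 p q * v 2 p q - u 2 p q * v 1 p q)) ^ j)" by metis
  qed
  then obtain c where c: "\<And>p q r. F p q r = (\<Sum>k\<le>m div 3. \<Sum>j\<le>m - 3 * k. c j k * p ^ (m - 3 * k - j) * q ^ j * r ^ k)"
    using weighted_form_normal_form by blast
  have main: "J f = F p q r"
    if xy: "x analytic_on {0}" "y analytic_on {0}" and f: "\<forall>\<^sub>F t in nhds 0. f t = affine_point (x t) (y t)"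
      and 0: "x 0 = a" "y 0 = b" and 1: "D1 x = X p" "D1 y = Y p q"
      and W: "D1 x * D2 y - D1 y * D2 x = wronskian R a b p q r" for f x y p q r
  proof -
    have dom: "affine_point (x 0) (y 0) \<in> U" using 0 U by simp
    have f0: "f 0 = affine_point a b" using germ_start[OF xy f dom] 0 by simp
    have D1: "D1 (\<lambda>\<zeta>. \<phi> (f \<zeta>) $ i) = u i p q" for i
      using germ_D1[OF xy f dom] by (simp add: 0 1 u_def)
    have D2: "D2 (\<lambda>\<zeta>. \<phi> (f \<zeta>) $ i) = v i p q + (dx (coord i) a b * D2 x + dy (coord i) a b * D2 y)" for i
      using germ_D2[OF xy f dom] by (simp add: 0 1 v_def second_jet_def)
    have "u 1 p q * (v 2 p q + (dx (coord 2) a b * D2 x + dy (coord 2) a b * D2 y))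
        - u 2 p q * (v 1 p q + (dx (coord 1) a b * D2 x + dy (coord 1) a b * D2 y))
        = jac * wronskian R a b p q r + (u 1 p q * v 2 p q - u 2 p q * v 1 p q)"
      unfolding W[symmetric] 1 by (simp add: jac_def u_def first_jet_def algebra_simps)
    then show ?thesis
      using J[OF germ_curve_germ[OF xy f dom]] U(2) by (simp add: f0 D1 D2 F_def jet_expression_def)
  qed
  show ?thesis
    by (intro exI[of _ c] allI impI, elim conjE, subst c[symmetric], rule main)
      (assumption | simp add: X_def Y_def)+
qed

section \<open>Jet differentials along families of germs\<close>

definition quadratic :: "complex \<Rightarrow> complex \<Rightarrow> complex \<Rightarrow> complex \<Rightarrow> complex" where
  "quadratic a a1 a2 t = a + a1 * t + a2 * t\<^sup>2 / 2"

lemma quadratic_deriv: "(quadratic a a1 a2 has_field_derivative a1 + a2 * t) (at t)"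
  unfolding quadratic_def[abs_def] by (auto intro!: derivative_eq_intros)

lemma quadratic_jet:
  "quadratic a a1 a2 analytic_on S" "quadratic a a1 a2 0 = a"
  "D1 (quadratic a a1 a2) = a1" "D2 (quadratic a a1 a2) = a2"
proof -
  have "quadratic a a1 a2 holomorphic_on UNIV"
    unfolding quadratic_def[abs_def] by (intro holomorphic_intros) auto
  then show "quadratic a a1 a2 analytic_on S"
    by (meson analytic_on_holomorphic open_UNIV subset_UNIV)
  have 1: "deriv (quadratic a a1 a2) = (\<lambda>t. a1 + a2 * t)"
    using DERIV_imp_deriv[OF quadratic_deriv] by blast
  then show "D1 (quadratic a a1 a2) = a1" by (simp add: D1_def)
  have "((\<lambda>t. a1 + a2 * t) has_field_derivative a2) (at 0)"
    by (auto intro!: derivative_eq_intros)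
  then show "D2 (quadratic a a1 a2) = a2" by (simp add: D2_def 1 DERIV_imp_deriv)
qed (simp add: quadratic_def)

definition jet_curve :: "complex \<Rightarrow> complex \<Rightarrow> complex \<Rightarrow> complex \<Rightarrow> complex \<Rightarrow> complex \<Rightarrow> complex \<Rightarrow> p2" where
  "jet_curve a b a1 b1 a2 b2 t = affine_point (quadratic a a1 a2 t) (quadratic b b1 b2 t)"

text \<open>
  Along germs whose 2-jets vary holomorphically with the base point, \<open>J\<close> is holomorphic off the
  curve.
\<close>

lemma plain_form_bihol:
  assumes form: "plain_local_form C m J (affine_point a b)"
    and jets: "bihol_at X1 a b" "bihol_at Y1 a b" "bihol_at X2 a b" "bihol_at Y2 a b"
  shows "\<exists>G. bihol_at G a b \<and>
    (\<forall>\<^sub>F (x, y) in nhds (a, b). J (jet_curve x y (X1 x y) (Y1 x y) (X2 x y) (Y2 x y)) = G x y)"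
proof -
  obtain U \<phi> A where U: "local_coordinates U \<phi>" "affine_point a b \<in> U"
    and A: "\<And>\<alpha>1 \<alpha>2 j. mholomorphic_on (A \<alpha>1 \<alpha>2 j) (\<phi> ` U)"
    and J: "\<And>f. curve_germ f \<Longrightarrow> f 0 \<in> U \<Longrightarrow> J f = jet_expression m A (\<phi> (f 0))
        (D1 (\<lambda>\<zeta>. \<phi> (f \<zeta>) $ 1)) (D1 (\<lambda>\<zeta>. \<phi> (f \<zeta>) $ 2)) (D2 (\<lambda>\<zeta>. \<phi> (f \<zeta>) $ 1)) (D2 (\<lambda>\<zeta>. \<phi> (f \<zeta>) $ 2))"
    using form unfolding plain_local_form_def Let_def by blast
  interpret lifted_chart U \<phi> "\<lambda>x y. vector [1, x, y]"
    by unfold_locales (fact U affine_lift)+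
  define G where "G x y = jet_expression m A (\<phi> (affine_point x y))
    (first_jet (coord 1) x y (X1 x y) (Y1 x y)) (first_jet (coord 2) x y (X1 x y) (Y1 x y))
    (second_jet (coord 1) x y (X1 x y) (Y1 x y) (X2 x y) (Y2 x y))
    (second_jet (coord 2) x y (X1 x y) (Y1 x y) (X2 x y) (Y2 x y))" for x y
  have "bihol_at G a b"
    unfolding G_def[abs_def]
    by (intro bihol_at_jet_expression bihol_at_coefficient bihol_at_first_jet bihol_at_second_jet bihol_at_coord U A jets)
  moreover have "\<forall>\<^sub>F z in nhds (a, b). case z of (x, y) \<Rightarrow> J (jet_curve x y (X1 x y) (Y1 x y) (X2 x y) (Y2 x y)) = G x y"
    using eventually_in_domain[OF U(2)]
  proof (eventually_elim, clarify)
    fix x y assume dom: "affine_point (fst (x, y)) (snd (x, y)) \<in> U"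
    let ?f = "jet_curve x y (X1 x y) (Y1 x y) (X2 x y) (Y2 x y)"
    let ?x = "quadratic x (X1 x y) (X2 x y)" and ?y = "quadratic y (Y1 x y) (Y2 x y)"
    have f: "\<forall>\<^sub>F t in nhds 0. ?f t = affine_point (?x t) (?y t)"
      by (simp add: jet_curve_def)
    have dom': "affine_point (?x 0) (?y 0) \<in> U" using dom by (simp add: quadratic_jet)
    note an = quadratic_jet(1)
    note g = germ_start[OF an an f dom'] germ_curve_germ[OF an an f dom']
      germ_D1[OF an an f dom'] germ_D2[OF an an f dom']
    show "J ?f = G x y"
      using J[OF g(2)] dom by (simp add: g quadratic_jet G_def)
  qed
  ultimately show ?thesis by blast
qed

section \<open>Logarithmic derivatives of equations of the same curve\<close>

lemma jet_mult:
  assumes f: "f analytic_on {0}" and g: "g analytic_on {0}"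
  shows "D1 (\<lambda>t. f t * g t) = D1 f * g 0 + D1 g * f 0"
    and "D2 (\<lambda>t. f t * g t) = D2 f * g 0 + 2 * D1 f * D1 g + D2 g * f 0"
proof -
  note evf = eventually_analytic_at[OF f] and evg = eventually_analytic_at[OF g] and der = analytic_at_has_derivative
  have prod: "deriv (\<lambda>t. f t * g t) t = deriv f t * g t + deriv g t * f t"
    if "f analytic_on {t}" "g analytic_on {t}" for t
    by (rule DERIV_imp_deriv) (rule DERIV_mult[OF der[OF that(1)] der[OF that(2)]])
  show "D1 (\<lambda>t. f t * g t) = D1 f * g 0 + D1 g * f 0"
    unfolding D1_def using f g by (intro prod)
  from evf evg have "eventually (\<lambda>t. deriv (\<lambda>t. f t * g t) t = deriv f t * g t + deriv g t * f t) (nhds 0)"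
    by eventually_elim (rule prod)
  then have "D2 (\<lambda>t. f t * g t) = deriv (\<lambda>t. deriv f t * g t + deriv g t * f t) 0"
    unfolding D2_def by (rule deriv_cong_ev[OF _ refl])
  also have "\<dots> = D2 f * g 0 + 2 * D1 f * D1 g + D2 g * f 0"
    unfolding D1_def D2_def
    by (rule DERIV_imp_deriv, rule DERIV_cong[OF DERIV_add[OF DERIV_mult[OF der[OF analytic_deriv[OF f]] der[OF g]]
        DERIV_mult[OF der[OF analytic_deriv[OF g]] der[OF f]]]]) (simp add: algebra_simps)
  finally show "D2 (\<lambda>t. f t * g t) = D2 f * g 0 + 2 * D1 f * D1 g + D2 g * f 0" .
qed

lemma logD_mult:
  assumes "f analytic_on {0}" "f 0 \<noteq> 0" "g analytic_on {0}" "g 0 \<noteq> 0"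
  shows "logD1 (\<lambda>t. f t * g t) = logD1 f + logD1 g" "logD2 (\<lambda>t. f t * g t) = logD2 f + logD2 g"
  using assms by (simp_all add: logD1_def logD2_def jet_mult field_simps power2_eq_square)

lemma reciprocal_jet:
  assumes f: "f analytic_on {0}" and f0: "f 0 \<noteq> 0"
  shows "D1 (\<lambda>t. 1 / f t) = - (D1 f * (1 / f 0)\<^sup>2)"
    and "D2 (\<lambda>t. 1 / f t) = - (D2 f * (1 / f 0)\<^sup>2) + 2 * (D1 f)\<^sup>2 * (1 / f 0) ^ 3"
proof -
  have an: "(\<lambda>t. 1 / f t) analytic_on {0}"
    using f f0 by (intro analytic_intros) auto
  have "eventually (\<lambda>t. f t \<noteq> 0) (nhds 0)"
    using tendsto_imp_eventually_ne[OF isCont_tendsto_nhds[OF analytic_at_imp_isCont[OF f]] f0] .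
  then have "eventually (\<lambda>t. f t * (1 / f t) = 1) (nhds 0)" by eventually_elim simp
  from jet_cong(1,2)[OF this] have 1: "D1 f * (1 / f 0) + D1 (\<lambda>t. 1 / f t) * f 0 = 0"
    and 2: "D2 f * (1 / f 0) + 2 * D1 f * D1 (\<lambda>t. 1 / f t) + D2 (\<lambda>t. 1 / f t) * f 0 = 0"
    unfolding jet_mult[OF f an] by (simp_all add: D1_def D2_def)
  from 1 show 3: "D1 (\<lambda>t. 1 / f t) = - (D1 f * (1 / f 0)\<^sup>2)"
    using f0 by (simp add: field_simps power2_eq_square add_eq_0_iff)
  from 2 show "D2 (\<lambda>t. 1 / f t) = - (D2 f * (1 / f 0)\<^sup>2) + 2 * (D1 f)\<^sup>2 * (1 / f 0) ^ 3"
    unfolding 3 using f0 by (simp add: field_simps power2_eq_square power3_eq_cube add_eq_0_iff)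
qed

text \<open>
  The quotient of two functions that bound each other extends holomorphically across the common
  zeros, and so does its inverse; its logarithmic derivatives are controlled by Cauchy's inequality.
\<close>

lemma logD_difference_bound:
  assumes u: "u holomorphic_on ball 0 \<rho>" and v: "v holomorphic_on ball 0 \<rho>" and \<rho>: "0 < \<rho>"
    and uv: "\<And>t. t \<in> ball 0 \<rho> \<Longrightarrow> norm (u t) \<le> M * norm (v t)"
    and vu: "\<And>t. t \<in> ball 0 \<rho> \<Longrightarrow> norm (v t) \<le> M * norm (u t)"
    and v0: "v 0 \<noteq> 0"
  shows "norm (logD1 u - logD1 v) \<le> M * (M / (\<rho>/4))"
    and "norm (logD2 u - logD2 v) \<le> M * (2 * M / (\<rho>/4)\<^sup>2) + (M * (M / (\<rho>/4)))\<^sup>2"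
proof -
  \<comment> \<open>half the radius, so that there are only finitely many zeros\<close>
  define Z where "Z = {t \<in> cball 0 (\<rho>/2). v t = 0}"
  have fin: "finite Z"
  proof (cases "v constant_on ball 0 \<rho>")
    case True
    then have "Z = {}" using v0 \<rho> by (fastforce simp: Z_def constant_on_def)
    then show ?thesis by simp
  next
    case False
    show ?thesis unfolding Z_def
      by (rule holomorphic_compact_finite_zeros[OF v]) (use False \<rho> in auto)
  qed
  define B where "B = ball (0::complex) (\<rho>/2)"
  have Bsub: "B \<subseteq> ball 0 \<rho>" using \<rho> by (auto simp: B_def)
  have 0: "0 \<in> B - Z" using \<rho> v0 by (auto simp: B_def Z_def)
  have nz: "v t \<noteq> 0" if "t \<in> B - Z" for t using that by (auto simp: B_def Z_def)
  have M: "0 \<le> M" using uv[of 0] v0 \<rho> by (smt (verit) centre_in_ball mult_neg_pos norm_ge_zero zero_less_norm_iff)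
  have q: "norm (u t / v t) \<le> M" if "t \<in> B - Z" for t
    using uv[of t] nz[OF that] that Bsub by (auto simp: norm_divide divide_le_eq)
  have "\<exists>g. g holomorphic_on B \<and> (\<forall>t\<in>B - Z \<inter> B. g t = u t / v t)"
  proof (rule removable_singularities)
    show "finite (Z \<inter> B)" using fin by simp
    show "Z \<inter> B \<subseteq> interior B" by (simp add: B_def interior_open)
    show "(\<lambda>t. u t / v t) holomorphic_on B - Z \<inter> B"
      using u v Bsub nz by (intro holomorphic_intros) (auto intro: holomorphic_on_subset)
    fix z assume z: "z \<in> Z \<inter> B"
    have "open (B - (Z - {z}))" using fin by (auto simp: B_def intro!: open_Diff finite_imp_closed)
    then have "eventually (\<lambda>t. t \<in> B - (Z - {z})) (nhds z)" using z by (intro eventually_nhds_in_open) auto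
    then have "eventually (\<lambda>t. norm (u t / v t) \<le> M * norm (1::complex)) (at z)"
      unfolding eventually_at_filter by eventually_elim (use q in auto)
    then show "(\<lambda>t. u t / v t) \<in> O[at z](\<lambda>_. 1)" by (rule bigoI)
  qed
  then obtain g where g: "g holomorphic_on B" and guv: "\<And>t. t \<in> B - Z \<Longrightarrow> g t = u t / v t" by auto
  have gM: "norm (g t) \<le> M" if t: "t \<in> B" for t
  proof (rule tendsto_upperbound)
    show "((\<lambda>t. norm (g t)) \<longlongrightarrow> norm (g t)) (at t)"
      using holomorphic_on_imp_continuous_on[OF g] t
      by (intro tendsto_norm) (simp add: B_def continuous_on_eq_continuous_at isCont_def)
    have "open (B - (Z - {t}))" using fin by (auto simp: B_def intro!: open_Diff finite_imp_closed)
    then have "eventually (\<lambda>s. s \<in> B - (Z - {t})) (nhds t)" using t by (intro eventually_nhds_in_open) auto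
    then show "eventually (\<lambda>s. norm (g s) \<le> M) (at t)"
      unfolding eventually_at_filter
    proof eventually_elim
      case (elim s)
      then show ?case using guv[of s] q[of s] by auto
    qed
  qed simp
  have "norm ((deriv ^^ n) g 0) \<le> fact n * M / (\<rho>/2/2) ^ n" for n
    by (rule deriv_bound[OF g[unfolded B_def]]) (use gM \<rho> in \<open>auto simp: B_def\<close>)
  from this[of 1] this[of 2] have g1: "norm (D1 g) \<le> M / (\<rho>/4)" and g2: "norm (D2 g) \<le> 2 * M / (\<rho>/4)\<^sup>2"
    by (simp_all add: D1_def D2_def numeral_2_eq_2)
  have g0: "g 0 = u 0 / v 0" using 0 by (rule guv)
  have u0: "u 0 \<noteq> 0" using vu[of 0] v0 \<rho> by auto
  then have g0_nz: "g 0 \<noteq> 0" using v0 g0 by simp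
  have ig: "norm (inverse (g 0)) \<le> M"
    using vu[of 0] \<rho> u0 by (simp add: g0 norm_divide divide_le_eq)
  have oB: "open (B - Z)" using fin by (auto simp: B_def intro!: open_Diff finite_imp_closed)
  have an: "v analytic_on {0}" "g analytic_on {0}"
    using v g \<rho> by (auto simp: analytic_at B_def intro!: exI[of _ "ball 0 \<rho>"] exI[of _ "ball 0 (\<rho>/2)"])
  have "eventually (\<lambda>t. u t = g t * v t) (nhds 0)"
    using eventually_nhds_in_open[OF oB 0] by eventually_elim (simp add: guv nz)
  from jet_cong(3,4)[OF this] logD_mult[OF an(2) g0_nz an(1) v0]
  have eq: "logD1 u - logD1 v = D1 g * inverse (g 0)" "logD2 u - logD2 v = D2 g * inverse (g 0) - (D1 g * inverse (g 0))\<^sup>2"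
    by (simp_all add: logD1_def logD2_def power_divide divide_inverse power_mult_distrib power_inverse)
  have 1: "norm (D1 g * inverse (g 0)) \<le> M * (M / (\<rho>/4))"
    unfolding norm_mult using mult_mono[OF g1 ig] M \<rho> by (simp add: mult.commute)
  then show "norm (logD1 u - logD1 v) \<le> M * (M / (\<rho>/4))" by (simp add: eq)
  have 2: "norm (D2 g * inverse (g 0)) \<le> M * (2 * M / (\<rho>/4)\<^sup>2)"
    unfolding norm_mult using mult_mono[OF g2 ig] M \<rho> by (simp add: mult.commute)
  have "norm ((D1 g * inverse (g 0))\<^sup>2) \<le> (M * (M / (\<rho>/4)))\<^sup>2"
    unfolding norm_power using 1 by (intro power_mono) auto
  with 2 show "norm (logD2 u - logD2 v) \<le> M * (2 * M / (\<rho>/4)\<^sup>2) + (M * (M / (\<rho>/4)))\<^sup>2"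
    unfolding eq by (intro norm_triangle_le_diff add_mono)
qed

text \<open>
  Two cases for each fixed \<open>x\<close>. Near \<open>(a, b)\<close>, \<open>K x\<close> shrinks distances at most by a constant factor, as
  \<open>\<partial>\<^sub>y K\<close> is close to a nonzero number. If it has a zero \<open>y'\<close>, then \<open>P x\<close> vanishes there too and both functions are compared with
  \<open>|y - y'|\<close>. If it has none, the quotient is holomorphic on a disc on whose boundary \<open>K x\<close> is not small,
  and the maximum principle applies.
\<close>

lemma holomorphic_ratio_bound:
  assumes K: "bihol_at K a b" and P: "bihol_at P a b"
    and K0: "K a b = 0" and dK: "dy K a b \<noteq> 0"
    and vanish: "eventually (\<lambda>z. K (fst z) (snd z) = 0 \<longrightarrow> P (fst z) (snd z) = 0) (nhds (a, b))"
  shows "\<exists>M. eventually (\<lambda>z. norm (P (fst z) (snd z)) \<le> M * norm (K (fst z) (snd z))) (nhds (a, b))"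
proof -
  define c where "c = dy K a b"
  obtain rK MK where rK: "bihol_on K a b rK MK" using K by (auto simp: bihol_at_def)
  obtain rP MP where rP: "bihol_on P a b rP MP" using P by (auto simp: bihol_at_def)
  have "eventually (\<lambda>z. dist (dy K (fst z) (snd z)) c < norm c / 2) (nhds (a, b))"
    using tendstoD[OF isCont_tendsto_nhds[OF bihol_at_continuous[OF bihol_at_dy[OF K]]], of "norm c / 2"] dK
    by (simp add: c_def)
  from eventually_conj[OF this vanish] obtain r0 where r0: "0 < r0"
    and near: "\<And>x y. x \<in> ball a r0 \<Longrightarrow> y \<in> ball b r0 \<Longrightarrow> dist (dy K x y) c < norm c / 2 \<and> (K x y = 0 \<longrightarrow> P x y = 0)"
    by (rule eventually_nhds_polydisc) (rule that, assumption, simp)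
  define \<delta> where "\<delta> = min r0 (min (rK / 2) (rP / 2))"
  have rpos: "0 < rK" "0 < rP" using rK rP by (auto simp: bihol_on_def)
  have \<delta>: "0 < \<delta>" "\<delta> \<le> r0" "\<delta> \<le> rK / 2" "\<delta> \<le> rP / 2" using r0 rpos by (auto simp: \<delta>_def)
  have S': "dist (dy K x y) c < norm c / 2 \<and> (K x y = 0 \<longrightarrow> P x y = 0)"
    if "x \<in> ball a \<delta>" "y \<in> ball b \<delta>" for x y
    using near that \<delta>(2) by simp
  have sepK: "norm c / 2 * norm (y - y') \<le> norm (K x y - K x y')"
    if x: "x \<in> ball a \<delta>" and y: "y \<in> ball b \<delta>" "y' \<in> ball b \<delta>" for x y y'
  proof -
    have "norm ((K x y - c * y) - (K x y' - c * y')) \<le> norm c / 2 * norm (y - y')"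
    proof (rule field_differentiable_bound[of "ball b \<delta>" "\<lambda>y. K x y - c * y" "\<lambda>y. dy K x y - c"])
      fix z assume z: "z \<in> ball b \<delta>"
      have "K x holomorphic_on ball b rK" using rK x \<delta> rpos by (auto simp: bihol_on_def)
      then have "(K x has_field_derivative dy K x z) (at z)"
        using z \<delta> rpos by (intro holomorphic_derivI[OF _ open_ball]) auto
      then show "((\<lambda>y. K x y - c * y) has_field_derivative dy K x z - c) (at z within ball b \<delta>)"
        using DERIV_diff[OF _ DERIV_cmult_Id] by (blast intro: has_field_derivative_at_within)
      show "norm (dy K x z - c) \<le> norm c / 2"
        using S'[OF x z] by (simp add: dist_norm)
    qed (use y in auto)
    moreover have "(K x y - c * y) - (K x y' - c * y') = (K x y - K x y') - c * (y - y')"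
      by (simp add: algebra_simps)
    moreover have "norm (c * (y - y')) \<le> norm (K x y - K x y') + norm ((K x y - K x y') - c * (y - y'))"
      using norm_triangle_ineq4[of "K x y - K x y'" "(K x y - K x y') - c * (y - y')"] by simp
    ultimately show ?thesis by (simp add: norm_mult)
  qed
  have LP: "norm (P x y - P x y') \<le> 4 * MP / rP * norm (y - y')"
    if "x \<in> ball a \<delta>" "y \<in> ball b \<delta>" "y' \<in> ball b \<delta>" for x y y'
    by (rule bihol_on_Lipschitz_y[OF rP]) (use that \<delta> in auto)
  have MP: "0 \<le> MP"
    using rP rpos unfolding bihol_on_def by (meson centre_in_ball norm_ge_zero order_trans)
  \<comment> \<open>the two entries belong to the two cases\<close>
  define M where "M = max (4 * MP / rP / (norm c / 2)) (MP / (norm c * \<delta> / 8))"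
  have c: "0 < norm c" using dK by (simp add: c_def)
  have contK: "isCont (\<lambda>x. K x b) a"
    using bihol_at_partial_derivatives(1)[OF K] DERIV_isCont by blast
  then have "eventually (\<lambda>x. norm (K x b) < norm c * \<delta> / 8) (nhds a)"
    using tendstoD[OF isCont_tendsto_nhds[OF contK], of "norm c * \<delta> / 8"] c \<delta>(1) K0 by simp
  then have ev: "eventually (\<lambda>z. norm (K (fst z) b) < norm c * \<delta> / 8) (nhds (a, b))"
    using eventually_compose_filterlim[OF _ tendsto_fst[OF filterlim_ident]] by fastforce
  have "eventually (\<lambda>z. fst z \<in> ball a (\<delta>/2) \<and> snd z \<in> ball b (\<delta>/2)) (nhds (a, b))"
    by (rule eventually_polydisc) (use \<delta> in simp)
  with ev have "eventually (\<lambda>z. norm (P (fst z) (snd z)) \<le> M * norm (K (fst z) (snd z))) (nhds (a, b))"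
  proof eventually_elim
    case (elim z)
    define x y where "x = fst z" and "y = snd z"
    have x: "x \<in> ball a \<delta>" and y: "y \<in> ball b \<delta>" "y \<in> ball b (\<delta>/2)" and Kb: "norm (K x b) < norm c * \<delta> / 8"
      using elim \<delta> by (auto simp: x_def y_def)
    have "norm (P x y) \<le> M * norm (K x y)"
    proof (cases "\<exists>y'\<in>ball b \<delta>. K x y' = 0")
      case True
      then obtain y' where y': "y' \<in> ball b \<delta>" "K x y' = 0" by blast
      then have "P x y' = 0" using S'[OF x y'(1)] y'(2) by simp
      then have "norm (P x y) \<le> 4 * MP / rP * norm (y - y')" using LP[OF x y(1) y'(1)] by simp
      also have "norm (y - y') \<le> norm (K x y) / (norm c / 2)"
        using sepK[OF x y(1) y'(1)] y'(2) c by (simp add: field_simps)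
      then have "4 * MP / rP * norm (y - y') \<le> 4 * MP / rP * (norm (K x y) / (norm c / 2))"
        using MP rpos by (intro mult_left_mono) auto
      also have "\<dots> = 4 * MP / rP / (norm c / 2) * norm (K x y)" by simp
      also have "\<dots> \<le> M * norm (K x y)" by (intro mult_right_mono) (auto simp: M_def)
      finally show ?thesis .
    next
      case False
      have holK: "K x holomorphic_on ball b \<delta>"
        by (rule holomorphic_on_subset[of _ "ball b rK"]) (use rK x \<delta> rpos in \<open>auto simp: bihol_on_def\<close>)
      have holP: "P x holomorphic_on ball b \<delta>"
        by (rule holomorphic_on_subset[of _ "ball b rP"]) (use rP x \<delta> rpos in \<open>auto simp: bihol_on_def\<close>)
      have hol: "(\<lambda>y. P x y / K x y) holomorphic_on ball b \<delta>"
        using holK holP False by (intro holomorphic_intros) auto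
      have "norm (P x y / K x y) \<le> MP / (norm c * \<delta> / 8)"
      proof (rule maximum_modulus_frontier[of "\<lambda>y. P x y / K x y" "ball b (\<delta>/2)"])
        show "(\<lambda>y. P x y / K x y) holomorphic_on interior (ball b (\<delta>/2))"
          by (rule holomorphic_on_subset[OF hol]) (use \<delta> in \<open>auto simp: interior_open\<close>)
        have "continuous_on (ball b \<delta>) (\<lambda>y. P x y / K x y)" using hol by (rule holomorphic_on_imp_continuous_on)
        then show "continuous_on (closure (ball b (\<delta>/2))) (\<lambda>y. P x y / K x y)"
          by (rule continuous_on_subset) (use \<delta> in auto)
        fix w assume "w \<in> frontier (ball b (\<delta>/2))"
        then have w: "norm (w - b) = \<delta>/2" using \<delta> by (simp add: frontier_ball sphere_def dist_norm norm_minus_commute)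
        then have wb: "w \<in> ball b \<delta>" using \<delta> by (simp add: dist_norm norm_minus_commute)
        have "norm c / 2 * (\<delta>/2) \<le> norm (K x w - K x b)" using sepK[OF x wb, of b] \<delta> w by simp
        also have "\<dots> \<le> norm (K x w) + norm c * \<delta> / 8" using Kb norm_triangle_ineq4[of "K x w" "K x b"] by simp
        finally have Kw: "norm c * \<delta> / 8 \<le> norm (K x w)" by (simp add: field_simps)
        have "norm (P x w) \<le> MP" using rP x wb \<delta> rpos by (auto simp: bihol_on_def)
        then show "norm (P x w / K x w) \<le> MP / (norm c * \<delta> / 8)"
          unfolding norm_divide using Kw c \<delta>(1) MP by (intro frac_le) auto
      qed (use y in auto)
      moreover have "K x y \<noteq> 0" using False y by blast
      ultimately have "norm (P x y) \<le> MP / (norm c * \<delta> / 8) * norm (K x y)"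
        by (simp add: norm_divide divide_le_eq)
      also have "\<dots> \<le> M * norm (K x y)" by (intro mult_right_mono) (auto simp: M_def)
      finally show ?thesis .
    qed
    then show ?case by (simp add: x_def y_def)
  qed
  then show ?thesis by blast
qed

section \<open>Growth along families of germs\<close>

lemma bihol_bigo:
  assumes K: "bihol_at K a b" and x: "(x \<longlongrightarrow> a) F" and y: "(y \<longlongrightarrow> b) F"
  shows "(\<lambda>i. K (x i) (y i)) \<in> O[F](\<lambda>_. 1)"
proof (rule bigoI_tendsto)
  have "((\<lambda>i. (x i, y i)) \<longlongrightarrow> (a, b)) F" using x y by (rule tendsto_Pair)
  from filterlim_compose[OF isCont_tendsto_nhds[OF bihol_at_continuous[OF K]] this]
  show "((\<lambda>i. K (x i) (y i) / 1) \<longlongrightarrow> K a b) F" by simp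
qed simp

lemma first_jet_bigo:
  assumes K: "bihol_at K a b" "(x \<longlongrightarrow> a) F" "(y \<longlongrightarrow> b) F"
    and 1: "x1 \<in> O[F](\<lambda>i. l i)" "y1 \<in> O[F](\<lambda>i. l i)"
  shows "(\<lambda>i. first_jet K (x i) (y i) (x1 i) (y1 i)) \<in> O[F](\<lambda>i. l i)"
  unfolding first_jet_def
  using landau_o.big.mult[OF bihol_bigo[OF bihol_at_dx[OF K(1)] K(2,3)] 1(1)]
    landau_o.big.mult[OF bihol_bigo[OF bihol_at_dy[OF K(1)] K(2,3)] 1(2)]
  by (auto intro!: sum_in_bigo)

lemma second_jet_bigo:
  assumes K: "bihol_at K a b" "(x \<longlongrightarrow> a) F" "(y \<longlongrightarrow> b) F"
    and 1: "x1 \<in> O[F](\<lambda>i. l i)" "y1 \<in> O[F](\<lambda>i. l i)"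
    and 2: "x2 \<in> O[F](\<lambda>i. l i ^ 2)" "y2 \<in> O[F](\<lambda>i. l i ^ 2)"
  shows "(\<lambda>i. second_jet K (x i) (y i) (x1 i) (y1 i) (x2 i) (y2 i)) \<in> O[F](\<lambda>i. l i ^ 2)"
proof -
  note b = bihol_bigo[OF _ K(2,3)]
  have quad: "(\<lambda>i. K (x i) (y i) * (u i * v i)) \<in> O[F](\<lambda>i. l i ^ 2)"
    if "bihol_at K a b" "u \<in> O[F](\<lambda>i. l i)" "v \<in> O[F](\<lambda>i. l i)" for K u v
    using landau_o.big.mult[OF b[OF that(1)] landau_o.big.mult[OF that(2,3)]] by (simp add: power2_eq_square)
  have lin: "(\<lambda>i. K (x i) (y i) * u i) \<in> O[F](\<lambda>i. l i ^ 2)"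
    if "bihol_at K a b" "u \<in> O[F](\<lambda>i. l i ^ 2)" for K u
    using landau_o.big.mult[OF b[OF that(1)] that(2)] by simp
  have dd: "bihol_at (dx (dx K)) a b" "bihol_at (\<lambda>x y. dy (dx K) x y + dx (dy K) x y) a b" "bihol_at (dy (dy K)) a b"
    by (intro bihol_at_plus bihol_at_dx bihol_at_dy K)+
  have "(\<lambda>i. dx K (x i) (y i) * x2 i + dy K (x i) (y i) * y2 i +
      (dx (dx K) (x i) (y i) * (x1 i * x1 i) + (dy (dx K) (x i) (y i) + dx (dy K) (x i) (y i)) * (x1 i * y1 i)
       + dy (dy K) (x i) (y i) * (y1 i * y1 i))) \<in> O[F](\<lambda>i. l i ^ 2)"
    by (intro sum_in_bigo lin quad[OF dd(1)] quad[OF dd(2)] quad[OF dd(3)] bihol_at_dx bihol_at_dy K 1 2)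
  then show ?thesis by (simp add: second_jet_def power2_eq_square mult.assoc)
qed

text \<open>
  A jet differential of order \<open>m\<close> grows like the \<open>m\<close>-th power of the size of the jets, where second
  derivatives count as squares.
\<close>

lemma jet_expression_bigo:
  assumes A: "\<And>\<alpha>1 \<alpha>2 j. (\<lambda>i. A \<alpha>1 \<alpha>2 j (z i)) \<in> O[F](\<lambda>_. 1)"
    and u: "u1 \<in> O[F](\<lambda>i. l i)" "u2 \<in> O[F](\<lambda>i. l i)"
    and w: "w1 \<in> O[F](\<lambda>i. l i ^ 2)" "w2 \<in> O[F](\<lambda>i. l i ^ 2)"
  shows "(\<lambda>i. jet_expression m A (z i) (u1 i) (u2 i) (w1 i) (w2 i)) \<in> O[F](\<lambda>i. l i ^ m)"
  unfolding jet_expression_def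
proof (intro big_sum_in_bigo, clarsimp)
  fix j \<alpha>1 \<alpha>2 assume j: "j \<le> m div 3" "\<alpha>1 + \<alpha>2 = m - 3 * j"
  have det: "(\<lambda>i. u1 i * w2 i - u2 i * w1 i) \<in> O[F](\<lambda>i. l i ^ 3)"
    using sum_in_bigo(2)[OF landau_o.big.mult[OF u(1) w(2)] landau_o.big.mult[OF u(2) w(1)]]
    by (simp add: power3_eq_cube power2_eq_square mult.assoc)
  have "(\<lambda>i. A \<alpha>1 \<alpha>2 j (z i) * u1 i ^ \<alpha>1 * u2 i ^ \<alpha>2 * (u1 i * w2 i - u2 i * w1 i) ^ j)
      \<in> O[F](\<lambda>i. 1 * l i ^ \<alpha>1 * l i ^ \<alpha>2 * (l i ^ 3) ^ j)"
    by (intro landau_o.big.mult landau_o.big_power A u det)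
  moreover have "1 * l i ^ \<alpha>1 * l i ^ \<alpha>2 * (l i ^ 3) ^ j = l i ^ m" for i
  proof -
    have "m = \<alpha>1 + \<alpha>2 + 3 * j" using j by auto
    then show ?thesis by (simp add: power_add power_mult)
  qed
  ultimately show "(\<lambda>i. A \<alpha>1 \<alpha>2 j (z i) * u1 i ^ \<alpha>1 * u2 i ^ \<alpha>2 * (u1 i * w2 i - u2 i * w1 i) ^ j) \<in> O[F](\<lambda>i. l i ^ m)"
    by simp
qed

lemma hom_coords_eq_affine_point:
  assumes "v \<noteq> 0"
  shows "hom_coords v = affine_point x y \<longleftrightarrow> v $ 1 \<noteq> 0 \<and> x = v $ 2 / v $ 1 \<and> y = v $ 3 / v $ 1"
proof -
  have "hom_coords v = affine_point x y \<longleftrightarrow> (\<exists>c. vector [1, x, y] = c *s v)"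
    by (rule hom_coords_eq_iff[OF assms affine_lift(2)])
  also have "\<dots> \<longleftrightarrow> (\<exists>c. 1 = c * v $ 1 \<and> x = c * v $ 2 \<and> y = c * v $ 3)"
    by (simp add: vec_eq_iff forall_3 vector_3)
  also have "\<dots> \<longleftrightarrow> v $ 1 \<noteq> 0 \<and> x = v $ 2 / v $ 1 \<and> y = v $ 3 / v $ 1"
  proof -
    have "1 = c * v $ 1 \<longleftrightarrow> v $ 1 \<noteq> 0 \<and> c = 1 / v $ 1" for c
      by (cases "v $ 1 = 0") (auto simp: eq_divide_eq)
    then show ?thesis by auto
  qed
  finally show ?thesis .
qed

text \<open>
  Near a point \<open>[0 : 1 : \<beta>]\<close> off the curve, \<open>J\<close> has bounded coefficients in coordinates that are holomorphic in
  \<open>s = 1 / x\<close> and \<open>t = y / x\<close>, and the jets of \<open>s\<close> and \<open>t\<close> are not larger than those of \<open>x\<close> and \<open>y\<close>.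
\<close>

lemma plain_form_growth:
  assumes form: "plain_local_form C m J (hom_coords (vector [0, 1, \<beta>]))"
    and nz: "eventually (\<lambda>i. x i \<noteq> 0) F" and lim: "((\<lambda>i. 1 / x i) \<longlongrightarrow> 0) F" "((\<lambda>i. y i / x i) \<longlongrightarrow> \<beta>) F"
    and 1: "x1 \<in> O[F](\<lambda>i. l i)" "y1 \<in> O[F](\<lambda>i. l i)"
    and 2: "x2 \<in> O[F](\<lambda>i. l i ^ 2)" "y2 \<in> O[F](\<lambda>i. l i ^ 2)"
  shows "(\<lambda>i. J (jet_curve (x i) (y i) (x1 i) (y1 i) (x2 i) (y2 i))) \<in> O[F](\<lambda>i. l i ^ m)"
proof -
  obtain U \<phi> A where U: "local_coordinates U \<phi>" "hom_coords (vector [0, 1, \<beta>]) \<in> U"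
    and A: "\<And>\<alpha>1 \<alpha>2 j. mholomorphic_on (A \<alpha>1 \<alpha>2 j) (\<phi> ` U)"
    and J: "\<And>f. curve_germ f \<Longrightarrow> f 0 \<in> U \<Longrightarrow> J f = jet_expression m A (\<phi> (f 0))
        (D1 (\<lambda>\<zeta>. \<phi> (f \<zeta>) $ 1)) (D1 (\<lambda>\<zeta>. \<phi> (f \<zeta>) $ 2)) (D2 (\<lambda>\<zeta>. \<phi> (f \<zeta>) $ 1)) (D2 (\<lambda>\<zeta>. \<phi> (f \<zeta>) $ 2))"
    using form unfolding plain_local_form_def Let_def by blast
  interpret lifted_chart U \<phi> "\<lambda>s t. vector [s, 1, t]"
    by unfold_locales (fact U infinity_lift)+
  define \<sigma> where "\<sigma> i = 1 / x i" for i
  define \<tau> where "\<tau> i = y i / x i" for i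
  define s1 where "s1 i = - (x1 i * \<sigma> i ^ 2)" for i
  define s2 where "s2 i = - (x2 i * \<sigma> i ^ 2) + 2 * x1 i ^ 2 * \<sigma> i ^ 3" for i
  define t1 where "t1 i = y1 i * \<sigma> i - x1 i * \<tau> i * \<sigma> i" for i
  define t2 where "t2 i = y2 i * \<sigma> i - 2 * (y1 i * x1 i) * \<sigma> i ^ 2 - x2 i * \<tau> i * \<sigma> i + 2 * x1 i ^ 2 * \<tau> i * \<sigma> i ^ 2" for i
  note lims = lim[folded \<sigma>_def \<tau>_def]
  have \<sigma>: "\<sigma> \<in> O[F](\<lambda>_. 1)" and \<tau>: "\<tau> \<in> O[F](\<lambda>_. 1)"
    using lims by (auto intro!: bigoI_tendsto)
  have b: "(\<lambda>i. f i * g i) \<in> O[F](h)" if "f \<in> O[F](h)" "g \<in> O[F](\<lambda>_. 1)" for f g h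
    using landau_o.big.mult[OF that] by simp
  have p: "(\<lambda>i. \<sigma> i ^ n) \<in> O[F](\<lambda>_. 1)" for n using landau_o.big_power[OF \<sigma>, of n] by simp
  have sq: "(\<lambda>i. f i * g i) \<in> O[F](\<lambda>i. l i ^ 2)" if "f \<in> O[F](\<lambda>i. l i)" "g \<in> O[F](\<lambda>i. l i)" for f g
    using landau_o.big.mult[OF that] by (simp add: power2_eq_square)
  have x11: "(\<lambda>i. x1 i ^ 2) \<in> O[F](\<lambda>i. l i ^ 2)" using sq[OF 1(1,1)] by (simp add: power2_eq_square)
  have s1: "s1 \<in> O[F](\<lambda>i. l i)" unfolding s1_def[abs_def] using b[OF 1(1) p] by simp
  have t1: "t1 \<in> O[F](\<lambda>i. l i)" unfolding t1_def[abs_def]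
    by (intro sum_in_bigo b \<sigma> \<tau> 1)
  have "(\<lambda>i. 2 * x1 i ^ 2) \<in> O[F](\<lambda>i. l i ^ 2)" "(\<lambda>i. 2 * (y1 i * x1 i)) \<in> O[F](\<lambda>i. l i ^ 2)"
    "(\<lambda>i. - (x2 i * \<sigma> i ^ 2)) \<in> O[F](\<lambda>i. l i ^ 2)"
    using x11 sq[OF 1(2,1)] b[OF 2(1) p] by simp_all
  note q = this
  have s2: "s2 \<in> O[F](\<lambda>i. l i ^ 2)" unfolding s2_def[abs_def] by (intro sum_in_bigo b p q)
  have t2: "t2 \<in> O[F](\<lambda>i. l i ^ 2)" unfolding t2_def[abs_def] by (intro sum_in_bigo b p \<sigma> \<tau> 2 q)
  define G where "G i = jet_expression m A (\<phi> (hom_coords (vector [\<sigma> i, 1, \<tau> i])))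
    (first_jet (coord 1) (\<sigma> i) (\<tau> i) (s1 i) (t1 i)) (first_jet (coord 2) (\<sigma> i) (\<tau> i) (s1 i) (t1 i))
    (second_jet (coord 1) (\<sigma> i) (\<tau> i) (s1 i) (t1 i) (s2 i) (t2 i))
    (second_jet (coord 2) (\<sigma> i) (\<tau> i) (s1 i) (t1 i) (s2 i) (t2 i))" for i
  have GO: "G \<in> O[F](\<lambda>i. l i ^ m)"
    unfolding G_def[abs_def]
    by (intro jet_expression_bigo first_jet_bigo[OF bihol_at_coord[OF U(2)] lims s1 t1]
        second_jet_bigo[OF bihol_at_coord[OF U(2)] lims s1 t1 s2 t2] bihol_bigo[OF bihol_at_coefficient[OF A U(2)] lims])
  have ev: "eventually (\<lambda>i. J (jet_curve (x i) (y i) (x1 i) (y1 i) (x2 i) (y2 i)) = G i) F"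
  proof -
    have "eventually (\<lambda>i. hom_coords (vector [\<sigma> i, 1, \<tau> i]) \<in> U) F"
      using eventually_compose_filterlim[OF eventually_in_domain[OF U(2)] tendsto_Pair[OF lims]] by simp
    with nz show ?thesis
    proof eventually_elim
      case (elim i)
      let ?f = "jet_curve (x i) (y i) (x1 i) (y1 i) (x2 i) (y2 i)"
      let ?x = "quadratic (x i) (x1 i) (x2 i)" and ?y = "quadratic (y i) (y1 i) (y2 i)"
      let ?s = "\<lambda>t. 1 / ?x t" and ?t = "\<lambda>t. ?y t * (1 / ?x t)"
      have x0: "?x 0 \<noteq> 0" using elim by (simp add: quadratic_jet)
      have an: "?s analytic_on {0}" using x0 by (intro analytic_intros quadratic_jet) auto
      have an': "?t analytic_on {0}" by (intro analytic_on_mult quadratic_jet an)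
      have "eventually (\<lambda>t. ?x t \<noteq> 0) (nhds 0)"
        using tendsto_imp_eventually_ne[OF isCont_tendsto_nhds[OF analytic_at_imp_isCont[OF quadratic_jet(1)]] x0] .
      then have f: "\<forall>\<^sub>F t in nhds 0. ?f t = hom_coords (vector [?s t, 1, ?t t])"
        by eventually_elim (unfold jet_curve_def, rule sym,
          simp add: hom_coords_eq_affine_point[OF infinity_lift(2)] vector_3)
      have dom: "hom_coords (vector [?s 0, 1, ?t 0]) \<in> U"
        using elim by (simp add: quadratic_jet \<sigma>_def \<tau>_def)
      have s: "D1 ?s = s1 i" "D2 ?s = s2 i"
        by (simp_all add: reciprocal_jet[OF quadratic_jet(1) x0] quadratic_jet s1_def s2_def \<sigma>_def)
      have t: "D1 ?t = t1 i" "D2 ?t = t2 i"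
        unfolding jet_mult[OF quadratic_jet(1) an] s using elim
        by (simp_all add: quadratic_jet s1_def s2_def t1_def t2_def \<sigma>_def \<tau>_def
            power2_eq_square power3_eq_cube field_simps)
      have s0: "?s 0 = \<sigma> i" "?y 0 * \<sigma> i = \<tau> i" by (simp_all add: quadratic_jet \<sigma>_def \<tau>_def)
      have start: "?f 0 = hom_coords (vector [\<sigma> i, 1, \<tau> i])"
        using germ_start[OF an an' f dom] unfolding s0 .
      have "?f 0 \<in> U" using start elim by simp
      from J[OF germ_curve_germ[OF an an' f dom] this] show "J ?f = G i"
        unfolding germ_D1[OF an an' f dom] germ_D2[OF an an' f dom] s t start s0 G_def .
    qed
  qed
  show ?thesis
    using GO unfolding landau_o.big.in_cong[OF ev] .
qed

section \<open>Boundedness near the curve\<close>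

text \<open>
  Along germs with bounded 2-jets the function is defined on a disc whose radius is independent of
  the germ.
\<close>

lemma holomorphic_along_quadratic:
  assumes K: "bihol_on K a b r M" and xy: "dist a x \<le> r/2" "dist b y \<le> r/2"
    and B: "norm x1 \<le> B" "norm y1 \<le> B" "norm x2 \<le> B" "norm y2 \<le> B"
    and \<rho>: "0 < \<rho>" "\<rho> \<le> 1" "2 * B * \<rho> < r / 2"
  shows "(\<lambda>t. K (quadratic x x1 x2 t) (quadratic y y1 y2 t)) holomorphic_on ball 0 \<rho>"
    and "\<And>t. t \<in> ball 0 \<rho> \<Longrightarrow> quadratic x x1 x2 t \<in> ball a r \<and> quadratic y y1 y2 t \<in> ball b r"
proof -
  have r: "0 < r" using K by (simp add: bihol_on_def)
  have near: "dist c (quadratic c' c1 c2 t) < r"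
    if "t \<in> ball 0 \<rho>" "dist c c' \<le> r/2" "norm c1 \<le> B" "norm c2 \<le> B" for t c c' c1 c2
  proof -
    have t: "norm t \<le> \<rho>" using that by simp
    have "norm (c1 * t) \<le> B * \<rho>"
      unfolding norm_mult using that t \<rho> by (intro mult_mono) (auto intro: order_trans[OF norm_ge_zero])
    moreover have "norm (c2 * t\<^sup>2 / 2) \<le> B * \<rho>"
    proof -
      have "norm t ^ 2 \<le> \<rho> * 1" unfolding power2_eq_square using t \<rho> by (intro mult_mono) auto
      then have "norm c2 * norm t ^ 2 \<le> B * \<rho>"
        using that by (intro mult_mono) (auto intro: order_trans[OF norm_ge_zero])
      moreover have "norm (c2 * t\<^sup>2 / 2) = norm c2 * norm t ^ 2 / 2" by (simp add: norm_mult norm_divide norm_power)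
      moreover have "0 \<le> norm c2 * norm t ^ 2" by simp
      ultimately show ?thesis by linarith
    qed
    ultimately have "norm (c1 * t + c2 * t\<^sup>2 / 2) \<le> 2 * B * \<rho>"
      using norm_triangle_ineq[of "c1 * t" "c2 * t\<^sup>2 / 2"] by simp
    moreover have "dist (quadratic c' c1 c2 t) c' = norm (c1 * t + c2 * t\<^sup>2 / 2)"
      unfolding dist_norm quadratic_def by (simp add: add.assoc)
    ultimately show ?thesis using dist_triangle2[of c "quadratic c' c1 c2 t" c'] that(2) \<rho>(3) by linarith
  qed
  show "quadratic x x1 x2 t \<in> ball a r \<and> quadratic y y1 y2 t \<in> ball b r" if "t \<in> ball 0 \<rho>" for t
    using near[OF that xy(1) B(1,3)] near[OF that xy(2) B(2,4)] by simp
  show "(\<lambda>t. K (quadratic x x1 x2 t) (quadratic y y1 y2 t)) holomorphic_on ball 0 \<rho>"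
    unfolding holomorphic_on_open[OF open_ball]
  proof
    fix t :: complex assume t: "t \<in> ball 0 \<rho>"
    define p q where "p = quadratic x x1 x2 t" and "q = quadratic y y1 y2 t"
    have "dist a p < r" "dist b q < r"
      using near[OF t xy(1) B(1,3)] near[OF t xy(2) B(2,4)] by (simp_all add: p_def q_def)
    then have "bihol_at K p q"
      unfolding bihol_at_def
      using bihol_on_mono[OF K, of p "max (dist a p) (dist b q)" q "r - max (dist a p) (dist b q)"] by auto
    then show "\<exists>D. ((\<lambda>t. K (quadratic x x1 x2 t) (quadratic y y1 y2 t)) has_field_derivative D) (at t)"
      unfolding p_def q_def
      by (intro exI) (rule bihol_at_chain[where x="quadratic x x1 x2" and y="quadratic y y1 y2", OF _ quadratic_deriv quadratic_deriv])
  qed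
qed

text \<open>
  Local equations of the same smooth curve, compared along germs that may start arbitrarily close to
  the curve: their logarithmic derivatives differ by a bounded amount.
\<close>

lemma logD_difference_bigo:
  fixes x y x1 y1 x2 y2 :: "'i \<Rightarrow> complex"
  assumes P: "bihol_at P a b" and K: "bihol_at K a b"
    and PK: "eventually (\<lambda>z. norm (P (fst z) (snd z)) \<le> M1 * norm (K (fst z) (snd z))) (nhds (a, b))"
    and KP: "eventually (\<lambda>z. norm (K (fst z) (snd z)) \<le> M2 * norm (P (fst z) (snd z))) (nhds (a, b))"
    and lim: "(x \<longlongrightarrow> a) F" "(y \<longlongrightarrow> b) F" and nz: "eventually (\<lambda>i. K (x i) (y i) \<noteq> 0) F"
    and jets: "x1 \<in> O[F](\<lambda>_. 1)" "y1 \<in> O[F](\<lambda>_. 1)" "x2 \<in> O[F](\<lambda>_. 1)" "y2 \<in> O[F](\<lambda>_. 1)"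
  defines "along_germ \<equiv> \<lambda>K i t. K (quadratic (x i) (x1 i) (x2 i) t) (quadratic (y i) (y1 i) (y2 i) t)"
  shows "(\<lambda>i. logD1 (along_germ P i) - logD1 (along_germ K i)) \<in> O[F](\<lambda>_. 1)"
    and "(\<lambda>i. logD2 (along_germ P i) - logD2 (along_germ K i)) \<in> O[F](\<lambda>_. 1)"
proof -
  define M where "M = max M1 M2"
  obtain rK MK where rK: "bihol_on K a b rK MK" using K by (auto simp: bihol_at_def)
  obtain rP MP where rP: "bihol_on P a b rP MP" using P by (auto simp: bihol_at_def)
  from eventually_conj[OF PK KP] obtain r0 where r0: "0 < r0"
    and near: "\<And>x y. x \<in> ball a r0 \<Longrightarrow> y \<in> ball b r0 \<Longrightarrow>
      norm (P x y) \<le> M1 * norm (K x y) \<and> norm (K x y) \<le> M2 * norm (P x y)"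
    by (rule eventually_nhds_polydisc) (rule that, assumption, simp only: fst_conv snd_conv)
  define r where "r = min r0 (min rK rP)"
  have r: "0 < r" "r \<le> r0" "r \<le> rK" "r \<le> rP"
    using r0 rK rP by (auto simp: r_def bihol_on_def)
  have K': "bihol_on K a b r MK" and P': "bihol_on P a b r MP"
    by (rule bihol_on_mono[OF rK, of _ 0] bihol_on_mono[OF rP, of _ 0]; use r in simp)+
  have bounds: "norm (P s t) \<le> M * norm (K s t)" "norm (K s t) \<le> M * norm (P s t)"
    if "s \<in> ball a r" "t \<in> ball b r" for s t
  proof -
    have 1: "norm (P s t) \<le> M1 * norm (K s t)" "norm (K s t) \<le> M2 * norm (P s t)"
      using near[of s t] that r(2) by auto
    show "norm (P s t) \<le> M * norm (K s t)"
      by (rule order_trans[OF 1(1)]) (auto simp: M_def intro: mult_right_mono)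
    show "norm (K s t) \<le> M * norm (P s t)"
      by (rule order_trans[OF 1(2)]) (auto simp: M_def intro: mult_right_mono)
  qed
  obtain c1 c2 c3 c4 where c: "\<forall>\<^sub>F i in F. norm (x1 i) \<le> c1" "\<forall>\<^sub>F i in F. norm (y1 i) \<le> c2"
    "\<forall>\<^sub>F i in F. norm (x2 i) \<le> c3" "\<forall>\<^sub>F i in F. norm (y2 i) \<le> c4"
    using jets by (elim landau_o.bigE) simp
  define B where "B = max 0 (max (max c1 c2) (max c3 c4))"
  from c have jB: "\<forall>\<^sub>F i in F. norm (x1 i) \<le> B \<and> norm (y1 i) \<le> B \<and> norm (x2 i) \<le> B \<and> norm (y2 i) \<le> B"
    by eventually_elim (auto simp: B_def)
  define \<rho> where "\<rho> = min 1 (r / (4 * (B + 1)))"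
  have B: "0 \<le> B" by (simp add: B_def)
  have \<rho>: "0 < \<rho>" "\<rho> \<le> 1" using r B by (simp_all add: \<rho>_def)
  have \<rho>3: "2 * B * \<rho> < r / 2"
  proof -
    have "2 * B * \<rho> \<le> 2 * B * (r / (4 * (B + 1)))" using B by (intro mult_left_mono) (auto simp: \<rho>_def)
    also have "\<dots> < r / 2" using B r by (simp add: field_simps)
    finally show ?thesis .
  qed
  have "\<forall>\<^sub>F i in F. dist (x i) a < r / 2" "\<forall>\<^sub>F i in F. dist (y i) b < r / 2"
    by (rule tendstoD[OF lim(1)] tendstoD[OF lim(2)], use r in simp)+
  then have ev: "\<forall>\<^sub>F i in F. norm (logD1 (along_germ P i) - logD1 (along_germ K i)) \<le> M * (M / (\<rho>/4)) \<and>
     norm (logD2 (along_germ P i) - logD2 (along_germ K i)) \<le> M * (2 * M / (\<rho>/4)\<^sup>2) + (M * (M / (\<rho>/4)))\<^sup>2"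
    using jB nz
  proof eventually_elim
    case (elim i)
    then have xy: "dist a (x i) \<le> r/2" "dist b (y i) \<le> r/2" by (simp_all add: dist_commute)
    have j: "norm (x1 i) \<le> B" "norm (y1 i) \<le> B" "norm (x2 i) \<le> B" "norm (y2 i) \<le> B" using elim by auto
    note hK = holomorphic_along_quadratic[OF K' xy j \<rho> \<rho>3] and hP = holomorphic_along_quadratic[OF P' xy j \<rho> \<rho>3]
    have nz0: "along_germ K i 0 \<noteq> 0" using elim by (simp add: along_germ_def quadratic_jet)
    have b: "norm (along_germ P i t) \<le> M * norm (along_germ K i t)" "norm (along_germ K i t) \<le> M * norm (along_germ P i t)"
      if "t \<in> ball 0 \<rho>" for t
      using bounds hK(2)[OF that] by (auto simp: along_germ_def)
    have hol: "along_germ P i holomorphic_on ball 0 \<rho>" "along_germ K i holomorphic_on ball 0 \<rho>"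
      using hK(1) hP(1) by (simp_all add: along_germ_def)
    show ?case
      using logD_difference_bound[OF hol \<rho>(1) b nz0] by blast
  qed
  show "(\<lambda>i. logD1 (along_germ P i) - logD1 (along_germ K i)) \<in> O[F](\<lambda>_. 1)"
    by (rule bigoI[where c="M * (M / (\<rho>/4))"]) (use ev in \<open>auto elim!: eventually_mono\<close>)
  show "(\<lambda>i. logD2 (along_germ P i) - logD2 (along_germ K i)) \<in> O[F](\<lambda>_. 1)"
    by (rule bigoI[where c="M * (2 * M / (\<rho>/4)\<^sup>2) + (M * (M / (\<rho>/4)))\<^sup>2"]) (use ev in \<open>auto elim!: eventually_mono\<close>)
qed

lemma vec2_eq_iff: "(v :: complex^2) = vector [s, t] \<longleftrightarrow> v $ 1 = s \<and> v $ 2 = t"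
  by (simp add: vec_eq_iff forall_2 vector_2)

lemma vec2_bihol: "bihol_at (\<lambda>x y. (vector [x, y] :: complex^2) $ i) a b"
  using exhaust_2[of i] by (auto simp: vector_2 intro: bihol_intros)

text \<open>
  In the coordinates \<open>\<phi>\<close> the curve is \<open>w\<^sub>1 = 0\<close>, so \<open>R\<close>, which vanishes there, is bounded by a multiple of
  \<open>w\<^sub>1\<close>. The inverse chart has a holomorphic lift \<open>g\<close> to \<open>\<complex>\<^sup>3\<close>, which expresses \<open>R\<close> as a function of
  \<open>(w\<^sub>1, w\<^sub>2)\<close>.
\<close>

lemma equation_bounded_by_log_coordinate:
  assumes U: "local_coordinates U \<phi>" "affine_point a b \<in> U"
    and UC: "U \<inter> C = {q \<in> U. \<phi> q $ 1 = 0}"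
    and C: "\<And>x y. affine_point x y \<in> C \<longleftrightarrow> eval2 R x y = 0" and ab: "eval2 R a b = 0"
  shows "\<exists>M. eventually (\<lambda>z. norm (eval2 R (fst z) (snd z)) \<le> M * norm (\<phi> (affine_point (fst z) (snd z)) $ 1)) (nhds (a, b))"
proof -
  interpret lifted_chart U \<phi> "\<lambda>x y. vector [1, x, y]"
    by unfold_locales (fact U affine_lift)+
  define \<psi> where "\<psi> = the_inv_into U \<phi>"
  have inj: "inj_on \<phi> U" and oU: "open (\<phi> ` U)" and \<psi>: "holomorphic_into_p2 \<psi> (\<phi> ` U)"
    using U(1) by (auto simp: local_coordinates_def \<psi>_def)
  have \<psi>\<phi>: "\<psi> (\<phi> q) = q" if "q \<in> U" for q using inj that by (simp add: \<psi>_def the_inv_into_f_f)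
  have \<phi>\<psi>: "\<psi> w \<in> U \<and> \<phi> (\<psi> w) = w" if "w \<in> \<phi> ` U" for w using that \<psi>\<phi> by auto
  have UC': "q \<in> C \<longleftrightarrow> \<phi> q $ 1 = 0" if "q \<in> U" for q using UC that by blast
  define w0 where "w0 = \<phi> (affine_point a b)"
  define c where "c = w0 $ 2"
  have "affine_point a b \<in> C" using C ab by simp
  then have w0: "w0 = vector [0, c]"
    using UC'[OF U(2)] by (simp add: vec2_eq_iff w0_def c_def)
  obtain S g where S: "open S" "w0 \<in> S" and g: "\<And>i. mholomorphic_on (\<lambda>w. g w $ i) S"
    and g\<psi>: "\<And>w. w \<in> S \<Longrightarrow> g w \<noteq> 0 \<and> \<psi> w = hom_coords (g w)"
  proof -
    have "w0 \<in> \<phi> ` U" using U(2) by (simp add: w0_def)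
    from \<psi>[unfolded holomorphic_into_p2_def, rule_format, OF this]
    obtain S g where "open S \<and> w0 \<in> S \<and> (\<forall>i. mholomorphic_on (\<lambda>w. g w $ i) S) \<and>
        (\<forall>w\<in>S. g w \<noteq> 0 \<and> \<psi> w = hom_coords (g w))" by (elim exE)
    then show ?thesis by (intro that[of S g]) auto
  qed
  define V where "V = S \<inter> \<phi> ` U"
  have V: "open V" "w0 \<in> V" using S oU U(2) by (auto simp: V_def w0_def)
  \<comment> \<open>the variable in which \<open>holomorphic_ratio_bound\<close> divides comes second, hence the swapped order\<close>
  define G where "G i u w = g (vector [w, u]) $ i" for i u w
  have G: "bihol_at (G i) c 0" for i
    unfolding G_def[abs_def]
    using bihol_at_flip[OF bihol_at_compose[OF g S(1) vec2_bihol], of 0 c] S(2) w0 by simp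
  have "hom_coords (g w0) = affine_point a b"
    using g\<psi>[OF S(2)] \<psi>\<phi>[OF U(2)] by (simp add: w0_def)
  then have G1: "G 1 c 0 \<noteq> 0"
    using hom_coords_eq_affine_point g\<psi>[OF S(2)] by (auto simp: G_def w0[symmetric])
  define Q where "Q u w = eval2 R (G 2 u w / G 1 u w) (G 3 u w / G 1 u w)" for u w
  have Q: "bihol_at Q c 0"
    unfolding Q_def[abs_def] by (intro bihol_at_compose2[OF bihol_at_eval2] bihol_at_divide G G1)
  have "isCont (\<lambda>z. vector [snd z, fst z] :: complex^2) (c, 0)"
    using bihol_at_continuous[OF bihol_at_flip[OF vec2_bihol]] by (intro isCont_vec_componentwise) simp
  then have evV: "eventually (\<lambda>z. vector [snd z, fst z] \<in> V) (nhds (c, 0))"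
    using topological_tendstoD[OF isCont_tendsto_nhds V(1)] V(2) w0 by fastforce
  have evG: "eventually (\<lambda>z. G 1 (fst z) (snd z) \<noteq> 0) (nhds (c, 0))"
    by (rule bihol_at_eventually_nonzero[OF G G1])
  have *: "\<psi> w = affine_point (g w $ 2 / g w $ 1) (g w $ 3 / g w $ 1)" if "w \<in> V" "g w $ 1 \<noteq> 0" for w
    using g\<psi>[of w] that by (auto simp: V_def hom_coords_eq_affine_point)
  have "\<exists>M. eventually (\<lambda>z. norm (Q (fst z) (snd z)) \<le> M * norm (snd z)) (nhds (c, 0))"
  proof (rule holomorphic_ratio_bound[of "\<lambda>u w. w", OF bihol_at_snd Q])
    show "deriv (\<lambda>w. w) (0::complex) \<noteq> 0" by simp
    show "eventually (\<lambda>z. snd z = 0 \<longrightarrow> Q (fst z) (snd z) = 0) (nhds (c, 0))"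
      using evV evG
    proof eventually_elim
      case (elim z)
      show ?case
      proof
        assume z: "snd z = 0"
        define w :: "complex^2" where "w = vector [0, fst z]"
        have w: "w \<in> V" "g w $ 1 \<noteq> 0" using elim z by (simp_all add: w_def G_def)
        then have "\<psi> w \<in> U" "\<phi> (\<psi> w) = w" using \<phi>\<psi> by (auto simp: V_def)
        moreover have "w $ 1 = 0" by (simp add: w_def vector_2)
        ultimately have "\<psi> w \<in> C" using UC' by simp
        then have "eval2 R (g w $ 2 / g w $ 1) (g w $ 3 / g w $ 1) = 0" unfolding *[OF w] C .
        then show "Q (fst z) (snd z) = 0" unfolding Q_def G_def z w_def .
      qed
    qed
  qed simp
  then obtain M where M: "eventually (\<lambda>z. norm (Q (fst z) (snd z)) \<le> M * norm (snd z)) (nhds (c, 0))" by blast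
  have cont: "isCont (\<lambda>z. (coord 2 (fst z) (snd z), coord 1 (fst z) (snd z))) (a, b)"
    by (intro isCont_Pair bihol_at_continuous bihol_at_coord U)
  have c0: "(coord 2 a b, coord 1 a b) = (c, 0)"
    using w0 by (simp add: coord_def w0_def[symmetric] vector_2)
  have lim: "filterlim (\<lambda>z. (coord 2 (fst z) (snd z), coord 1 (fst z) (snd z))) (nhds (c, 0)) (nhds (a, b))"
    using isCont_tendsto_nhds[OF cont] c0 by simp
  have "eventually (\<lambda>z. norm (eval2 R (fst z) (snd z)) \<le> M * norm (\<phi> (affine_point (fst z) (snd z)) $ 1)) (nhds (a, b))"
    using eventually_in_domain[OF U(2)] eventually_compose_filterlim[OF M lim] eventually_compose_filterlim[OF evV lim]
  proof eventually_elim
    case (elim z)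
    define w where "w = \<phi> (affine_point (fst z) (snd z))"
    have w: "vector [coord 1 (fst z) (snd z), coord 2 (fst z) (snd z)] = w"
      by (rule sym) (simp add: vec2_eq_iff coord_def w_def)
    then have wV: "w \<in> V" using elim by simp
    have "hom_coords (g w) = affine_point (fst z) (snd z)"
      using g\<psi>[of w] wV \<psi>\<phi> elim by (auto simp: V_def w_def)
    then have eq: "g w $ 2 / g w $ 1 = fst z" "g w $ 3 / g w $ 1 = snd z"
      using hom_coords_eq_affine_point g\<psi>[of w] wV by (auto simp: V_def)
    have "Q (coord 2 (fst z) (snd z)) (coord 1 (fst z) (snd z)) = eval2 R (fst z) (snd z)"
      unfolding Q_def G_def w eq ..
    then show ?case using elim by (simp add: coord_def)
  qed
  then show ?thesis by blast
qed

text \<open>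
  The local form near the curve uses the logarithmic derivatives of the coordinate \<open>\<phi>\<^sub>1\<close>; they differ from
  those of \<open>R\<close> by bounded terms, since \<open>\<phi>\<^sub>1 / R\<close> and \<open>R / \<phi>\<^sub>1\<close> are both bounded (the former because the
  gradient of \<open>R\<close> does not vanish).
\<close>

lemma log_form_bounded:
  fixes x y x1 y1 x2 y2 :: "'i \<Rightarrow> complex"
  assumes form: "log_local_form C m J (affine_point a b)"
    and C: "\<And>x y. affine_point x y \<in> C \<longleftrightarrow> eval2 R x y = 0" and ab: "eval2 R a b = 0"
    and smooth: "eval2 (d_x R) a b \<noteq> 0 \<or> eval2 (d_y R) a b \<noteq> 0"
    and lim: "(x \<longlongrightarrow> a) F" "(y \<longlongrightarrow> b) F" and nz: "eventually (\<lambda>i. eval2 R (x i) (y i) \<noteq> 0) F"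
    and jets: "x1 \<in> O[F](\<lambda>_. 1)" "y1 \<in> O[F](\<lambda>_. 1)" "x2 \<in> O[F](\<lambda>_. 1)" "y2 \<in> O[F](\<lambda>_. 1)"
    and log_jets: "(\<lambda>i. logD1 (\<lambda>t. eval2 R (quadratic (x i) (x1 i) (x2 i) t) (quadratic (y i) (y1 i) (y2 i) t))) \<in> O[F](\<lambda>_. 1)"
      "(\<lambda>i. logD2 (\<lambda>t. eval2 R (quadratic (x i) (x1 i) (x2 i) t) (quadratic (y i) (y1 i) (y2 i) t))) \<in> O[F](\<lambda>_. 1)"
  shows "(\<lambda>i. J (jet_curve (x i) (y i) (x1 i) (y1 i) (x2 i) (y2 i))) \<in> O[F](\<lambda>_. 1)"
proof -
  obtain U \<phi> A where U: "local_coordinates U \<phi>" "affine_point a b \<in> U"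
    and UC: "U \<inter> C = {q \<in> U. \<phi> q $ 1 = 0}"
    and A: "\<And>\<alpha>1 \<alpha>2 j. mholomorphic_on (A \<alpha>1 \<alpha>2 j) (\<phi> ` U)"
    and J: "\<And>f. curve_germ f \<Longrightarrow> f 0 \<in> U - C \<Longrightarrow> J f = jet_expression m A (\<phi> (f 0))
        (logD1 (\<lambda>\<zeta>. \<phi> (f \<zeta>) $ 1)) (D1 (\<lambda>\<zeta>. \<phi> (f \<zeta>) $ 2)) (logD2 (\<lambda>\<zeta>. \<phi> (f \<zeta>) $ 1)) (D2 (\<lambda>\<zeta>. \<phi> (f \<zeta>) $ 2))"
    using form unfolding log_local_form_def Let_def by blast
  interpret lifted_chart U \<phi> "\<lambda>x y. vector [1, x, y]"
    by unfold_locales (fact U affine_lift)+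
  have P: "bihol_at (coord 1) a b" and R: "bihol_at (eval2 R) a b"
    by (rule bihol_at_coord[OF U(2)], rule bihol_at_eval2)
  have vanish: "eventually (\<lambda>z. eval2 R (fst z) (snd z) = 0 \<longrightarrow> coord 1 (fst z) (snd z) = 0) (nhds (a, b))"
    using eventually_in_domain[OF U(2)] by eventually_elim (use UC C in \<open>auto simp: coord_def\<close>)
  have "\<exists>M. eventually (\<lambda>z. norm (coord 1 (fst z) (snd z)) \<le> M * norm (eval2 R (fst z) (snd z))) (nhds (a, b))"
  proof (cases "eval2 (d_y R) a b = 0")
    case False
    then show ?thesis
      using DERIV_imp_deriv[OF eval2_has_derivative_y]
      by (intro holomorphic_ratio_bound R P ab vanish) auto
  next
    case True
    then have "eval2 (d_x R) a b \<noteq> 0" using smooth by simp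
    have swap: "filterlim prod.swap (nhds (a, b)) (nhds (b, a))" "filterlim prod.swap (nhds (b, a)) (nhds (a, b))"
      unfolding prod.swap_def by (intro tendsto_Pair tendsto_fst tendsto_snd filterlim_ident
        tendsto_eq_rhs[OF tendsto_snd[OF filterlim_ident]] tendsto_eq_rhs[OF tendsto_fst[OF filterlim_ident]]; simp)+
    have "\<exists>M. eventually (\<lambda>z. norm (coord 1 (snd z) (fst z)) \<le> M * norm (eval2 R (snd z) (fst z))) (nhds (b, a))"
    proof (rule holomorphic_ratio_bound[OF bihol_at_flip[OF R] bihol_at_flip[OF P] ab])
      show "dy (\<lambda>x y. eval2 R y x) b a \<noteq> 0"
        using DERIV_imp_deriv[OF eval2_has_derivative_x] \<open>eval2 (d_x R) a b \<noteq> 0\<close> by simp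
      show "eventually (\<lambda>z. eval2 R (snd z) (fst z) = 0 \<longrightarrow> coord 1 (snd z) (fst z) = 0) (nhds (b, a))"
        using eventually_compose_filterlim[OF vanish swap(1)] by simp
    qed
    then obtain M where "eventually (\<lambda>z. norm (coord 1 (snd z) (fst z)) \<le> M * norm (eval2 R (snd z) (fst z))) (nhds (b, a))" by blast
    from eventually_compose_filterlim[OF this swap(2)] show ?thesis by auto
  qed
  then obtain M1 where M1: "eventually (\<lambda>z. norm (coord 1 (fst z) (snd z)) \<le> M1 * norm (eval2 R (fst z) (snd z))) (nhds (a, b))" by blast
  obtain M2 where "eventually (\<lambda>z. norm (eval2 R (fst z) (snd z)) \<le> M2 * norm (\<phi> (affine_point (fst z) (snd z)) $ 1)) (nhds (a, b))"
    using equation_bounded_by_log_coordinate[OF U UC C ab] by blast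
  then have M2: "eventually (\<lambda>z. norm (eval2 R (fst z) (snd z)) \<le> M2 * norm (coord 1 (fst z) (snd z))) (nhds (a, b))"
    by (simp add: coord_def)
  define p where "p i t = coord 1 (quadratic (x i) (x1 i) (x2 i) t) (quadratic (y i) (y1 i) (y2 i) t)" for i t
  note diff = logD_difference_bigo[OF P R M1 M2 lim nz jets]
  have u1: "(\<lambda>i. logD1 (p i)) \<in> O[F](\<lambda>_. 1)" and w1: "(\<lambda>i. logD2 (p i)) \<in> O[F](\<lambda>_. 1)"
    using sum_in_bigo(1)[OF diff(1) log_jets(1)] sum_in_bigo(1)[OF diff(2) log_jets(2)] by (simp_all add: p_def[abs_def])
  define G where "G i = jet_expression m A (\<phi> (affine_point (x i) (y i)))
    (logD1 (p i)) (first_jet (coord 2) (x i) (y i) (x1 i) (y1 i))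
    (logD2 (p i)) (second_jet (coord 2) (x i) (y i) (x1 i) (y1 i) (x2 i) (y2 i))" for i
  have GO: "G \<in> O[F](\<lambda>i. 1 ^ m)"
    unfolding G_def[abs_def]
    by (intro jet_expression_bigo bihol_bigo[OF bihol_at_coefficient[OF A U(2)] lim] first_jet_bigo[OF bihol_at_coord[OF U(2)] lim]
        second_jet_bigo[OF bihol_at_coord[OF U(2)] lim, where l="\<lambda>_. 1", simplified])
      (simp_all add: u1 w1 jets second_jet_bigo[OF bihol_at_coord[OF U(2)] lim, where l="\<lambda>_. 1", simplified])
  have ev: "eventually (\<lambda>i. J (jet_curve (x i) (y i) (x1 i) (y1 i) (x2 i) (y2 i)) = G i) F"
  proof -
    have "eventually (\<lambda>i. affine_point (x i) (y i) \<in> U) F"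
      using eventually_compose_filterlim[OF eventually_in_domain[OF U(2)] tendsto_Pair[OF lim]] by simp
    with nz show ?thesis
    proof eventually_elim
      case (elim i)
      let ?f = "jet_curve (x i) (y i) (x1 i) (y1 i) (x2 i) (y2 i)"
      let ?x = "quadratic (x i) (x1 i) (x2 i)" and ?y = "quadratic (y i) (y1 i) (y2 i)"
      have f: "\<forall>\<^sub>F t in nhds 0. ?f t = affine_point (?x t) (?y t)" by (simp add: jet_curve_def)
      have dom: "affine_point (?x 0) (?y 0) \<in> U" using elim by (simp add: quadratic_jet)
      note an = quadratic_jet(1)
      note germ = germ_start[OF an an f dom] germ_curve_germ[OF an an f dom]
        germ_D1[OF an an f dom] germ_D2[OF an an f dom]
        jet_cong(3,4)[OF germ_coord[OF an an f dom]]
      have "?f 0 \<in> U - C" using elim C by (simp add: germ quadratic_jet)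
      from J[OF germ(2) this] show "J ?f = G i"
        unfolding germ by (simp add: quadratic_jet G_def p_def[abs_def])
    qed
  qed
  show ?thesis
    using GO unfolding landau_o.big.in_cong[OF ev] by simp
qed

section \<open>The gradient and the points at infinity\<close>

lemma eval3_chain:
  fixes v :: "complex \<Rightarrow> complex^3"
  assumes v: "\<And>i. ((\<lambda>c. v c $ i) has_field_derivative v' i) (at s)"
  shows "((\<lambda>c. eval3 P (v c)) has_field_derivative
    v' 1 * eval3 (d_T P) (v s) + v' 2 * eval3 (d_X P) (v s) + v' 3 * eval3 (d_Y P) (v s)) (at s)"
proof (induction P)
  case 0
  then show ?case by (simp add: eval3_def d_T_def d_X_def d_Y_def)
next
  case (pCons p P)
  have T: "eval3 (d_T (pCons p P)) w = eval2 (d_x p) (w$1) (w$2) + w$3 * eval3 (d_T P) w" for w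
    by (simp add: d_T_def d_x_def map_poly_pCons eval3_pCons)
  have X: "eval3 (d_X (pCons p P)) w = eval2 (d_y p) (w$1) (w$2) + w$3 * eval3 (d_X P) w" for w
    by (simp add: d_X_def d_y_def map_poly_pCons eval3_pCons)
  have Y: "eval3 (d_Y (pCons p P)) w = eval3 P w + w$3 * eval3 (d_Y P) w" for w
  proof -
    have "eval3 (A + B) w = eval3 A w + eval3 B w" for A B by (simp add: eval3_def)
    then show ?thesis by (simp add: d_Y_def pderiv_pCons eval3_pCons eval2_0)
  qed
  have "((\<lambda>c. eval2 p (v c $ 1) (v c $ 2)) has_field_derivative
      eval2 (d_x p) (v s $ 1) (v s $ 2) * v' 1 + eval2 (d_y p) (v s $ 1) (v s $ 2) * v' 2) (at s)"
    using bihol_at_chain[OF bihol_at_eval2 v v]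
    by (simp add: DERIV_imp_deriv[OF eval2_has_derivative_x] DERIV_imp_deriv[OF eval2_has_derivative_y])
  from DERIV_add[OF this DERIV_mult[OF v[of 3] pCons.IH]]
  show ?case
    unfolding eval3_pCons T X Y by (rule DERIV_cong) (simp add: algebra_simps)
qed

lemma vector3_has_derivative:
  assumes "(f has_field_derivative f') (at s)" "(g has_field_derivative g') (at s)" "(h has_field_derivative h') (at s)"
  shows "((\<lambda>c. (vector [f c, g c, h c] :: complex^3) $ i) has_field_derivative (vector [f', g', h'] :: complex^3) $ i) (at s)"
  using exhaust_3[of i] assms by (auto simp: vector_3)

lemma eval2_d_x_dehomogenize: "eval2 (d_x (dehomogenize P)) x y = eval3 (d_X P) (vector [1, x, y])"
proof -
  have "((\<lambda>x. eval3 P (vector [1, x, y])) has_field_derivative eval3 (d_X P) (vector [1, x, y])) (at x)"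
    using eval3_chain[OF vector3_has_derivative[OF DERIV_const DERIV_ident DERIV_const], of P 1 y x] by (simp add: vector_3)
  moreover have "((\<lambda>x. eval3 P (vector [1, x, y])) has_field_derivative eval2 (d_x (dehomogenize P)) x y) (at x)"
    using eval2_has_derivative_x[of "dehomogenize P"] by (simp add: eval2_dehomogenize)
  ultimately show ?thesis using DERIV_unique by fastforce
qed

lemma eval2_d_y_dehomogenize: "eval2 (d_y (dehomogenize P)) x y = eval3 (d_Y P) (vector [1, x, y])"
proof -
  have "((\<lambda>y. eval3 P (vector [1, x, y])) has_field_derivative eval3 (d_Y P) (vector [1, x, y])) (at y)"
    using eval3_chain[OF vector3_has_derivative[OF DERIV_const DERIV_const DERIV_ident], of P 1 x y] by (simp add: vector_3)
  moreover have "((\<lambda>y. eval3 P (vector [1, x, y])) has_field_derivative eval2 (d_y (dehomogenize P)) x y) (at y)"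
    using eval2_has_derivative_y[of "dehomogenize P" x y]
    by (simp add: eval2_dehomogenize[abs_def])
  ultimately show ?thesis using DERIV_unique by fastforce
qed

lemma euler_relation:
  assumes "homogeneous P d"
  shows "v$1 * eval3 (d_T P) v + v$2 * eval3 (d_X P) v + v$3 * eval3 (d_Y P) v = of_nat d * eval3 P v"
proof -
  have "((\<lambda>c. eval3 P (c *s v)) has_field_derivative
      v$1 * eval3 (d_T P) (1 *s v) + v$2 * eval3 (d_X P) (1 *s v) + v$3 * eval3 (d_Y P) (1 *s v)) (at 1)"
    by (rule eval3_chain) (auto intro!: derivative_eq_intros)
  moreover have "((\<lambda>c. eval3 P (c *s v)) has_field_derivative of_nat d * eval3 P v) (at 1)"
    unfolding eval3_scale[OF assms] by (auto intro!: derivative_eq_intros)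
  ultimately show ?thesis using DERIV_unique by fastforce
qed

text \<open>
  Euler's relation recovers the derivative in \<open>T\<close> from those in \<open>X\<close> and \<open>Y\<close>.
\<close>

lemma smooth_affine_gradient:
  assumes "defines_smooth_curve P d" "eval2 (dehomogenize P) a b = 0"
  shows "eval2 (d_x (dehomogenize P)) a b \<noteq> 0 \<or> eval2 (d_y (dehomogenize P)) a b \<noteq> 0"
proof (rule ccontr)
  assume "\<not> ?thesis"
  then have 0: "eval3 (d_X P) (vector [1, a, b]) = 0" "eval3 (d_Y P) (vector [1, a, b]) = 0"
    by (simp_all add: eval2_d_x_dehomogenize eval2_d_y_dehomogenize)
  have h: "homogeneous P d" and P0: "eval3 P (vector [1, a, b]) = 0"
    using assms by (simp_all add: defines_smooth_curve_def eval2_dehomogenize)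
  have "eval3 (d_T P) (vector [1, a, b]) = 0"
    using euler_relation[OF h, of "vector [1, a, b]"] by (simp add: 0 P0 vector_3)
  with 0 P0 assms(1) affine_lift(2) show False unfolding defines_smooth_curve_def by blast
qed

lemma d_x_d_y_commute: "d_x (d_y F) = d_y (d_x F)"
  by (intro poly_eqI) (simp add: d_x_def d_y_def coeff_map_poly coeff_pderiv of_nat_poly pderiv_smult)

text \<open>
  If the form vanished on the line \<open>T = 0\<close>, then so would its derivatives in \<open>X\<close> and \<open>Y\<close> at \<open>[0 : 1 : 0]\<close>, and
  three of the four divisors would meet.
\<close>

lemma infinity_not_contained:
  assumes smooth: "defines_smooth_curve P d" and general: "general_position [P, d_T P, d_X P, d_Y P]"
  shows "\<exists>u. eval3 P (vector [0, 1, u]) \<noteq> 0"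
proof (rule ccontr)
  assume "\<not> ?thesis"
  then have P0: "eval3 P (vector [0, 1, u]) = 0" for u by blast
  let ?v = "vector [0, 1, 0] :: complex^3"
  have v: "?v \<noteq> 0" by (rule infinity_lift(2))
  have h: "homogeneous P d" using smooth by (simp add: defines_smooth_curve_def)
  have "((\<lambda>u. eval3 P (vector [0, 1, u])) has_field_derivative eval3 (d_Y P) ?v) (at 0)"
    using eval3_chain[OF vector3_has_derivative[OF DERIV_const DERIV_const DERIV_ident], of P 0 1 0] by (simp add: vector_3)
  then have Y: "eval3 (d_Y P) ?v = 0" unfolding P0 by (rule DERIV_unique[OF _ DERIV_const])
  have X: "eval3 (d_X P) ?v = 0"
    using euler_relation[OF h, of ?v] P0[of 0] by (simp add: vector_3)
  have "hom_coords ?v \<in> zero_locus Q" if "eval3 Q ?v = 0" for Q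
    using that v unfolding zero_locus_def by blast
  with X Y P0[of 0] have "hom_coords ?v \<in> (\<Inter>i\<in>{0, 2, 3}. zero_locus ([P, d_T P, d_X P, d_Y P] ! i))"
    by (simp add: eval_nat_numeral)
  moreover have card_3: "card {0, 2, 3 :: nat} = 3" by simp
  moreover have "codim_ge (\<Inter>i\<in>{0, 2, 3}. zero_locus ([P, d_T P, d_X P, d_Y P] ! i)) (card {0, 2, 3::nat})"
    using general unfolding general_position_def by (elim allE[of _ "{0, 2, 3}"]) auto
  ultimately show False unfolding codim_ge_def by (simp only: card_3) (auto split: if_splits)
qed

text \<open>
  On the line at infinity the form is a nonzero polynomial in \<open>\<beta>\<close>, so the point at infinity of the
  direction \<open>(1, \<beta>)\<close> lies off the curve for all but finitely many \<open>\<beta>\<close>.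
\<close>

lemma two_directions:
  assumes "\<exists>u. eval3 P (vector [0, 1, u]) \<noteq> 0"
  obtains \<beta>1 \<beta>2 where "\<beta>1 \<noteq> \<beta>2" "eval3 P (vector [0, 1, \<beta>1]) \<noteq> 0" "eval3 P (vector [0, 1, \<beta>2]) \<noteq> 0"
proof -
  define p where "p = (\<Sum>k\<le>degree P. monom (eval2 (coeff P k) 0 1) k)"
  have p: "poly p u = eval3 P (vector [0, 1, u])" for u
    by (simp add: p_def poly_sum poly_monom eval3_altdef vector_3)
  then have "p \<noteq> 0" using assms by auto
  then have fin: "finite {u. poly p u = 0}" by (rule poly_roots_finite)
  obtain \<beta>1 where "\<beta>1 \<notin> {u. poly p u = 0}" using ex_new_if_finite[OF infinite_UNIV_char_0 fin] by blast
  moreover obtain \<beta>2 where "\<beta>2 \<notin> insert \<beta>1 {u. poly p u = 0}"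
    using ex_new_if_finite[OF infinite_UNIV_char_0, of "insert \<beta>1 {u. poly p u = 0}"] fin by blast
  ultimately show ?thesis using that[of \<beta>1 \<beta>2] p by auto
qed

abbreviation on_line :: "poly_xy \<Rightarrow> complex \<Rightarrow> complex \<Rightarrow> complex \<Rightarrow> complex \<Rightarrow> complex"
  where "on_line F x0 y0 \<beta> s \<equiv> eval2 F (x0 + s) (y0 + \<beta> * s)"

text \<open>
  The point of the line with \<open>x = 1 / u\<close> has a lift that tends to \<open>(0, 1, \<beta>)\<close> as \<open>u\<close> tends to 0. If the form
  vanished on the line, it would vanish at the limit.
\<close>

lemma nonzero_on_transversal_line:
  assumes h: "homogeneous P d" and \<beta>: "eval3 P (vector [0, 1, \<beta>]) \<noteq> 0"
  shows "\<exists>s. on_line (dehomogenize P) x0 y0 \<beta> s \<noteq> 0"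
proof (rule ccontr)
  assume "\<not> ?thesis"
  then have 0: "eval3 P (vector [1, x0 + s, y0 + \<beta> * s]) = 0" for s
    by (simp add: eval2_dehomogenize)
  define v where "v u = (vector [u, 1, \<beta> + (y0 - \<beta> * x0) * u] :: complex^3)" for u
  have "eval3 P (v u) = 0" if "u \<noteq> 0" for u
  proof -
    have "v u = u *s vector [1, x0 + (1 / u - x0), y0 + \<beta> * (1 / u - x0)]"
      using that by (simp add: v_def vec_eq_iff forall_3 vector_3 field_simps)
    then show ?thesis by (simp only: eval3_scale[OF h] 0 mult_zero_right)
  qed
  then have "eventually (\<lambda>u. eval3 P (v u) = 0) (at 0)" by (simp add: eventually_at_filter)
  moreover have "isCont (\<lambda>u. eval3 P (v u)) 0"
  proof (rule DERIV_isCont[OF eval3_chain])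
    show "((\<lambda>c. v c $ i) has_field_derivative (if i = 1 then 1 else if i = 2 then 0 else y0 - \<beta> * x0)) (at 0)" for i
      using exhaust_3[of i] by (auto simp: v_def vector_3 intro!: derivative_eq_intros)
  qed
  ultimately have "eval3 P (v 0) = 0"
    unfolding isCont_def by (intro tendsto_unique[OF at_neq_bot _ tendsto_eventually])
  then show False using \<beta> by (simp add: v_def)
qed

section \<open>Polynomials on lines\<close>

lemma eval2_on_line_degree:
  "\<exists>D. \<forall>x0 y0 \<beta>. \<exists>p. degree p \<le> D \<and> (\<forall>s. on_line F x0 y0 \<beta> s = poly p s)"
proof (induction F)
  case 0
  then show ?case by (auto simp: eval2_0 intro!: exI[of _ 0])
next
  case (pCons a F)
  then obtain D where D: "\<And>x0 y0 \<beta>. \<exists>p. degree p \<le> D \<and> (\<forall>s. on_line F x0 y0 \<beta> s = poly p s)" by blast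
  have "\<exists>p. degree p \<le> max (degree a) (D + 1) \<and> (\<forall>s. on_line (pCons a F) x0 y0 \<beta> s = poly p s)" for x0 y0 \<beta>
  proof -
    obtain p where p: "degree p \<le> D" "\<And>s. on_line F x0 y0 \<beta> s = poly p s" using D by blast
    have "degree (pcompose a [:x0, 1:]) \<le> degree a * 1"
      by (rule order_trans[OF degree_pcompose_le]) simp
    moreover have "degree ([:y0, \<beta>:] * p) \<le> 1 + D"
      by (rule order_trans[OF degree_mult_le]) (use p(1) in \<open>auto intro!: add_mono\<close>)
    ultimately have "degree (pcompose a [:x0, 1:] + [:y0, \<beta>:] * p) \<le> max (degree a) (D + 1)"
      by (intro degree_add_le) auto
    moreover have "on_line (pCons a F) x0 y0 \<beta> s = poly (pcompose a [:x0, 1:] + [:y0, \<beta>:] * p) s" for s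
      unfolding eval2_pCons p(2) by (simp add: poly_pcompose algebra_simps)
    ultimately show ?thesis by blast
  qed
  then show ?case by blast
qed

lemma poly_bigo_at_infinity:
  fixes p :: "complex poly"
  assumes "degree p \<le> n"
  shows "poly p \<in> O[at_infinity](\<lambda>s. s ^ n)"
proof -
  have "(\<lambda>s::complex. s ^ k) \<in> O[at_infinity](\<lambda>s. s ^ n)" if "k \<le> n" for k
  proof (rule bigoI[where c=1])
    have "eventually (\<lambda>s::complex. 1 \<le> norm s) at_infinity" by (auto simp: eventually_at_infinity)
    then show "eventually (\<lambda>s::complex. norm (s ^ k) \<le> 1 * norm (s ^ n)) at_infinity"
      by eventually_elim (use that in \<open>simp add: norm_power power_increasing\<close>)
  qed
  then have "(\<lambda>s. coeff p k * s ^ k) \<in> O[at_infinity](\<lambda>s. s ^ n)" if "k \<le> n" for k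
    using that landau_o.big.cmult_in_iff by (cases "coeff p k = 0") auto
  then show ?thesis
    unfolding poly_altdef[abs_def] using assms by (intro big_sum_in_bigo) auto
qed

lemma eventually_poly_nonzero_at_infinity:
  fixes p :: "complex poly"
  assumes "p \<noteq> 0"
  shows "eventually (\<lambda>s. poly p s \<noteq> 0) at_infinity"
proof -
  obtain B where "\<And>s. poly p s = 0 \<Longrightarrow> norm s \<le> B"
    using finite_imp_bounded[OF poly_roots_finite[OF assms]] unfolding bounded_iff by blast
  then have "poly p s \<noteq> 0" if "B + 1 \<le> norm s" for s using that by fastforce
  then show ?thesis unfolding eventually_at_infinity by blast
qed

lemma inverse_poly_bigo_at_infinity:
  fixes p :: "complex poly"
  assumes "p \<noteq> 0"
  shows "(\<lambda>s. 1 / poly p s) \<in> O[at_infinity](\<lambda>_. 1)"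
proof -
  obtain c where c: "c > 0" "eventually (\<lambda>s. c \<le> norm (poly p s)) at_infinity"
  proof (cases "degree p = 0")
    case True
    then obtain a where "p = [:a:]" by (rule degree_eq_zeroE)
    then show ?thesis using that[of "norm a"] assms by auto
  next
    case False
    then show ?thesis
      using that[of 1] assms polyfun_extremal[of "degree p" "coeff p" 1, OF exI[of _ "degree p"]]
      by (simp add: poly_altdef)
  qed
  show ?thesis
  proof (rule bigoI[where c="1 / c"])
    show "eventually (\<lambda>s. norm (1 / poly p s) \<le> 1 / c * norm (1::complex)) at_infinity"
      using c(2) by eventually_elim (use c(1) in \<open>simp add: norm_divide divide_simps\<close>)
  qed
qed

section \<open>Polynomials in two variables\<close>

definition polynomial_fun :: "(complex \<Rightarrow> complex \<Rightarrow> complex) \<Rightarrow> bool" where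
  "polynomial_fun f \<longleftrightarrow> (\<exists>F. f = eval2 F)"

lemma polynomial_fun_const: "polynomial_fun (\<lambda>x y. c)"
  and polynomial_fun_fst: "polynomial_fun (\<lambda>x y. x)"
  and polynomial_fun_snd: "polynomial_fun (\<lambda>x y. y)"
  unfolding polynomial_fun_def
  by (rule exI[of _ "[:[:c:]:]"] exI[of _ "[:[:0, 1:]:]"] exI[of _ "[:0, 1:]"]; simp add: fun_eq_iff eval2_def)+

lemma polynomial_fun_add: "polynomial_fun f \<Longrightarrow> polynomial_fun g \<Longrightarrow> polynomial_fun (\<lambda>x y. f x y + g x y)"
  and polynomial_fun_mult: "polynomial_fun f \<Longrightarrow> polynomial_fun g \<Longrightarrow> polynomial_fun (\<lambda>x y. f x y * g x y)"
proof -
  assume "polynomial_fun f" "polynomial_fun g"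
  then obtain F G where FG: "f = eval2 F" "g = eval2 G" by (auto simp: polynomial_fun_def)
  show "polynomial_fun (\<lambda>x y. f x y + g x y)" unfolding polynomial_fun_def FG
    by (rule exI[of _ "F + G"]) (simp add: fun_eq_iff eval2_add)
  show "polynomial_fun (\<lambda>x y. f x y * g x y)" unfolding polynomial_fun_def FG
    by (rule exI[of _ "F * G"]) (simp add: fun_eq_iff eval2_mult)
qed

lemma polynomial_fun_sum: "(\<And>i. i \<in> I \<Longrightarrow> polynomial_fun (f i)) \<Longrightarrow> polynomial_fun (\<lambda>x y. \<Sum>i\<in>I. f i x y)"
  by (induction I rule: infinite_finite_induct) (auto intro: polynomial_fun_const polynomial_fun_add)

lemma polynomial_fun_poly: "polynomial_fun f \<Longrightarrow> polynomial_fun (\<lambda>x y. poly p (f x y))"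
  by (induction p) (auto intro: polynomial_fun_const polynomial_fun_add polynomial_fun_mult)

text \<open>
  Interpolating in the first variable at \<open>N + 1\<close> nodes gives a polynomial \<open>f\<close> that agrees with \<open>G\<close> for all
  \<open>b\<close> for which no node is exceptional. For the finitely many other \<open>b\<close>, use that \<open>G\<close> is polynomial in \<open>b\<close>
  for fixed \<open>a\<close>.
\<close>

lemma separately_polynomial:
  assumes Z: "\<And>b. finite {a. Z a b}" "\<And>a. finite {b. Z a b}"
    and 1: "\<And>b. \<exists>p. degree p \<le> N \<and> (\<forall>a. \<not> Z a b \<longrightarrow> G a b = poly p a)"
    and 2: "\<And>a. \<exists>p. \<forall>b. \<not> Z a b \<longrightarrow> G a b = poly p b"
  shows "\<exists>f. polynomial_fun f \<and> (\<forall>a b. \<not> Z a b \<longrightarrow> G a b = f a b)"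
proof -
  define t where "t i = (of_nat i :: complex)" for i
  have inj: "inj_on t {..N}" by (auto simp: t_def inj_on_def)
  obtain L where L: "\<And>p j. degree p \<le> N \<Longrightarrow> coeff p j = (\<Sum>i\<le>N. L j i * poly p (t i))"
    using coeff_interpolation[OF inj] by blast
  obtain q where q: "\<And>a b. \<not> Z a b \<Longrightarrow> G a b = poly (q a) b" using 2 by metis
  define f where "f a b = (\<Sum>j\<le>N. (\<Sum>i\<le>N. L j i * poly (q (t i)) b) * a ^ j)" for a b
  have pow: "polynomial_fun (\<lambda>a b. a ^ j)" for j
    by (induction j) (auto intro: polynomial_fun_const polynomial_fun_mult polynomial_fun_fst)
  have f: "polynomial_fun f"
    unfolding f_def[abs_def]
    by (intro polynomial_fun_sum polynomial_fun_mult polynomial_fun_const polynomial_fun_poly polynomial_fun_snd pow)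
  define bad where "bad = (\<Union>i\<le>N. {b. Z (t i) b})"
  have fin: "finite bad" using Z by (auto simp: bad_def)
  have good: "G a b = f a b" if ab: "\<not> Z a b" and b: "b \<notin> bad" for a b
  proof -
    obtain p where p: "degree p \<le> N" "\<And>a. \<not> Z a b \<Longrightarrow> G a b = poly p a" using 1 by blast
    have "poly p (t i) = poly (q (t i)) b" if "i \<le> N" for i
      using b that p(2) q by (auto simp: bad_def)
    then have "coeff p j = (\<Sum>i\<le>N. L j i * poly (q (t i)) b)" for j using L[OF p(1)] by simp
    moreover have "poly p a = (\<Sum>j\<le>N. coeff p j * a ^ j)" 
      using arg_cong[OF poly_as_sum_of_monoms'[OF p(1)], of "\<lambda>p. poly p a"] by (simp add: poly_sum poly_monom)
    ultimately show ?thesis using p(2)[OF ab] by (simp add: f_def)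
  qed
  have "G a b = f a b" if ab: "\<not> Z a b" for a b
  proof -
    define r where "r = (\<Sum>j\<le>N. smult (a ^ j) (\<Sum>i\<le>N. smult (L j i) (q (t i))))"
    have r: "poly r b = f a b" for b by (simp add: r_def f_def poly_sum mult.commute)
    have "{b. poly (q a - r) b \<noteq> 0} \<subseteq> bad \<union> {b. Z a b}"
      using good q r by fastforce
    then have "finite {b. poly (q a - r) b \<noteq> 0}" using fin Z(2) by (meson finite_UnI finite_subset)
    have "q a - r = 0"
    proof (rule ccontr)
      assume "q a - r \<noteq> 0"
      then have "finite {b. poly (q a - r) b = 0}" by (rule poly_roots_finite)
      with \<open>finite {b. poly (q a - r) b \<noteq> 0}\<close> have "finite (UNIV :: complex set)"
        by (rule_tac finite_subset[OF _ finite_UnI]) auto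
      then show False using infinite_UNIV_char_0 by blast
    qed
    then show ?thesis using q[OF ab] r[of b] by simp
  qed
  with f show ?thesis by blast
qed

section \<open>The coefficients of a jet differential\<close>

lemma eval2_germ_jet:
  assumes "x analytic_on {0}" "y analytic_on {0}"
  shows "D1 (\<lambda>t. eval2 R (x t) (y t)) = jet1 R x y" "D2 (\<lambda>t. eval2 R (x t) (y t)) = jet2 R x y"
proof -
  have dx: "deriv (\<lambda>t. eval2 F t b) a = eval2 (d_x F) a b" and dy: "deriv (eval2 F a) b = eval2 (d_y F) a b" for F a b
    by (rule DERIV_imp_deriv[OF eval2_has_derivative_x], rule DERIV_imp_deriv[OF eval2_has_derivative_y])
  show "D1 (\<lambda>t. eval2 R (x t) (y t)) = jet1 R x y"
    by (simp add: bihol_at_jet(1)[OF bihol_at_eval2 assms] dx dy jet1_def along_def mult.commute)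
  show "D2 (\<lambda>t. eval2 R (x t) (y t)) = jet2 R x y"
    by (simp add: bihol_at_jet(2)[OF bihol_at_eval2 assms] dx dy jet2_def along_def d_x_d_y_commute power2_eq_square algebra_simps)
qed

text \<open>
  Every germ off the curve with \<open>R\<^sub>y \<noteq> 0\<close> arises from parameters \<open>(p, q, r)\<close>; this is the change of variables
  that puts \<open>R\<^sub>y\<close> into the denominators.
\<close>

lemma tangent_parameters:
  fixes x y :: "complex \<Rightarrow> complex" and R :: poly_xy
  assumes R: "along R x y \<noteq> 0" and Ry: "along (d_y R) x y \<noteq> 0"
  defines "p \<equiv> D1 x / along (d_y R) x y" and "q \<equiv> jet1 R x y / along R x y / along (d_y R) x y"
    and "r \<equiv> Delta_xR R x y / along (d_y R) x y"
  shows "D1 x = tangent_x R (x 0) (y 0) p" "D1 y = tangent_y R (x 0) (y 0) p q"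
    "D1 x * D2 y - D1 y * D2 x = wronskian R (x 0) (y 0) p q r"
proof -
  have e: "eval2 F (x 0) (y 0) = along F x y" for F by (simp add: along_def)
  show x1: "D1 x = tangent_x R (x 0) (y 0) p" using Ry by (simp add: tangent_x_def p_def e)
  show y1: "D1 y = tangent_y R (x 0) (y 0) p q"
    using R Ry by (simp add: tangent_y_def p_def q_def e jet1_def field_simps)
  define H where "H = hessian_form R (x 0) (y 0) (D1 x) (D1 y)"
  have H: "jet2 R x y = D2 x * along (d_x R) x y + D2 y * along (d_y R) x y + H"
    by (simp add: jet2_def H_def hessian_form_def e power2_eq_square algebra_simps)
  have "along R x y * r + p * (along R x y * q\<^sup>2 * (along (d_y R) x y)\<^sup>2 - H)
      = (D1 x * jet2 R x y - D2 x * jet1 R x y - D1 x * H) / along (d_y R) x y"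
    using R Ry by (simp add: p_def q_def r_def Delta_xR_def log_jet1_def log_jet2_def field_simps power2_eq_square)
  also have "\<dots> = D1 x * D2 y - D1 y * D2 x"
    using Ry unfolding H jet1_def by (simp add: field_simps)
  finally show "D1 x * D2 y - D1 y * D2 x = wronskian R (x 0) (y 0) p q r"
    by (simp add: wronskian_def x1[symmetric] y1[symmetric] H_def e)
qed

text \<open>
  Germs given by bounded parameters and bounded \<open>x''\<close> have bounded logarithmic 2-jets, however close to
  the curve they start.
\<close>

lemma log_jets_of_equation:
  assumes R: "eval2 R a b \<noteq> 0"
    and W: "tangent_x R a b 1 * y2 - tangent_y R a b 1 q * x2 = wronskian R a b 1 q r"
  defines "g \<equiv> \<lambda>t. eval2 R (quadratic a (tangent_x R a b 1) x2 t) (quadratic b (tangent_y R a b 1 q) y2 t)"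
  shows "logD1 g = q * eval2 (d_y R) a b" "logD2 g = r + q * x2"
proof -
  let ?x = "quadratic a (tangent_x R a b 1) x2" and ?y = "quadratic b (tangent_y R a b 1 q) y2"
  have 0: "g 0 = eval2 R a b" by (simp add: g_def quadratic_jet)
  define H where "H = hessian_form R a b (tangent_x R a b 1) (tangent_y R a b 1 q)"
  have D1: "D1 g = eval2 R a b * (q * eval2 (d_y R) a b)"
    unfolding g_def eval2_germ_jet[OF quadratic_jet(1) quadratic_jet(1)] jet1_def
    by (simp add: along_def quadratic_jet tangent_x_def tangent_y_def algebra_simps)
  have "D2 g = x2 * eval2 (d_x R) a b + y2 * eval2 (d_y R) a b + H"
    unfolding g_def eval2_germ_jet[OF quadratic_jet(1) quadratic_jet(1)] jet2_def
    by (simp add: along_def quadratic_jet H_def hessian_form_def power2_eq_square algebra_simps)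
  also have "\<dots> = eval2 R a b * (r + q * x2 + (q * eval2 (d_y R) a b)\<^sup>2)"
    using W unfolding wronskian_def H_def[symmetric]
    by (simp add: tangent_x_def tangent_y_def power2_eq_square algebra_simps)
  finally have D2: "D2 g = eval2 R a b * (r + q * x2 + (q * eval2 (d_y R) a b)\<^sup>2)" .
  show "logD1 g = q * eval2 (d_y R) a b" using R by (simp add: logD1_def D1 0)
  show "logD2 g = r + q * x2" using R by (simp add: logD2_def D1 D2 0 power_mult_distrib)
qed

lemma bihol_tangents:
  "bihol_at (\<lambda>x y. tangent_x R x y p) a b" "bihol_at (\<lambda>x y. tangent_y R x y p q) a b"
  "bihol_at (\<lambda>x y. wronskian R x y p q r) a b"
  unfolding tangent_x_def[abs_def] tangent_y_def[abs_def] wronskian_def[abs_def] hessian_form_def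
  by (intro bihol_intros)+

locale log_jet_section =
  fixes Rhat :: poly_TXY and d m :: nat and J :: "(complex \<Rightarrow> p2) \<Rightarrow> complex"
  assumes smooth: "defines_smooth_curve Rhat d" and J: "log_jet_differential (zero_locus Rhat) m J"
begin

abbreviation "C \<equiv> zero_locus Rhat"
abbreviation "R \<equiv> dehomogenize Rhat"

lemma hom: "homogeneous Rhat d" using smooth by (simp add: defines_smooth_curve_def)

lemma affine_point_in_C: "affine_point x y \<in> C \<longleftrightarrow> eval2 R x y = 0"
  by (simp add: hom_coords_in_zero_locus[OF hom affine_lift(2)] eval2_dehomogenize)

lemma plain: "p \<notin> C \<Longrightarrow> plain_local_form C m J p" and log: "p \<in> C \<Longrightarrow> log_local_form C m J p"
  using J by (simp_all add: log_jet_differential_def)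

definition represents :: "(nat \<Rightarrow> nat \<Rightarrow> complex) \<Rightarrow> complex \<Rightarrow> complex \<Rightarrow> bool" where
  "represents c a b \<longleftrightarrow> (\<forall>f x y p q r. x analytic_on {0} \<and> y analytic_on {0} \<and>
      (\<forall>\<^sub>F t in nhds 0. f t = affine_point (x t) (y t)) \<and> x 0 = a \<and> y 0 = b \<and>
      D1 x = tangent_x R a b p \<and> D1 y = tangent_y R a b p q \<and> D1 x * D2 y - D1 y * D2 x = wronskian R a b p q r \<longrightarrow>
    J f = (\<Sum>k\<le>m div 3. \<Sum>j\<le>m - 3 * k. c j k * p ^ (m - 3 * k - j) * q ^ j * r ^ k))"

definition coefficient :: "nat \<Rightarrow> nat \<Rightarrow> complex \<Rightarrow> complex \<Rightarrow> complex" where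
  "coefficient j k a b = (SOME c. represents c a b) j k"

lemma coefficient:
  assumes "eval2 R a b \<noteq> 0"
  shows "represents (\<lambda>j k. coefficient j k a b) a b"
proof -
  have "\<exists>c. represents c a b"
    unfolding represents_def
    by (rule plain_form_coefficients[OF plain]) (use assms in \<open>simp add: affine_point_in_C\<close>)
  then have "represents (SOME c. represents c a b) a b" by (rule someI_ex)
  then show ?thesis by (simp add: coefficient_def)
qed

text \<open>
  Germs with \<open>p = 1\<close>. Their second derivatives have to solve one linear equation, \<open>second_order_at\<close>, which
  is possible unless \<open>x' = y' = 0\<close>.
\<close>

abbreviation sample_germ where
  "sample_germ a b q x2 y2 \<equiv> jet_curve a b (tangent_x R a b 1) (tangent_y R a b 1 q) x2 y2"

definition second_order_at :: "complex \<Rightarrow> complex \<Rightarrow> complex \<Rightarrow> complex \<Rightarrow> complex \<Rightarrow> complex \<Rightarrow> bool" where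
  "second_order_at a b q r x2 y2 \<longleftrightarrow> tangent_x R a b 1 * y2 - tangent_y R a b 1 q * x2 = wronskian R a b 1 q r"

text \<open>
  The coefficients are fixed linear combinations of values of \<open>J\<close> at finitely many germs with \<open>p = 1\<close>, for any
  choice of the nodes in \<open>q\<close>. In particular they are unique, and all their analytic properties are
  inherited from \<open>J\<close>. The freedom in the nodes serves to avoid \<open>x' = y' = 0\<close>.
\<close>

lemma coefficient_interpolation:
  assumes t: "inj_on t {..m}"
  shows "\<exists>L. \<forall>a b x2 y2. eval2 R a b \<noteq> 0 \<longrightarrow>
      (\<forall>i\<le>m. \<forall>l\<le>m. second_order_at a b (t i) (of_nat l) (x2 i l) (y2 i l)) \<longrightarrow>
    (\<forall>k\<le>m div 3. \<forall>j\<le>m - 3 * k. coefficient j k a b =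
      (\<Sum>i\<le>m. \<Sum>l\<le>m. L j k i l * J (sample_germ a b (t i) (x2 i l) (y2 i l))))"
proof -
  have "inj_on (of_nat :: nat \<Rightarrow> complex) {..m}" by (simp add: inj_on_def)
  from double_coeff_interpolation[OF t this] obtain L where L: "\<And>c P k j.
      (\<And>q r. P q r = (\<Sum>k\<le>m div 3. \<Sum>j\<le>m - 3 * k. c j k * q ^ j * r ^ k)) \<Longrightarrow> k \<le> m div 3 \<Longrightarrow> j \<le> m - 3 * k \<Longrightarrow>
      c j k = (\<Sum>i\<le>m. \<Sum>l\<le>m. L j k i l * P (t i) (of_nat l))" by blast
  have "coefficient j k a b = (\<Sum>i\<le>m. \<Sum>l\<le>m. L j k i l * J (sample_germ a b (t i) (x2 i l) (y2 i l)))"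
    if R: "eval2 R a b \<noteq> 0"
      and W: "\<And>i l. i \<le> m \<Longrightarrow> l \<le> m \<Longrightarrow> second_order_at a b (t i) (of_nat l) (x2 i l) (y2 i l)"
      and kj: "k \<le> m div 3" "j \<le> m - 3 * k" for a b x2 y2 k j
  proof -
    define P where "P q r = (\<Sum>k\<le>m div 3. \<Sum>j\<le>m - 3 * k. coefficient j k a b * q ^ j * r ^ k)" for q r
    have "J (sample_germ a b (t i) (x2 i l) (y2 i l)) = P (t i) (of_nat l)" if "i \<le> m" "l \<le> m" for i l
    proof -
      have "J (sample_germ a b (t i) (x2 i l) (y2 i l)) =
        (\<Sum>k\<le>m div 3. \<Sum>j\<le>m - 3 * k. coefficient j k a b * 1 ^ (m - 3 * k - j) * t i ^ j * of_nat l ^ k)"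
        by (rule coefficient[OF R, unfolded represents_def, rule_format,
            of "quadratic a (tangent_x R a b 1) (x2 i l)" "quadratic b (tangent_y R a b 1 (t i)) (y2 i l)"])
          (use W[OF that] in \<open>simp add: quadratic_jet jet_curve_def second_order_at_def\<close>)
      then show ?thesis by (simp add: P_def)
    qed
    then show ?thesis using L[of P "\<lambda>j k. coefficient j k a b", OF P_def kj] by simp
  qed
  then show ?thesis by (intro exI[of _ L]) blast
qed

lemma bihol_at_coefficient:
  assumes R: "eval2 R a b \<noteq> 0" and kj: "k \<le> m div 3" "j \<le> m - 3 * k"
  shows "bihol_at (coefficient j k) a b"
proof -
  \<comment> \<open>\<open>y' = q R - R\<^sub>x\<close> vanishes at \<open>(a, b)\<close> only for \<open>q = R\<^sub>x / R\<close>, which the nodes avoid\<close>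
  define t where "t i = eval2 (d_x R) a b / eval2 R a b + of_nat (Suc i)" for i
  have t: "inj_on t {..m}" by (simp add: t_def inj_on_def)
  obtain L where L: "\<And>a b x2 y2. eval2 R a b \<noteq> 0 \<Longrightarrow>
      (\<And>i l. i \<le> m \<Longrightarrow> l \<le> m \<Longrightarrow> second_order_at a b (t i) (of_nat l) (x2 i l) (y2 i l)) \<Longrightarrow>
      coefficient j k a b = (\<Sum>i\<le>m. \<Sum>l\<le>m. L j k i l * J (sample_germ a b (t i) (x2 i l) (y2 i l)))"
    using coefficient_interpolation[OF t] kj by blast
  have ty: "tangent_y R a b 1 (t i) \<noteq> 0" for i
  proof -
    have "tangent_y R a b 1 (t i) = eval2 R a b * of_nat (Suc i)"
      using R by (simp add: tangent_y_def t_def field_simps del: of_nat_Suc)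
    then show ?thesis using R by (simp del: of_nat_Suc)
  qed
  define X2 where "X2 i l x y = - wronskian R x y 1 (t i) (of_nat l) / tangent_y R x y 1 (t i)" for i l x y
  have X2: "bihol_at (X2 i l) a b" for i l
    unfolding X2_def[abs_def] by (intro bihol_at_divide bihol_at_uminus bihol_tangents ty)
  have "plain_local_form C m J (affine_point a b)" using plain R by (simp add: affine_point_in_C)
  from plain_form_bihol[OF this bihol_tangents(1) bihol_tangents(2) X2 bihol_at_const[of 0]]
  have "\<forall>i l. \<exists>G. bihol_at G a b \<and> (\<forall>\<^sub>F (x, y) in nhds (a, b). J (sample_germ x y (t i) (X2 i l x y) 0) = G x y)"
    by blast
  then obtain G where G: "\<And>i l. bihol_at (G i l) a b"
    and JG: "\<And>i l. \<forall>\<^sub>F z in nhds (a, b). J (sample_germ (fst z) (snd z) (t i) (X2 i l (fst z) (snd z)) 0) = G i l (fst z) (snd z)"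
    unfolding case_prod_unfold choice_iff by blast
  have nz: "eventually (\<lambda>z. eval2 R (fst z) (snd z) \<noteq> 0) (nhds (a, b))"
    by (rule bihol_at_eventually_nonzero[OF bihol_at_eval2 R])
  have "eventually (\<lambda>z. tangent_y R (fst z) (snd z) 1 (t i) \<noteq> 0) (nhds (a, b))" for i
    by (rule bihol_at_eventually_nonzero[OF bihol_tangents(2) ty])
  then have ty': "eventually (\<lambda>z. \<forall>i\<in>{..m}. tangent_y R (fst z) (snd z) 1 (t i) \<noteq> 0) (nhds (a, b))"
    by (intro eventually_ball_finite) auto
  have JG': "\<forall>\<^sub>F z in nhds (a, b). \<forall>i\<in>{..m}. \<forall>l\<in>{..m}. J (sample_germ (fst z) (snd z) (t i) (X2 i l (fst z) (snd z)) 0) = G i l (fst z) (snd z)"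
    by (intro eventually_ball_finite ballI JG) auto
  show ?thesis
  proof (rule bihol_at_cong)
    show "bihol_at (\<lambda>x y. \<Sum>i\<le>m. \<Sum>l\<le>m. L j k i l * G i l x y) a b" by (intro bihol_intros G)
    show "\<forall>\<^sub>F z in nhds (a, b). coefficient j k (fst z) (snd z) = (\<Sum>i\<le>m. \<Sum>l\<le>m. L j k i l * G i l (fst z) (snd z))"
      using nz ty' JG'
    proof eventually_elim
      case (elim z)
      have "coefficient j k (fst z) (snd z) =
          (\<Sum>i\<le>m. \<Sum>l\<le>m. L j k i l * J (sample_germ (fst z) (snd z) (t i) (X2 i l (fst z) (snd z)) 0))"
        by (rule L) (use elim in \<open>auto simp: second_order_at_def X2_def\<close>)
      also have "\<dots> = (\<Sum>i\<le>m. \<Sum>l\<le>m. L j k i l * G i l (fst z) (snd z))"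
        by (intro sum.cong refl) (use elim in simp)
      finally show ?case .
    qed
  qed
qed

lemma coefficient_bigo:
  fixes x y :: "'i \<Rightarrow> complex"
  assumes t: "inj_on t {..m}" and nz: "eventually (\<lambda>i. eval2 R (x i) (y i) \<noteq> 0) F"
    and germs: "\<And>n l. n \<le> m \<Longrightarrow> l \<le> m \<Longrightarrow> \<exists>x2 y2. eventually (\<lambda>i. second_order_at (x i) (y i) (t n) (of_nat l) (x2 i) (y2 i)) F \<and>
        (\<lambda>i. J (sample_germ (x i) (y i) (t n) (x2 i) (y2 i))) \<in> O[F](g)"
    and kj: "k \<le> m div 3" "j \<le> m - 3 * k"
  shows "(\<lambda>i. coefficient j k (x i) (y i)) \<in> O[F](g)"
proof -
  obtain L where L: "\<And>a b x2 y2. eval2 R a b \<noteq> 0 \<Longrightarrow>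
      (\<And>i l. i \<le> m \<Longrightarrow> l \<le> m \<Longrightarrow> second_order_at a b (t i) (of_nat l) (x2 i l) (y2 i l)) \<Longrightarrow>
      coefficient j k a b = (\<Sum>i\<le>m. \<Sum>l\<le>m. L j k i l * J (sample_germ a b (t i) (x2 i l) (y2 i l)))"
    using coefficient_interpolation[OF t] kj by blast
  have "\<forall>n l. \<exists>x2 y2. n \<le> m \<longrightarrow> l \<le> m \<longrightarrow> eventually (\<lambda>i. second_order_at (x i) (y i) (t n) (of_nat l) (x2 i) (y2 i)) F \<and>
        (\<lambda>i. J (sample_germ (x i) (y i) (t n) (x2 i) (y2 i))) \<in> O[F](g)"
    using germs by blast
  then obtain X2 Y2 where
    W: "\<And>n l. n \<le> m \<Longrightarrow> l \<le> m \<Longrightarrow> eventually (\<lambda>i. second_order_at (x i) (y i) (t n) (of_nat l) (X2 n l i) (Y2 n l i)) F"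
    and bd: "\<And>n l. n \<le> m \<Longrightarrow> l \<le> m \<Longrightarrow> (\<lambda>i. J (sample_germ (x i) (y i) (t n) (X2 n l i) (Y2 n l i))) \<in> O[F](g)"
    unfolding choice_iff by blast
  have W': "eventually (\<lambda>i. \<forall>n\<in>{..m}. \<forall>l\<in>{..m}. second_order_at (x i) (y i) (t n) (of_nat l) (X2 n l i) (Y2 n l i)) F"
    by (intro eventually_ball_finite ballI W) auto
  have ev: "eventually (\<lambda>i. coefficient j k (x i) (y i) =
      (\<Sum>n\<le>m. \<Sum>l\<le>m. L j k n l * J (sample_germ (x i) (y i) (t n) (X2 n l i) (Y2 n l i)))) F"
    using nz W' by eventually_elim (rule L, auto)
  have "(\<lambda>i. L j k n l * J (sample_germ (x i) (y i) (t n) (X2 n l i) (Y2 n l i))) \<in> O[F](g)" if "n \<le> m" "l \<le> m" for n l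
    using bd[OF that] by (cases "L j k n l = 0") auto
  then have "(\<lambda>i. \<Sum>n\<le>m. \<Sum>l\<le>m. L j k n l * J (sample_germ (x i) (y i) (t n) (X2 n l i) (Y2 n l i))) \<in> O[F](g)"
    by (intro big_sum_in_bigo) auto
  then show ?thesis unfolding landau_o.big.in_cong[OF ev] .
qed

text \<open>
  At a point of the curve one of \<open>x' = R\<^sub>y\<close> and \<open>y' = q R - R\<^sub>x\<close> does not vanish, since the gradient of \<open>R\<close> does
  not vanish. So the second derivatives can be chosen holomorphic near the point, and \<open>J\<close> is bounded along
  the resulting germs.
\<close>

lemma coefficient_bounded_near_curve:
  fixes x y :: "'i \<Rightarrow> complex"
  assumes ab: "eval2 R a b = 0" and lim: "(x \<longlongrightarrow> a) F" "(y \<longlongrightarrow> b) F"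
    and nz: "eventually (\<lambda>i. eval2 R (x i) (y i) \<noteq> 0) F"
    and kj: "k \<le> m div 3" "j \<le> m - 3 * k"
  shows "(\<lambda>i. coefficient j k (x i) (y i)) \<in> O[F](\<lambda>_. 1)"
proof (rule coefficient_bigo[where t=of_nat, OF _ nz _ kj])
  show "inj_on (of_nat :: nat \<Rightarrow> complex) {..m}" by (simp add: inj_on_def)
  fix n l :: nat
  define q r :: complex where "q = of_nat n" and "r = of_nat l"
  note B = bihol_bigo[OF _ lim]
  have grad: "eval2 (d_x R) a b \<noteq> 0 \<or> eval2 (d_y R) a b \<noteq> 0" by (rule smooth_affine_gradient[OF smooth ab])
  have "\<exists>X2 Y2. bihol_at X2 a b \<and> bihol_at Y2 a b \<and>
      eventually (\<lambda>i. second_order_at (x i) (y i) q r (X2 (x i) (y i)) (Y2 (x i) (y i))) F"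
  proof (cases "eval2 (d_y R) a b = 0")
    case False
    then have nz: "tangent_x R a b 1 \<noteq> 0" by (simp add: tangent_x_def)
    define Y2 where "Y2 x y = wronskian R x y 1 q r / tangent_x R x y 1" for x y
    have "bihol_at Y2 a b" unfolding Y2_def[abs_def] by (intro bihol_at_divide bihol_tangents nz)
    moreover have "eventually (\<lambda>z. tangent_x R (fst z) (snd z) 1 \<noteq> 0) (nhds (a, b))"
      by (rule bihol_at_eventually_nonzero[OF bihol_tangents(1) nz])
    from eventually_compose_filterlim[OF this tendsto_Pair[OF lim]]
    have "eventually (\<lambda>i. second_order_at (x i) (y i) q r 0 (Y2 (x i) (y i))) F"
      by eventually_elim (simp add: second_order_at_def Y2_def)
    ultimately show ?thesis using bihol_at_const[of 0] by blast
  next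
    case True
    then have nz: "tangent_y R a b 1 q \<noteq> 0" using grad ab by (simp add: tangent_y_def)
    define X2 where "X2 x y = - wronskian R x y 1 q r / tangent_y R x y 1 q" for x y
    have "bihol_at X2 a b" unfolding X2_def[abs_def] by (intro bihol_at_divide bihol_at_uminus bihol_tangents nz)
    moreover have "eventually (\<lambda>z. tangent_y R (fst z) (snd z) 1 q \<noteq> 0) (nhds (a, b))"
      by (rule bihol_at_eventually_nonzero[OF bihol_tangents(2) nz])
    from eventually_compose_filterlim[OF this tendsto_Pair[OF lim]]
    have "eventually (\<lambda>i. second_order_at (x i) (y i) q r (X2 (x i) (y i)) 0) F"
      by eventually_elim (simp add: second_order_at_def X2_def)
    ultimately show ?thesis using bihol_at_const[of 0] by blast
  qed
  then obtain X2 Y2 where XY: "bihol_at X2 a b" "bihol_at Y2 a b"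
    and W: "eventually (\<lambda>i. second_order_at (x i) (y i) q r (X2 (x i) (y i)) (Y2 (x i) (y i))) F" by blast
  define g where "g i t = eval2 R (quadratic (x i) (tangent_x R (x i) (y i) 1) (X2 (x i) (y i)) t)
      (quadratic (y i) (tangent_y R (x i) (y i) 1 q) (Y2 (x i) (y i)) t)" for i t
  have "eventually (\<lambda>i. logD1 (g i) = q * eval2 (d_y R) (x i) (y i) \<and> logD2 (g i) = r + q * X2 (x i) (y i)) F"
    using nz W
    by eventually_elim (use log_jets_of_equation in \<open>simp add: second_order_at_def g_def[abs_def]\<close>)
  then have ev: "eventually (\<lambda>i. logD1 (g i) = q * eval2 (d_y R) (x i) (y i)) F"
    "eventually (\<lambda>i. logD2 (g i) = r + q * X2 (x i) (y i)) F"
    by (auto elim: eventually_mono)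
  have logs: "(\<lambda>i. logD1 (g i)) \<in> O[F](\<lambda>_. 1)" "(\<lambda>i. logD2 (g i)) \<in> O[F](\<lambda>_. 1)"
    unfolding landau_o.big.in_cong[OF ev(1)] landau_o.big.in_cong[OF ev(2)]
    by (intro B bihol_intros XY B[where K="\<lambda>x y. q * eval2 (d_y R) x y"] B[where K="\<lambda>x y. r + q * X2 x y"])+
  have form: "log_local_form C m J (affine_point a b)" using log ab by (simp add: affine_point_in_C)
  have "(\<lambda>i. J (sample_germ (x i) (y i) q (X2 (x i) (y i)) (Y2 (x i) (y i)))) \<in> O[F](\<lambda>_. 1)"
    by (rule log_form_bounded[OF form affine_point_in_C ab grad lim nz B[OF bihol_tangents(1)] B[OF bihol_tangents(2)]
        B[OF XY(1)] B[OF XY(2)] logs[unfolded g_def[abs_def]]])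
  with W show "\<exists>x2 y2. eventually (\<lambda>i. second_order_at (x i) (y i) (of_nat n) (of_nat l) (x2 i) (y2 i)) F \<and>
        (\<lambda>i. J (sample_germ (x i) (y i) (of_nat n) (x2 i) (y2 i))) \<in> O[F](\<lambda>_. 1)"
    unfolding q_def r_def
    by (intro exI[of _ "\<lambda>i. X2 (x i) (y i)"] exI[of _ "\<lambda>i. Y2 (x i) (y i)"] conjI)
qed

text \<open>
  All data of the sample germs are rational in the position, so their size is polynomial along a
  line. The exponent depends on the degrees of \<open>R\<close> and its derivatives and on \<open>m\<close>, but not on the
  line.
\<close>

lemma coefficient_growth:
  "\<exists>N. \<forall>\<beta> x0 y0 k j. eval3 Rhat (vector [0, 1, \<beta>]) \<noteq> 0 \<longrightarrow> k \<le> m div 3 \<longrightarrow> j \<le> m - 3 * k \<longrightarrow>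
    (\<lambda>s. coefficient j k (x0 + s) (y0 + \<beta> * s)) \<in> O[at_infinity](\<lambda>s. s ^ N)"
proof -
  obtain D where D: "\<And>F x0 y0 \<beta>. F \<in> {R, d_x R, d_y R, d_x (d_x R), d_y (d_x R), d_y (d_y R)} \<Longrightarrow>
      (\<lambda>s. on_line F x0 y0 \<beta> s) \<in> O[at_infinity](\<lambda>s. s ^ D)"
  proof -
    have "\<forall>F. \<exists>D. \<forall>x0 y0 \<beta>. \<exists>p. degree p \<le> D \<and> (\<forall>s. on_line F x0 y0 \<beta> s = poly p s)"
      using eval2_on_line_degree by blast
    then obtain E where E: "\<And>F x0 y0 \<beta>. \<exists>p. degree p \<le> E F \<and> (\<forall>s. on_line F x0 y0 \<beta> s = poly p s)"
      unfolding choice_iff by blast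
    define S where "S = {R, d_x R, d_y R, d_x (d_x R), d_y (d_x R), d_y (d_y R)}"
    have "(\<lambda>s. on_line F x0 y0 \<beta> s) \<in> O[at_infinity](\<lambda>s. s ^ Max (E ` S))" if F: "F \<in> S" for F x0 y0 \<beta>
    proof -
      obtain p where p: "degree p \<le> E F" "\<And>s. on_line F x0 y0 \<beta> s = poly p s" using E by blast
      have "E F \<le> Max (E ` S)" using F by (intro Max_ge) (auto simp: S_def)
      then show ?thesis unfolding p(2) using poly_bigo_at_infinity[of p] p(1) by simp
    qed
    then show ?thesis using that unfolding S_def by blast
  qed
  have "(\<lambda>s. coefficient j k (x0 + s) (y0 + \<beta> * s)) \<in> O[at_infinity](\<lambda>s. s ^ (2 * D * m))"
    if \<beta>: "eval3 Rhat (vector [0, 1, \<beta>]) \<noteq> 0" and kj: "k \<le> m div 3" "j \<le> m - 3 * k" for \<beta> x0 y0 k j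
  proof -
    obtain pR where pR: "\<And>s. on_line R x0 y0 \<beta> s = poly pR s" using eval2_on_line_degree[of R] by blast
    obtain pX where pX: "\<And>s. on_line (d_x R) x0 y0 \<beta> s = poly pX s" using eval2_on_line_degree[of "d_x R"] by blast
    have pR0: "pR \<noteq> 0" using nonzero_on_transversal_line[OF hom \<beta>, of x0 y0] by (auto simp: pR)
    \<comment> \<open>at most one \<open>q0\<close> makes \<open>y' = q R - R\<^sub>x\<close> vanish identically on the line; the nodes avoid it\<close>
    define q0 where "q0 = (SOME q. smult q pR = pX)"
    define t where "t i = q0 + of_nat (Suc i)" for i
    have t: "inj_on t {..m}" by (simp add: t_def inj_on_def)
    have tp: "smult (t i) pR - pX \<noteq> 0" for i
    proof
      assume 0: "smult (t i) pR - pX = 0"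
      then have ti: "smult (t i) pR = pX" by (simp only: right_minus_eq)
      then have "smult q0 pR = pX" unfolding q0_def by (rule someI[of "\<lambda>q. smult q pR = pX"])
      with ti have "smult (of_nat (Suc i)) pR = 0"
        unfolding t_def smult_add_left by (simp only: add_cancel_left_right)
      then show False using pR0 by (simp del: of_nat_Suc)
    qed
    note DR = D[of R x0 y0 \<beta>, simplified] and DX = D[of "d_x R" x0 y0 \<beta>, simplified] and DY = D[of "d_y R" x0 y0 \<beta>, simplified]
      and DXX = D[of "d_x (d_x R)" x0 y0 \<beta>, simplified] and DXY = D[of "d_y (d_x R)" x0 y0 \<beta>, simplified]
      and DYY = D[of "d_y (d_y R)" x0 y0 \<beta>, simplified]
    have pw: "(\<lambda>s::complex. s ^ e) \<in> O[at_infinity](\<lambda>s. s ^ e')" if "e \<le> e'" for e e'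
      using poly_bigo_at_infinity[of "monom 1 e" e'] that by (simp add: poly_monom[abs_def] degree_monom_eq)
    have nzR: "eventually (\<lambda>s. on_line R x0 y0 \<beta> s \<noteq> 0) at_infinity"
      unfolding pR by (rule eventually_poly_nonzero_at_infinity[OF pR0])
    show ?thesis
    proof (rule coefficient_bigo[OF t nzR _ kj])
      fix n l :: nat
      define q r :: complex where "q = t n" and "r = of_nat l"
      define x1 where "x1 s = tangent_x R (x0 + s) (y0 + \<beta> * s) 1" for s
      define y1 where "y1 s = tangent_y R (x0 + s) (y0 + \<beta> * s) 1 q" for s
      define w where "w s = wronskian R (x0 + s) (y0 + \<beta> * s) 1 q r" for s
      have mul: "(\<lambda>s. f s * g s) \<in> O[at_infinity](\<lambda>s. s ^ (e + e'))"
        if "f \<in> O[at_infinity](\<lambda>s. s ^ e)" "g \<in> O[at_infinity](\<lambda>s. s ^ e')" for f g :: "complex \<Rightarrow> complex" and e e'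
        using landau_o.big.mult[OF that] by (simp add: power_add)
      have up: "f \<in> O[at_infinity](\<lambda>s. s ^ e')" if "f \<in> O[at_infinity](\<lambda>s. s ^ e)" "e \<le> e'" for f :: "complex \<Rightarrow> complex" and e e'
        using landau_o.big_trans[OF that(1) pw[OF that(2)]] .
      have cm: "(\<lambda>s. c * f s) \<in> O[at_infinity](\<lambda>s. s ^ e)" if "f \<in> O[at_infinity](\<lambda>s. s ^ e)" for f :: "complex \<Rightarrow> complex" and c e
        using that by (cases "c = 0") auto
      have x1: "x1 \<in> O[at_infinity](\<lambda>s. s ^ D)" unfolding x1_def[abs_def] tangent_x_def using DY by simp
      have y1: "y1 \<in> O[at_infinity](\<lambda>s. s ^ D)" unfolding y1_def[abs_def] tangent_y_def
        using sum_in_bigo(2)[OF cm[OF DR, of q] DX] by (simp add: mult.commute)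
      have "(\<lambda>s. r * on_line R x0 y0 \<beta> s + (q ^ 2 * (on_line R x0 y0 \<beta> s *
          (on_line (d_y R) x0 y0 \<beta> s * on_line (d_y R) x0 y0 \<beta> s))
          - ((x1 s * x1 s) * on_line (d_x (d_x R)) x0 y0 \<beta> s + 2 * ((x1 s * y1 s) * on_line (d_y (d_x R)) x0 y0 \<beta> s)
          + (y1 s * y1 s) * on_line (d_y (d_y R)) x0 y0 \<beta> s))) \<in> O[at_infinity](\<lambda>s. s ^ (4 * D))"
        by (intro sum_in_bigo cm up[OF DR] up[OF mul[OF DR mul[OF DY DY]]] up[OF mul[OF mul[OF x1 x1] DXX]]
            up[OF mul[OF mul[OF x1 y1] DXY]] up[OF mul[OF mul[OF y1 y1] DYY]]) auto
      then have w: "w \<in> O[at_infinity](\<lambda>s. s ^ (4 * D))"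
        unfolding w_def[abs_def] wronskian_def hessian_form_def x1_def[symmetric] y1_def[symmetric]
        by (simp add: power2_eq_square algebra_simps)
      define p where "p = smult q pR - pX"
      have p: "p \<noteq> 0" "y1 s = poly p s" for s
        using tp[of n] by (simp_all add: p_def q_def y1_def tangent_y_def pR pX mult.commute)
      have nzy: "eventually (\<lambda>s. y1 s \<noteq> 0) at_infinity"
        unfolding p(2) by (rule eventually_poly_nonzero_at_infinity[OF p(1)])
      \<comment> \<open>with \<open>y'' = 0\<close>; as \<open>1 / y'\<close> is bounded, first derivatives are \<open>O(s\<^bsup>2D\<^esup>)\<close> and second ones \<open>O(s\<^bsup>4D\<^esup>)\<close>\<close>
      define x2 where "x2 s = - (w s * (1 / y1 s))" for s
      have x2: "x2 \<in> O[at_infinity](\<lambda>s. (s ^ (2 * D)) ^ 2)"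
        using landau_o.big.mult[OF w inverse_poly_bigo_at_infinity[OF p(1)]]
        unfolding x2_def[abs_def] p(2) by (simp add: power_mult[symmetric] mult.commute mult.left_commute)
      have W: "eventually (\<lambda>s. second_order_at (x0 + s) (y0 + \<beta> * s) (t n) (of_nat l) (x2 s) 0) at_infinity"
        using nzy by eventually_elim
          (simp add: second_order_at_def x2_def q_def[symmetric] r_def[symmetric] x1_def[symmetric] y1_def[symmetric] w_def[symmetric])
      have "hom_coords (vector [0, 1, \<beta>]) \<notin> C"
        using \<beta> hom_coords_in_zero_locus[OF hom infinity_lift(2)] by simp
      from plain[OF this] have form: "plain_local_form C m J (hom_coords (vector [0, 1, \<beta>]))" .
      have x_inf: "filterlim (\<lambda>s. x0 + s) at_infinity at_infinity"
        by (intro tendsto_add_filterlim_at_infinity[OF tendsto_const] filterlim_ident)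
      have nzx: "eventually (\<lambda>s. x0 + s \<noteq> 0) at_infinity"
        using filterlim_at_infinity_imp_eventually_ne[OF x_inf] .
      have lim1: "((\<lambda>s. 1 / (x0 + s)) \<longlongrightarrow> 0) at_infinity"
        using tendsto_divide_0[OF tendsto_const x_inf] .
      have "((\<lambda>s. \<beta> + (y0 - \<beta> * x0) * (1 / (x0 + s))) \<longlongrightarrow> \<beta> + (y0 - \<beta> * x0) * 0) at_infinity"
        by (intro tendsto_intros lim1)
      moreover have "eventually (\<lambda>s. \<beta> + (y0 - \<beta> * x0) * (1 / (x0 + s)) = (y0 + \<beta> * s) / (x0 + s)) at_infinity"
        using nzx by eventually_elim (simp add: field_simps)
      ultimately have lim2: "((\<lambda>s. (y0 + \<beta> * s) / (x0 + s)) \<longlongrightarrow> \<beta>) at_infinity"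
        by (simp add: tendsto_cong)
      have "(\<lambda>s. J (jet_curve (x0 + s) (y0 + \<beta> * s) (x1 s) (y1 s) (x2 s) 0)) \<in> O[at_infinity](\<lambda>s. (s ^ (2 * D)) ^ m)"
        by (rule plain_form_growth[OF form nzx lim1 lim2 up[OF x1] up[OF y1] x2]) auto
      then have "(\<lambda>s. J (sample_germ (x0 + s) (y0 + \<beta> * s) (t n) (x2 s) 0)) \<in> O[at_infinity](\<lambda>s. s ^ (2 * D * m))"
        by (simp add: x1_def y1_def q_def power_mult)
      with W show "\<exists>x2 y2. eventually (\<lambda>s. second_order_at (x0 + s) (y0 + \<beta> * s) (t n) (of_nat l) (x2 s) (y2 s)) at_infinity \<and>
          (\<lambda>s. J (sample_germ (x0 + s) (y0 + \<beta> * s) (t n) (x2 s) (y2 s))) \<in> O[at_infinity](\<lambda>s. s ^ (2 * D * m))"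
        by (intro exI[of _ x2] exI[of _ "\<lambda>_. 0"] conjI)
    qed
  qed
  then show ?thesis by blast
qed

end

section \<open>Polynomiality of the coefficients\<close>

text \<open>
  Riemann's theorem on removable singularities, followed by Liouville's theorem.
\<close>

lemma entire_of_polynomial_growth:
  fixes h :: "complex \<Rightarrow> complex"
  assumes Z: "finite Z" and h: "\<And>s. s \<notin> Z \<Longrightarrow> h field_differentiable (at s)"
    and bounded: "\<And>z. z \<in> Z \<Longrightarrow> h \<in> O[at z](\<lambda>_. 1)" and growth: "h \<in> O[at_infinity](\<lambda>s. s ^ N)"
  shows "\<exists>p. degree p \<le> N \<and> (\<forall>s. s \<notin> Z \<longrightarrow> h s = poly p s)"
proof -
  have "h holomorphic_on UNIV - Z"
    unfolding holomorphic_on_def using h field_differentiable_at_within by blast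
  from removable_singularities[OF Z _ this bounded]
  obtain g where g: "g holomorphic_on UNIV" and gh: "\<And>s. s \<notin> Z \<Longrightarrow> g s = h s" by auto
  obtain c where "eventually (\<lambda>s. norm (h s) \<le> c * norm (s ^ N)) at_infinity"
    using growth by (elim landau_o.bigE)
  then obtain A where A: "\<And>s. A \<le> norm s \<Longrightarrow> norm (h s) \<le> c * norm s ^ N"
    unfolding eventually_at_infinity norm_power by blast
  obtain B where B: "\<And>s. s \<in> Z \<Longrightarrow> norm s \<le> B"
    using finite_imp_bounded[OF Z] unfolding bounded_iff by blast
  have "norm (g s) \<le> c * norm s ^ N" if "max A (B + 1) \<le> norm s" for s
    using that A[of s] B[of s] gh[of s] by fastforce
  from Liouville_polynomial[OF g this]
  have "g s = (\<Sum>k\<le>N. (deriv ^^ k) g 0 / fact k * s ^ k)" for s by blast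
  moreover define p where "p = (\<Sum>k\<le>N. monom ((deriv ^^ k) g 0 / fact k) k)"
  ultimately have "g s = poly p s" for s by (simp add: poly_sum poly_monom)
  moreover have "degree p \<le> N"
    unfolding p_def by (intro degree_sum_le) (auto intro: order_trans[OF degree_monom_le])
  ultimately show ?thesis using gh by (intro exI[of _ p]) simp
qed

context log_jet_section
begin

lemma finite_curve_on_line:
  assumes "eval3 Rhat (vector [0, 1, \<beta>]) \<noteq> 0"
  shows "finite {s. on_line R x0 y0 \<beta> s = 0}"
proof -
  obtain p where p: "\<And>s. on_line R x0 y0 \<beta> s = poly p s" using eval2_on_line_degree[of R] by blast
  have "p \<noteq> 0" using nonzero_on_transversal_line[OF hom assms, of x0 y0] by (auto simp: p)
  then show ?thesis unfolding p by (rule poly_roots_finite)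
qed

lemma coefficient_polynomial_on_lines:
  "\<exists>N. \<forall>\<beta> x0 y0 k j. eval3 Rhat (vector [0, 1, \<beta>]) \<noteq> 0 \<longrightarrow> k \<le> m div 3 \<longrightarrow> j \<le> m - 3 * k \<longrightarrow>
    (\<exists>p. degree p \<le> N \<and> (\<forall>s. on_line R x0 y0 \<beta> s \<noteq> 0 \<longrightarrow> coefficient j k (x0 + s) (y0 + \<beta> * s) = poly p s))"
proof -
  obtain N where N: "\<And>\<beta> x0 y0 k j. eval3 Rhat (vector [0, 1, \<beta>]) \<noteq> 0 \<Longrightarrow> k \<le> m div 3 \<Longrightarrow> j \<le> m - 3 * k \<Longrightarrow>
    (\<lambda>s. coefficient j k (x0 + s) (y0 + \<beta> * s)) \<in> O[at_infinity](\<lambda>s. s ^ N)"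
    using coefficient_growth by blast
  have "\<exists>p. degree p \<le> N \<and> (\<forall>s. s \<notin> {s. on_line R x0 y0 \<beta> s = 0} \<longrightarrow> coefficient j k (x0 + s) (y0 + \<beta> * s) = poly p s)"
    if \<beta>: "eval3 Rhat (vector [0, 1, \<beta>]) \<noteq> 0" and kj: "k \<le> m div 3" "j \<le> m - 3 * k" for \<beta> x0 y0 k j
  proof (rule entire_of_polynomial_growth[OF finite_curve_on_line[OF \<beta>] _ _ N[OF \<beta> kj]])
    have dx: "((\<lambda>s. x0 + s) has_field_derivative 1) (at s)" and dy: "((\<lambda>s. y0 + \<beta> * s) has_field_derivative \<beta>) (at s)" for s
      by (auto intro!: derivative_eq_intros)
    show "(\<lambda>s. coefficient j k (x0 + s) (y0 + \<beta> * s)) field_differentiable at s"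
      if "s \<notin> {s. on_line R x0 y0 \<beta> s = 0}" for s
      using bihol_at_chain[where x="\<lambda>s. x0 + s" and y="\<lambda>s. y0 + \<beta> * s", OF bihol_at_coefficient[OF _ kj] dx dy] that
      unfolding field_differentiable_def by blast
    show "(\<lambda>s. coefficient j k (x0 + s) (y0 + \<beta> * s)) \<in> O[at z](\<lambda>_. 1)"
      if z: "z \<in> {s. on_line R x0 y0 \<beta> s = 0}" for z
    proof (rule coefficient_bounded_near_curve[OF _ _ _ _ kj])
      show "eval2 R (x0 + z) (y0 + \<beta> * z) = 0" using z by simp
      show "((\<lambda>s. x0 + s) \<longlongrightarrow> x0 + z) (at z)" "((\<lambda>s. y0 + \<beta> * s) \<longlongrightarrow> y0 + \<beta> * z) (at z)"
        by (intro tendsto_intros)+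
      have "z \<notin> {s. on_line R x0 y0 \<beta> s = 0} - {z}" by simp
      moreover have "open (- ({s. on_line R x0 y0 \<beta> s = 0} - {z}))"
        using finite_curve_on_line[OF \<beta>, of x0 y0] by (intro open_Compl finite_imp_closed) simp
      ultimately have "eventually (\<lambda>s. s \<in> - ({s. on_line R x0 y0 \<beta> s = 0} - {z})) (nhds z)"
        by (intro eventually_nhds_in_open) auto
      then show "eventually (\<lambda>s. on_line R x0 y0 \<beta> s \<noteq> 0) (at z)"
        unfolding eventually_at_filter by eventually_elim auto
    qed
  qed
  then show ?thesis by (intro exI[of _ N]) auto
qed

lemma coefficient_polynomial:
  assumes general: "general_position [Rhat, d_T Rhat, d_X Rhat, d_Y Rhat]" and kj: "k \<le> m div 3" "j \<le> m - 3 * k"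
  shows "\<exists>F. \<forall>x y. eval2 R x y \<noteq> 0 \<longrightarrow> coefficient j k x y = eval2 F x y"
proof -
  obtain \<beta>1 \<beta>2 where \<beta>: "\<beta>1 \<noteq> \<beta>2" "eval3 Rhat (vector [0, 1, \<beta>1]) \<noteq> 0" "eval3 Rhat (vector [0, 1, \<beta>2]) \<noteq> 0"
    by (rule two_directions[OF infinity_not_contained[OF smooth general]])
  obtain N where N: "\<And>\<beta> x0 y0. eval3 Rhat (vector [0, 1, \<beta>]) \<noteq> 0 \<Longrightarrow>
      \<exists>p. degree p \<le> N \<and> (\<forall>s. on_line R x0 y0 \<beta> s \<noteq> 0 \<longrightarrow> coefficient j k (x0 + s) (y0 + \<beta> * s) = poly p s)"
    using coefficient_polynomial_on_lines kj by blast
  define Z where "Z a b \<longleftrightarrow> eval2 R (a + b) (\<beta>1 * a + \<beta>2 * b) = 0" for a b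
  define G where "G a b = coefficient j k (a + b) (\<beta>1 * a + \<beta>2 * b)" for a b
  have "\<exists>f. polynomial_fun f \<and> (\<forall>a b. \<not> Z a b \<longrightarrow> G a b = f a b)"
  proof (rule separately_polynomial)
    show "finite {a. Z a b}" for b
      using finite_curve_on_line[OF \<beta>(2), of b "\<beta>2 * b"] by (simp add: Z_def add.commute)
    show "finite {b. Z a b}" for a
      using finite_curve_on_line[OF \<beta>(3), of a "\<beta>1 * a"] by (simp add: Z_def)
    show "\<exists>p. degree p \<le> N \<and> (\<forall>a. \<not> Z a b \<longrightarrow> G a b = poly p a)" for b
      using N[OF \<beta>(2), of b "\<beta>2 * b"] by (simp add: Z_def G_def add.commute)
    show "\<exists>p. \<forall>b. \<not> Z a b \<longrightarrow> G a b = poly p b" for a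
      using N[OF \<beta>(3), of a "\<beta>1 * a"] by (auto simp: Z_def G_def)
  qed
  then obtain H where H: "\<And>a b. \<not> Z a b \<Longrightarrow> G a b = eval2 H a b" unfolding polynomial_fun_def by blast
  \<comment> \<open>back from the coordinates along the two directions to \<open>(x, y)\<close>\<close>
  define A where "A x y = (y - \<beta>2 * x) / (\<beta>1 - \<beta>2)" for x y
  define B where "B x y = (\<beta>1 * x - y) / (\<beta>1 - \<beta>2)" for x y
  have AB: "A x y + B x y = x" "\<beta>1 * A x y + \<beta>2 * B x y = y" for x y
  proof -
    have nz: "\<beta>1 - \<beta>2 \<noteq> 0" using \<beta>(1) by simp
    have "A x y + B x y = ((\<beta>1 - \<beta>2) * x) / (\<beta>1 - \<beta>2)"
      unfolding A_def B_def add_divide_distrib[symmetric] by (simp add: algebra_simps)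
    then show "A x y + B x y = x" using nz by simp
    have "\<beta>1 * A x y + \<beta>2 * B x y = ((\<beta>1 - \<beta>2) * y) / (\<beta>1 - \<beta>2)"
      unfolding A_def B_def times_divide_eq_right add_divide_distrib[symmetric] by (simp add: algebra_simps)
    then show "\<beta>1 * A x y + \<beta>2 * B x y = y" using nz by simp
  qed
  have lin: "polynomial_fun (\<lambda>x y. a * x + b * y)" for a b
    by (intro polynomial_fun_add polynomial_fun_mult polynomial_fun_const polynomial_fun_fst polynomial_fun_snd)
  have A: "polynomial_fun A" "polynomial_fun B"
    using lin[of "- \<beta>2 / (\<beta>1 - \<beta>2)" "1 / (\<beta>1 - \<beta>2)"] lin[of "\<beta>1 / (\<beta>1 - \<beta>2)" "- 1 / (\<beta>1 - \<beta>2)"]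
    by (simp_all add: A_def[abs_def] B_def[abs_def] diff_divide_distrib add.commute)
  have "polynomial_fun (\<lambda>x y. eval2 H (A x y) (B x y))"
  proof (induction H)
    case (pCons a H)
    then show ?case
      using polynomial_fun_add[OF polynomial_fun_poly[OF A(1), of a] polynomial_fun_mult[OF A(2) pCons.IH]]
      by (simp add: eval2_pCons)
  qed (simp add: eval2_0 polynomial_fun_const)
  then obtain F where F: "(\<lambda>x y. eval2 H (A x y) (B x y)) = eval2 F" unfolding polynomial_fun_def by blast
  have "coefficient j k x y = eval2 F x y" if "eval2 R x y \<noteq> 0" for x y
    using H[of "A x y" "B x y"] that by (simp add: Z_def G_def AB F[symmetric])
  then show ?thesis by blast
qed

end

theorem proposition3p1:
  fixes Rhat :: poly_TXY and d m :: nat and R :: poly_xy and C :: "p2 set"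
    and J :: "(complex \<Rightarrow> p2) \<Rightarrow> complex"
  assumes smooth: "defines_smooth_curve Rhat d"
    and C: "C = zero_locus Rhat"
    and general: "general_position [Rhat, d_T Rhat, d_X Rhat, d_Y Rhat]"
    and R: "R = dehomogenize Rhat"
    and J: "log_jet_differential C m J"
  shows "\<exists>F :: nat \<Rightarrow> nat \<Rightarrow> poly_xy.
    \<forall>f x y. x analytic_on {0} \<and> y analytic_on {0} \<and>
        (\<forall>\<^sub>F \<zeta> in nhds 0. f \<zeta> = hom_coords (vector [1, x \<zeta>, y \<zeta>])) \<and>
        f 0 \<notin> C \<and> along (d_y R) x y \<noteq> 0 \<longrightarrow>
      J f = (\<Sum>k\<le>m div 3. \<Sum>j\<le>m - 3 * k.
               along (F j k) x y / along (d_y R) x y ^ (m - 2 * k)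
               * D1 x ^ (m - 3 * k - j) * (jet1 R x y / along R x y) ^ j * Delta_xR R x y ^ k)"
proof -
  interpret log_jet_section Rhat d m J
    using smooth J by unfold_locales (simp_all add: C)
  have "\<exists>F. k \<le> m div 3 \<longrightarrow> j \<le> m - 3 * k \<longrightarrow> (\<forall>x y. eval2 R x y \<noteq> 0 \<longrightarrow> coefficient j k x y = eval2 F x y)" for j k
    using coefficient_polynomial[OF general, of k j] unfolding R by blast
  then have "\<forall>j k. \<exists>F. k \<le> m div 3 \<longrightarrow> j \<le> m - 3 * k \<longrightarrow> (\<forall>x y. eval2 R x y \<noteq> 0 \<longrightarrow> coefficient j k x y = eval2 F x y)"
    by blast
  then obtain F where F: "\<And>j k x y. k \<le> m div 3 \<Longrightarrow> j \<le> m - 3 * k \<Longrightarrow> eval2 R x y \<noteq> 0 \<Longrightarrow>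
      coefficient j k x y = eval2 (F j k) x y"
    unfolding choice_iff by blast
  have "J f = (\<Sum>k\<le>m div 3. \<Sum>j\<le>m - 3 * k.
               along (F j k) x y / along (d_y R) x y ^ (m - 2 * k)
               * D1 x ^ (m - 3 * k - j) * (jet1 R x y / along R x y) ^ j * Delta_xR R x y ^ k)"
    if x: "x analytic_on {0}" and y: "y analytic_on {0}" and f: "\<forall>\<^sub>F \<zeta> in nhds 0. f \<zeta> = affine_point (x \<zeta>) (y \<zeta>)"
      and off: "f 0 \<notin> C" and Ry: "along (d_y R) x y \<noteq> 0" for f x y
  proof -
    have "f 0 = affine_point (x 0) (y 0)" using f by (rule eventually_nhds_x_imp_x)
    then have nz: "eval2 R (x 0) (y 0) \<noteq> 0" using off affine_point_in_C by (simp add: C R)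
    then have "along R x y \<noteq> 0" by (simp add: along_def)
    note par = tangent_parameters[OF this Ry]
    define c where "c = along (d_y R) x y"
    have "J f = (\<Sum>k\<le>m div 3. \<Sum>j\<le>m - 3 * k. coefficient j k (x 0) (y 0) * (D1 x / c) ^ (m - 3 * k - j)
        * (jet1 R x y / along R x y / c) ^ j * (Delta_xR R x y / c) ^ k)"
      using coefficient[of "x 0" "y 0"] nz x y f par unfolding represents_def R c_def by blast
    also have "\<dots> = (\<Sum>k\<le>m div 3. \<Sum>j\<le>m - 3 * k.
               along (F j k) x y / c ^ (m - 2 * k)
               * D1 x ^ (m - 3 * k - j) * (jet1 R x y / along R x y) ^ j * Delta_xR R x y ^ k)"
    proof (intro sum.cong refl)
      fix k j assume kj: "k \<in> {..m div 3}" "j \<in> {..m - 3 * k}"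
      then have e: "m - 2 * k = (m - 3 * k - j) + j + k" by auto
      have co: "coefficient j k (x 0) (y 0) = along (F j k) x y"
        using kj F[OF _ _ nz] by (simp add: along_def)
      show "coefficient j k (x 0) (y 0) * (D1 x / c) ^ (m - 3 * k - j) * (jet1 R x y / along R x y / c) ^ j * (Delta_xR R x y / c) ^ k
        = along (F j k) x y / c ^ (m - 2 * k) * D1 x ^ (m - 3 * k - j) * (jet1 R x y / along R x y) ^ j * Delta_xR R x y ^ k"
        unfolding co e power_add power_divide by simp
    qed
    finally show ?thesis unfolding c_def .
  qed
  then show ?thesis by blast
qed

end
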